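(* Let $\mathcal{G}$ be a finite $2$-player zero-sum game with an interior Nash equilibrium, and consider the stochastically perturbed reinforcement learning process $$dY_{k\alpha}=v_{k\alpha}(X)\,dt+\sigma_{k\alpha}(X)\,dW_{k\alpha},\qquad X_k=Q_k(\eta_kY_k)\qquad(k=1,2,\ \alpha\in\mathcal{A}_k),\tag{SRL}$$ run with learning parameters $\eta_k:[0,\infty)\to(0,\infty)$ that are $C^1$-smooth, nonincreasing, and satisfy $\lim_{t\to\infty}t\eta_k(t)=+\infty$ and $\lim_{t\to\infty}\eta_k(t)=0$, $k=1,2$. Then the time average $\bar X(t)=\frac1t\int_0^tX(s)\,ds$ of (SRL) converges to the set of Nash equilibria of $\mathcal{G}$ (a.s.).
   Context: Game: $\mathcal{N}=\{1,2\}$ is the set of players, $\mathcal{A}_k$ the finite action set of player $k$, $\mathcal{A}=\mathcal{A}_1\times\mathcal{A}_2$, $u_k:\mathcal{A}\to\mathbb{R}$ the payoff functions, extended multilinearly to $\mathcal{X}=\mathcal{X}_1\times\mathcal{X}_2$ with $\mathcal{X}_k=\Delta(\mathcal{A}_k)$ the simplex of mixed strategies. Zero-sum means $u_1+u_2=0$. $v_{k\alpha}(x)=u_k(\alpha;x_{-k})$ and $v_k(x)=(v_{k\alpha}(x))_{\alpha\in\mathcal{A}_k}$. $x^\ast\in\mathcal{X}$ is a Nash equilibrium if $u_k(x^\ast)\ge u_k(x_k,x^\ast_{-k})$ for all $x_k\in\mathcal{X}_k$, $k=1,2$; it is interior if it lies in the relative interior of $\mathcal{X}$ (all coordinates positive).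 (SRL): the $W_{k\alpha}$ are independent standard Wiener processes (across players and strategies) and the diffusion coefficients $\sigma_{k\alpha}:\mathcal{X}\to\mathbb{R}$ are Lipschitz. The choice maps are $Q_k(y_k)=\arg\max_{x_k\in\mathcal{X}_k}\{\langle y_k,x_k\rangle-h_k(x_k)\}$, where the penalty function $h_k:\mathcal{X}_k\to\mathbb{R}$ is continuous on $\mathcal{X}_k$, smooth on the relative interior of every face of $\mathcal{X}_k$, and strongly convex: there is $K>0$ with $h_k(tx_k+(1-t)x_k')\le th_k(x_k)+(1-t)h_k(x_k')-\frac12Kt(1-t)\|x_k'-x_k\|^2$ for all $x_k,x_k'\in\mathcal{X}_k$, $t\in[0,1]$. Convergence to a set means that the distance to the set tends to $0$. *)

theory Defs
  imports "HOL-Probability.Probability"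
begin

section \<open>Two-player games in mixed strategies\<close>

text \<open>The action sets of the two players are two arbitrary finite types.\<close>

definition mixed_strategies :: "(real ^ 'a::finite) set" where
  "mixed_strategies = {x. (\<forall>a. 0 \<le> x $ a) \<and> (\<Sum>a\<in>UNIV. x $ a) = 1}"

definition mixed_profiles :: "((real ^ 'a::finite) \<times> (real ^ 'b::finite)) set" where
  "mixed_profiles = mixed_strategies \<times> mixed_strategies"

definition mixed_payoff ::
    "('a::finite \<Rightarrow> 'b::finite \<Rightarrow> real) \<Rightarrow> (real ^ 'a) \<times> (real ^ 'b) \<Rightarrow> real" where
  "mixed_payoff u x = (\<Sum>a\<in>UNIV. \<Sum>b\<in>UNIV. fst x $ a * snd x $ b * u a b)"

text \<open>\<open>axis a 1\<close> is the vertex of the simplex which represents the pure strategy \<open>a\<close>.\<close>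

definition payoff_vector1 ::
    "('a::finite \<Rightarrow> 'b::finite \<Rightarrow> real) \<Rightarrow> (real ^ 'a) \<times> (real ^ 'b) \<Rightarrow> real ^ 'a" where
  "payoff_vector1 u1 x = (\<chi> a. mixed_payoff u1 (axis a 1, snd x))"

definition payoff_vector2 ::
    "('a::finite \<Rightarrow> 'b::finite \<Rightarrow> real) \<Rightarrow> (real ^ 'a) \<times> (real ^ 'b) \<Rightarrow> real ^ 'b" where
  "payoff_vector2 u2 x = (\<chi> b. mixed_payoff u2 (fst x, axis b 1))"

definition nash_equilibria ::
    "('a::finite \<Rightarrow> 'b::finite \<Rightarrow> real) \<Rightarrow> ('a \<Rightarrow> 'b \<Rightarrow> real) \<Rightarrow> ((real ^ 'a) \<times> (real ^ 'b)) set" where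
  "nash_equilibria u1 u2 =
     {x \<in> mixed_profiles.
        (\<forall>x1 \<in> mixed_strategies. mixed_payoff u1 x \<ge> mixed_payoff u1 (x1, snd x)) \<and>
        (\<forall>x2 \<in> mixed_strategies. mixed_payoff u2 x \<ge> mixed_payoff u2 (fst x, x2))}"

definition zero_sum :: "('a \<Rightarrow> 'b \<Rightarrow> real) \<Rightarrow> ('a \<Rightarrow> 'b \<Rightarrow> real) \<Rightarrow> bool" where
  "zero_sum u1 u2 \<longleftrightarrow> (\<forall>a b. u1 a b + u2 a b = 0)"


section \<open>Penalty functions and choice maps\<close>

text \<open>
  Intended for a set \<open>S\<close> that is open in its affine hull. \<open>Ck_on k S f\<close> says that all iterated
  directional derivatives of \<open>f\<close> up to order \<open>k\<close>, along directions tangent to the affine hull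
  of \<open>S\<close>, exist and are continuous on \<open>S\<close>. This is the usual notion of class \<open>C\<^sup>k\<close> in affine
  coordinates of that hull. The derivatives only see the values of \<open>f\<close> on \<open>S\<close>.
\<close>

primrec Ck_on :: "nat \<Rightarrow> 'v::euclidean_space set \<Rightarrow> ('v \<Rightarrow> real) \<Rightarrow> bool" where
  "Ck_on 0 S f \<longleftrightarrow> continuous_on S f"
| "Ck_on (Suc k) S f \<longleftrightarrow> continuous_on S f \<and>
     (\<forall>p \<in> affine hull S. \<forall>q \<in> affine hull S. \<exists>g.
        (\<forall>x \<in> S. ((\<lambda>t. f (x + t *\<^sub>R (q - p))) has_real_derivative g x) (at 0)) \<and> Ck_on k S g)"

definition smooth_on_relopen :: "'v::euclidean_space set \<Rightarrow> ('v \<Rightarrow> real) \<Rightarrow> bool" where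
  "smooth_on_relopen S f \<longleftrightarrow> (\<forall>k. Ck_on k S f)"

definition strongly_convex_on :: "'v::real_normed_vector set \<Rightarrow> ('v \<Rightarrow> real) \<Rightarrow> bool" where
  "strongly_convex_on S h \<longleftrightarrow>
     (\<exists>K>0. \<forall>x \<in> S. \<forall>x' \<in> S. \<forall>t \<in> {0..1}.
        h (t *\<^sub>R x + (1 - t) *\<^sub>R x')
          \<le> t * h x + (1 - t) * h x' - 1 / 2 * K * t * (1 - t) * (norm (x' - x))\<^sup>2)"

definition penalty_function :: "(real ^ 'a::finite \<Rightarrow> real) \<Rightarrow> bool" where
  "penalty_function h \<longleftrightarrow>
     continuous_on mixed_strategies h \<and>
     (\<forall>C. C face_of mixed_strategies \<longrightarrow> smooth_on_relopen (rel_interior C) h) \<and>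
     strongly_convex_on mixed_strategies h"

text \<open>For a penalty function the maximiser exists and is unique.\<close>

definition choice_map :: "(real ^ 'a::finite \<Rightarrow> real) \<Rightarrow> real ^ 'a \<Rightarrow> real ^ 'a" where
  "choice_map h y = arg_max (\<lambda>x. y \<bullet> x - h x) (\<lambda>x. x \<in> mixed_strategies)"


section \<open>Wiener processes and the It\^o integral\<close>

text \<open>
  Time is \<open>real\<close>, but only times \<open>t \<ge> 0\<close> are ever considered. The usual conditions (completeness
  and right-continuity of the filtration) are not needed.
\<close>

definition filtration_on :: "'w measure \<Rightarrow> (real \<Rightarrow> 'w measure) \<Rightarrow> bool" where
  "filtration_on M F \<longleftrightarrow>
     (\<forall>t\<ge>0. subalgebra M (F t)) \<and> (\<forall>s t. 0 \<le> s \<and> s \<le> t \<longrightarrow> sets (F s) \<subseteq> sets (F t))"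

definition adapted :: "(real \<Rightarrow> 'w measure) \<Rightarrow> (real \<Rightarrow> 'w \<Rightarrow> 'e::topological_space) \<Rightarrow> bool" where
  "adapted F Z \<longleftrightarrow> (\<forall>t\<ge>0. Z t \<in> borel_measurable (F t))"

definition continuous_paths ::
    "'w measure \<Rightarrow> (real \<Rightarrow> 'w \<Rightarrow> 'e::topological_space) \<Rightarrow> bool" where
  "continuous_paths M Z \<longleftrightarrow> (AE \<omega> in M. continuous_on {0..} (\<lambda>t. Z t \<omega>))"

definition standard_wiener ::
    "'w measure \<Rightarrow> (real \<Rightarrow> 'w measure) \<Rightarrow> (real \<Rightarrow> 'w \<Rightarrow> real) \<Rightarrow> bool" where
  "standard_wiener M F B \<longleftrightarrow>
     adapted F B \<and> continuous_paths M B \<and> (AE \<omega> in M. B 0 \<omega> = 0) \<and>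
     (\<forall>s t. 0 \<le> s \<and> s < t \<longrightarrow>
        distributed M lborel (\<lambda>\<omega>. B t \<omega> - B s \<omega>) (normal_density 0 (sqrt (t - s))) \<and>
        prob_space.indep_set M (sets (F s))
          (sets (vimage_algebra (space M) (\<lambda>\<omega>. B t \<omega> - B s \<omega>) borel)))"

text \<open>Each process is Wiener for \<open>F\<close>, and the processes, as random paths, are independent.\<close>

definition independent_wiener ::
    "'w measure \<Rightarrow> (real \<Rightarrow> 'w measure) \<Rightarrow> ('i \<Rightarrow> real \<Rightarrow> 'w \<Rightarrow> real) \<Rightarrow> bool" where
  "independent_wiener M F W \<longleftrightarrow>
     (\<forall>i. standard_wiener M F (W i)) \<and>
     prob_space.indep_vars M (\<lambda>_. PiM {0..} (\<lambda>_. borel)) (\<lambda>i \<omega>. \<lambda>t\<in>{0..}. W i t \<omega>) UNIV"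

text \<open>
  The data \<open>n, \<tau>, \<xi>\<close> encode the simple integrand that takes the value \<open>\<xi> i\<close> on
  \<open>{\<tau> i <.. \<tau> (Suc i)}\<close> for \<open>i < n\<close>, and \<open>0\<close> elsewhere.
\<close>

definition simple_integrand ::
    "(real \<Rightarrow> 'w measure) \<Rightarrow> nat \<Rightarrow> (nat \<Rightarrow> real) \<Rightarrow> (nat \<Rightarrow> 'w \<Rightarrow> real) \<Rightarrow> bool" where
  "simple_integrand F n \<tau> \<xi> \<longleftrightarrow>
     0 \<le> \<tau> 0 \<and> mono \<tau> \<and>
     (\<forall>i<n. \<xi> i \<in> borel_measurable (F (\<tau> i)) \<and> (\<exists>c. \<forall>\<omega> \<in> space (F (\<tau> i)). \<bar>\<xi> i \<omega>\<bar> \<le> c))"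

definition simple_process ::
    "nat \<Rightarrow> (nat \<Rightarrow> real) \<Rightarrow> (nat \<Rightarrow> 'w \<Rightarrow> real) \<Rightarrow> real \<Rightarrow> 'w \<Rightarrow> real" where
  "simple_process n \<tau> \<xi> s \<omega> = (\<Sum>i<n. \<xi> i \<omega> * indicator {\<tau> i <.. \<tau> (Suc i)} s)"

definition simple_integral ::
    "nat \<Rightarrow> (nat \<Rightarrow> real) \<Rightarrow> (nat \<Rightarrow> 'w \<Rightarrow> real) \<Rightarrow> (real \<Rightarrow> 'w \<Rightarrow> real) \<Rightarrow> real \<Rightarrow> 'w \<Rightarrow> real" where
  "simple_integral n \<tau> \<xi> B t \<omega> =
     (\<Sum>i<n. \<xi> i \<omega> * (B (min t (\<tau> (Suc i))) \<omega> - B (min t (\<tau> i)) \<omega>))"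

text \<open>
  \<open>ito_integral M F B H J\<close> says that \<open>J t\<close> is a version of the It\^o integral of \<open>H\<close> against \<open>B\<close>
  over \<open>[0,t]\<close>, for every \<open>t \<ge> 0\<close>. This is the classical \<open>L\<^sup>2\<close> construction: \<open>H\<close> is measurable
  and adapted, it is approximated by simple integrands in \<open>L\<^sup>2(dt \<otimes> dP)\<close> on bounded time intervals,
  and \<open>J t\<close> is the \<open>L\<^sup>2\<close> limit of the elementary integrals. By the It\^o isometry \<open>J t\<close> does not
  depend, up to null sets, on the approximating sequence.
\<close>

definition ito_integral ::
    "'w measure \<Rightarrow> (real \<Rightarrow> 'w measure) \<Rightarrow> (real \<Rightarrow> 'w \<Rightarrow> real) \<Rightarrow>
       (real \<Rightarrow> 'w \<Rightarrow> real) \<Rightarrow> (real \<Rightarrow> 'w \<Rightarrow> real) \<Rightarrow> bool" where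
  "ito_integral M F B H J \<longleftrightarrow>
     adapted F H \<and>
     (\<lambda>(s, \<omega>). H s \<omega>) \<in> borel_measurable (restrict_space borel {0..} \<Otimes>\<^sub>M M) \<and>
     (\<forall>t\<ge>0. J t \<in> borel_measurable M) \<and>
     (\<exists>n \<tau> \<xi>. (\<forall>m. simple_integrand F (n m) (\<tau> m) (\<xi> m)) \<and>
        (\<forall>t\<ge>0.
          (\<lambda>m. \<integral>\<^sup>+\<omega>. (\<integral>\<^sup>+s\<in>{0..t}. ennreal ((simple_process (n m) (\<tau> m) (\<xi> m) s \<omega> - H s \<omega>)\<^sup>2) \<partial>lborel) \<partial>M)
            \<longlonglongrightarrow> 0 \<and>
          (\<lambda>m. \<integral>\<^sup>+\<omega>. ennreal ((simple_integral (n m) (\<tau> m) (\<xi> m) B t \<omega> - J t \<omega>)\<^sup>2) \<partial>M)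
            \<longlonglongrightarrow> 0))"

text \<open>
  \<open>ito_process M F B b s Z\<close>: the continuous adapted real process \<open>Z\<close> satisfies
  \<open>dZ = b dt + s dB\<close>; the initial value \<open>Z 0\<close> may be random.
\<close>

definition ito_process ::
    "'w measure \<Rightarrow> (real \<Rightarrow> 'w measure) \<Rightarrow> (real \<Rightarrow> 'w \<Rightarrow> real) \<Rightarrow>
       (real \<Rightarrow> 'w \<Rightarrow> real) \<Rightarrow> (real \<Rightarrow> 'w \<Rightarrow> real) \<Rightarrow> (real \<Rightarrow> 'w \<Rightarrow> real) \<Rightarrow> bool" where
  "ito_process M F B b s Z \<longleftrightarrow>
     adapted F Z \<and> continuous_paths M Z \<and>
     (\<exists>J. ito_integral M F B s J \<and>
        (\<forall>t\<ge>0. AE \<omega> in M. Z t \<omega> = Z 0 \<omega> + integral {0..t} (\<lambda>r. b r \<omega>) + J t \<omega>))"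


section \<open>Stochastically perturbed reinforcement learning\<close>

definition learning_parameter :: "(real \<Rightarrow> real) \<Rightarrow> bool" where
  "learning_parameter \<eta> \<longleftrightarrow>
     (\<forall>t\<ge>0. 0 < \<eta> t) \<and>
     (\<exists>\<eta>'. (\<forall>t\<ge>0. (\<eta> has_real_derivative \<eta>' t) (at t within {0..})) \<and> continuous_on {0..} \<eta>') \<and>
     antimono_on {0..} \<eta> \<and>
     filterlim (\<lambda>t. t * \<eta> t) at_top at_top \<and>
     (\<eta> \<longlongrightarrow> 0) at_top"

text \<open>
  \<open>Inl a\<close> and \<open>Inr b\<close> index the strategies of players 1 and 2 respectively. \<open>Y1, Y2\<close> are the score
  processes and \<open>X\<close> is the resulting play.
\<close>

definition SRL ::
    "'w measure \<Rightarrow> (real \<Rightarrow> 'w measure) \<Rightarrow> ('a::finite + 'b::finite \<Rightarrow> real \<Rightarrow> 'w \<Rightarrow> real) \<Rightarrow>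
     ('a \<Rightarrow> 'b \<Rightarrow> real) \<Rightarrow> ('a \<Rightarrow> 'b \<Rightarrow> real) \<Rightarrow>
     ('a + 'b \<Rightarrow> (real ^ 'a) \<times> (real ^ 'b) \<Rightarrow> real) \<Rightarrow>
     (real ^ 'a \<Rightarrow> real) \<Rightarrow> (real ^ 'b \<Rightarrow> real) \<Rightarrow> (real \<Rightarrow> real) \<Rightarrow> (real \<Rightarrow> real) \<Rightarrow>
     (real \<Rightarrow> 'w \<Rightarrow> real ^ 'a) \<Rightarrow> (real \<Rightarrow> 'w \<Rightarrow> real ^ 'b) \<Rightarrow>
     (real \<Rightarrow> 'w \<Rightarrow> (real ^ 'a) \<times> (real ^ 'b)) \<Rightarrow> bool" where
  "SRL M F W u1 u2 \<sigma> h1 h2 \<eta>1 \<eta>2 Y1 Y2 X \<longleftrightarrow>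
     (\<forall>a. ito_process M F (W (Inl a))
            (\<lambda>t \<omega>. payoff_vector1 u1 (X t \<omega>) $ a) (\<lambda>t \<omega>. \<sigma> (Inl a) (X t \<omega>)) (\<lambda>t \<omega>. Y1 t \<omega> $ a)) \<and>
     (\<forall>b. ito_process M F (W (Inr b))
            (\<lambda>t \<omega>. payoff_vector2 u2 (X t \<omega>) $ b) (\<lambda>t \<omega>. \<sigma> (Inr b) (X t \<omega>)) (\<lambda>t \<omega>. Y2 t \<omega> $ b)) \<and>
     (\<forall>t\<ge>0. \<forall>\<omega> \<in> space M.
        X t \<omega> = (choice_map h1 (\<eta>1 t *\<^sub>R Y1 t \<omega>), choice_map h2 (\<eta>2 t *\<^sub>R Y2 t \<omega>)))"

definition time_average :: "(real \<Rightarrow> 'w \<Rightarrow> 'e::euclidean_space) \<Rightarrow> real \<Rightarrow> 'w \<Rightarrow> 'e" where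
  "time_average X t \<omega> = (1 / t) *\<^sub>R integral {0..t} (\<lambda>s. X s \<omega>)"

end

theory Submission
  imports Defs
begin

text \<open>
  No regret by discretisation. Sample the scores of one player on a grid of mesh \<open>1/k\<close>. Convexity of
  the smoothed maximum bounds \<open>Y T $ a - \<Sum>\<^sub>n (Y (t\<^sub>n\<^sub>+\<^sub>1) - Y t\<^sub>n) \<bullet> X t\<^sub>n\<close> by
  \<open>O(1 / \<eta> T)\<close> plus a sum of remainders of conditional size \<open>O(\<eta> / k)\<close>. The noise terms and the compensated
  remainders have second moment \<open>O(T)\<close> uniformly in \<open>k\<close>, so, by Fatou's lemma in \<open>k\<close>, at times \<open>T = m\<^sup>2\<close>
  they are almost surely \<open>o(T)\<close> for infinitely many \<open>k\<close>. Letting \<open>k\<close> tend to infinity for fixed \<open>T\<close> turns the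
  drift sum into \<open>\<integral>\<^sub>0\<^sup>T v \<bullet> X\<close>; no chain rule for stochastic integrals is needed. In a zero-sum game the two no-regret
  bounds add up to a vanishing duality gap of the time average.
\<close>

section \<open>Choice maps and the discrete regret bound\<close>

text \<open>The stochastic integral is given as an \<open>L2\<close> limit at each fixed time, and
  \<open>choice_map\<close> is only Lipschitz. The estimates are therefore second-moment estimates
  at finitely many times, in place of pathwise calculus or maximal inequalities. The one-step
  remainder carries two bounds in the score increment: the quadratic one makes its conditional mean
  \<open>O(\<eta> / k)\<close>, the linear one makes its second moment \<open>O(1 / k)\<close>.
  Restricting to \<open>T = m^2\<close> makes the ratios \<open>O(T) / T^2\<close> from Chebyshev's
  inequality summable; the gaps between squares are \<open>o(T)\<close> and the integrand is
  bounded, so nothing is lost. A good \<open>k\<close> may depend on \<open>T\<close> and on the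
  path, which is harmless because the drift sum converges for fixed \<open>T\<close>. The two limits
  imposed on \<eta> serve two terms: \<open>t * \<eta> t\<close> tending to infinity absorbs the
  penalty \<open>O(1 / \<eta> T)\<close>, and \<eta> tending to 0 makes the averaged remainders
  vanish. The regrets are against pure strategies; when those of the two players are added, the
  realised payoffs cancel and the sum is linear in the play, so it can be evaluated at the time
  average.\<close>

lemma axis_mixed_strategies: "axis a 1 \<in> mixed_strategies"
proof -
  have "(\<Sum>i\<in>UNIV. axis a (1::real) $ i) = (\<Sum>i\<in>UNIV. if i = a then 1 else 0)"
    by (rule sum.cong) (auto simp: axis_def)
  then show ?thesis by (auto simp: mixed_strategies_def axis_def)
qed

lemma mixed_strategies_nonempty: "mixed_strategies \<noteq> {}"
  using axis_mixed_strategies by blast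

lemma mixed_strategies_le_1: "x \<in> mixed_strategies \<Longrightarrow> x $ a \<le> 1"
  by (metis (mono_tags, lifting) finite mem_Collect_eq member_le_sum mixed_strategies_def UNIV_I)

lemma norm_mixed_strategies_le_1:
  fixes x :: "real ^ 'a::finite"
  assumes "x \<in> mixed_strategies"
  shows "norm x \<le> 1"
proof -
  have "norm x \<le> (\<Sum>a\<in>UNIV. \<bar>x $ a\<bar>)"
    by (rule norm_le_l1_cart)
  also have "\<dots> = 1"
    using assms by (simp add: mixed_strategies_def)
  finally show ?thesis .
qed

lemma convex_mixed_strategies: "convex (mixed_strategies :: (real ^ 'a::finite) set)"
  by (auto simp: convex_def mixed_strategies_def sum.distrib simp flip: sum_distrib_left)

lemma compact_mixed_strategies: "compact (mixed_strategies :: (real ^ 'a::finite) set)"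
proof -
  have "bounded (mixed_strategies :: (real ^ 'a) set)"
    unfolding bounded_iff using norm_mixed_strategies_le_1 by blast
  moreover have "closed (mixed_strategies :: (real ^ 'a) set)"
  proof -
    have "mixed_strategies = (\<Inter>a. {x::real^'a. 0 \<le> x $ a}) \<inter> {x. (\<Sum>a\<in>UNIV. x $ a) = 1}"
      by (auto simp: mixed_strategies_def)
    moreover have "closed \<dots>"
      by (intro closed_Int closed_INT ballI closed_Collect_le closed_Collect_eq continuous_intros)
    ultimately show ?thesis by metis
  qed
  ultimately show ?thesis by (simp add: compact_eq_bounded_closed)
qed

text \<open>\<open>arg_max\<close> is a Hilbert choice, so nothing is known about its value until a
  maximiser exists; continuity of \<open>h\<close> on the compact simplex provides one.\<close>

lemma
  assumes "penalty_function h"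
  shows choice_map_mixed: "choice_map h y \<in> mixed_strategies"
    and choice_map_max:
      "x \<in> mixed_strategies \<Longrightarrow> y \<bullet> x - h x \<le> y \<bullet> choice_map h y - h (choice_map h y)"
proof -
  have "continuous_on mixed_strategies (\<lambda>x. y \<bullet> x - h x)"
    using assms by (auto simp: penalty_function_def intro!: continuous_intros)
  then obtain x where "x \<in> mixed_strategies" "\<forall>z\<in>mixed_strategies. y \<bullet> z - h z \<le> y \<bullet> x - h x"
    using continuous_attains_sup[OF compact_mixed_strategies mixed_strategies_nonempty] by blast
  then have "is_arg_max (\<lambda>x. y \<bullet> x - h x) (\<lambda>x. x \<in> mixed_strategies) x"
    by (auto simp: is_arg_max_linorder)
  then have "is_arg_max (\<lambda>x. y \<bullet> x - h x) (\<lambda>x. x \<in> mixed_strategies) (choice_map h y)"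
    unfolding choice_map_def arg_max_def by (rule someI)
  then show "choice_map h y \<in> mixed_strategies"
    "x \<in> mixed_strategies \<Longrightarrow> y \<bullet> x - h x \<le> y \<bullet> choice_map h y - h (choice_map h y)" for x
    by (auto simp: is_arg_max_linorder)
qed

text \<open>Strong convexity makes the objective fall quadratically away from its maximiser.
  Comparing the maximisers of \<open>y\<close> and \<open>y'\<close> with each other gives strong
  monotonicity of the choice map, and Cauchy-Schwarz turns this into a Lipschitz bound.\<close>

lemma choice_map_lipschitz:
  fixes h :: "real ^ 'a::finite \<Rightarrow> real"
  assumes "penalty_function h"
  obtains L where "0 < L" "\<And>y y'. norm (choice_map h y - choice_map h y') \<le> L * norm (y - y')"
proof -
  obtain K where K: "K > 0" and sc: "\<And>x x' t. x \<in> mixed_strategies \<Longrightarrow> x' \<in> mixed_strategies \<Longrightarrow> t \<in> {0..1} \<Longrightarrow>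
        h (t *\<^sub>R x + (1 - t) *\<^sub>R x')
          \<le> t * h x + (1 - t) * h x' - 1 / 2 * K * t * (1 - t) * (norm (x' - x))\<^sup>2"
    using assms unfolding penalty_function_def strongly_convex_on_def by metis
  \<comment> \<open>Testing maximality at the midpoint of \<open>z\<close> and the maximiser gives
    \<open>K / 4\<close>. Smaller weights on \<open>z\<close> would approach \<open>K / 2\<close>,
    but only finiteness of the Lipschitz constant matters.\<close>
  have gap: "y \<bullet> z - h z + K / 4 * (norm (choice_map h y - z))\<^sup>2
       \<le> y \<bullet> choice_map h y - h (choice_map h y)" if z: "z \<in> mixed_strategies" for y z
  proof -
    let ?x = "choice_map h y"
    let ?w = "(1/2) *\<^sub>R z + (1 - 1/2) *\<^sub>R ?x"
    have x: "?x \<in> mixed_strategies" by (rule choice_map_mixed[OF assms])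
    have "?w \<in> mixed_strategies"
      using convexD[OF convex_mixed_strategies z x, of "1/2" "1 - 1/2"] by simp
    from choice_map_max[OF assms this, of y] sc[OF z x, of "1/2"] show ?thesis
      by (simp add: inner_add_right field_simps)
  qed
  have "norm (choice_map h y - choice_map h y') \<le> 2 / K * norm (y - y')" for y y'
  proof -
    let ?x = "choice_map h y" and ?x' = "choice_map h y'"
    have "K / 2 * (norm (?x - ?x'))\<^sup>2 \<le> (y - y') \<bullet> (?x - ?x')"
      using gap[OF choice_map_mixed[OF assms], of y y'] gap[OF choice_map_mixed[OF assms], of y' y]
      by (simp add: norm_minus_commute inner_diff_left inner_diff_right)
    also have "\<dots> \<le> norm (y - y') * norm (?x - ?x')"
      by (rule norm_cauchy_schwarz)
    finally have "K / 2 * norm (?x - ?x') * norm (?x - ?x') \<le> norm (y - y') * norm (?x - ?x')"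
      by (simp add: power2_eq_square)
    then have "K / 2 * norm (?x - ?x') \<le> norm (y - y')"
      by (cases "norm (?x - ?x') = 0") (auto simp: mult_le_cancel_right)
    then show ?thesis using K by (simp add: field_simps)
  qed
  with K show ?thesis by (intro that[of "2 / K"]) auto
qed

lemma choice_map_continuous:
  assumes "penalty_function h"
  shows "continuous_on UNIV (choice_map h)"
proof -
  obtain L where "0 < L" "\<And>y y'. norm (choice_map h y - choice_map h y') \<le> L * norm (y - y')"
    using choice_map_lipschitz[OF assms] by blast
  then have "L-lipschitz_on UNIV (choice_map h)" by (auto simp: lipschitz_on_def dist_norm)
  then show ?thesis by (rule lipschitz_on_continuous_on)
qed

lemma choice_path_continuous:
  fixes y :: "real \<Rightarrow> real ^ 'a::finite"
  assumes "penalty_function h" "continuous_on S \<eta>" "\<And>a. continuous_on S (\<lambda>t. y t $ a)"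
  shows "continuous_on S (\<lambda>t. choice_map h (\<eta> t *\<^sub>R y t))"
proof -
  have "continuous_on S (\<lambda>t. \<chi> a. y t $ a)"
    by (rule continuous_on_vec_lambda) (rule assms(3))
  then have "continuous_on S y" by simp
  then show ?thesis
    by (intro continuous_on_compose2[OF choice_map_continuous[OF assms(1)]] continuous_intros assms(2)) auto
qed

lemma learning_parameter_continuous: "learning_parameter \<eta> \<Longrightarrow> continuous_on {0..} \<eta>"
  using DERIV_continuous_on[of "{0..}" \<eta>] unfolding learning_parameter_def
  by (metis atLeast_iff)

section \<open>The regularised maximum of a score vector\<close>

lemma penalty_bounded_below:
  assumes "penalty_function h"
  obtains B where "\<And>x. x \<in> mixed_strategies \<Longrightarrow> 0 \<le> h x + B"
proof -
  obtain x where "\<forall>z\<in>mixed_strategies. h x \<le> h z"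
    using continuous_attains_inf[OF compact_mixed_strategies mixed_strategies_nonempty, of h] assms
    by (auto simp: penalty_function_def)
  then show ?thesis by (intro that[of "- h x"]) auto
qed

text \<open>The convex conjugate of \<open>(h + B) / e\<close> at \<open>y\<close>, written through
  its maximiser (for the entropy, a scaled log-sum-exp up to a constant). The shift \<open>B\<close>
  is there to make the penalty nonnegative, which makes the value monotone in
  \<open>e\<close>.\<close>

definition smoothed_max :: "(real ^ 'a::finite \<Rightarrow> real) \<Rightarrow> real \<Rightarrow> real \<Rightarrow> real ^ 'a \<Rightarrow> real" where
  "smoothed_max h B e y =
     y \<bullet> choice_map h (e *\<^sub>R y) - (h (choice_map h (e *\<^sub>R y)) + B) / e"

text \<open>Dividing the objective of \<open>choice_map\<close> at \<open>e *\<^sub>R y\<close> by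
  \<open>e\<close> does not change its maximiser.\<close>

lemma smoothed_max_ge:
  assumes "penalty_function h" "0 < e" "x \<in> mixed_strategies"
  shows "y \<bullet> x - (h x + B) / e \<le> smoothed_max h B e y"
proof -
  have "(e *\<^sub>R y \<bullet> x - h x) / e
      \<le> (e *\<^sub>R y \<bullet> choice_map h (e *\<^sub>R y) - h (choice_map h (e *\<^sub>R y))) / e"
    using choice_map_max[OF assms(1,3), of "e *\<^sub>R y"] assms(2)
    by (intro divide_right_mono) simp_all
  then show ?thesis
    using assms(2) by (simp add: smoothed_max_def diff_divide_distrib add_divide_distrib)
qed

text \<open>The maximiser for \<open>e'\<close> competes at \<open>e\<close>, where its nonnegative
  penalty is divided by a larger number. Hence lowering the learning parameter never raises the
  potential.\<close>

lemma smoothed_max_antimono: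
  assumes "penalty_function h" "0 < e'" "e' \<le> e"
    and "\<And>x. x \<in> mixed_strategies \<Longrightarrow> 0 \<le> h x + B"
  shows "smoothed_max h B e' y \<le> smoothed_max h B e y"
proof -
  let ?x = "choice_map h (e' *\<^sub>R y)"
  have x: "?x \<in> mixed_strategies" by (rule choice_map_mixed[OF assms(1)])
  have "(h ?x + B) / e \<le> (h ?x + B) / e'"
    using assms x by (intro divide_left_mono) auto
  with smoothed_max_ge[OF assms(1) _ x, of e y B] assms show ?thesis
    by (auto simp: smoothed_max_def)
qed

text \<open>The linear term of the remainder keeps its second moment bounded when the increment
  \<open>y' - y\<close> is only square integrable.\<close>

lemma smoothed_max_step:
  fixes y y' :: "real ^ 'a::finite"
  assumes h: "penalty_function h" and e: "0 < e"
    and L: "\<And>y y'. norm (choice_map h y - choice_map h y') \<le> L * norm (y - y')"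
  shows "smoothed_max h B e y' \<le> smoothed_max h B e y + (y' - y) \<bullet> choice_map h (e *\<^sub>R y)
           + min (L * e * (norm (y' - y))\<^sup>2) (2 * norm (y' - y))"
proof -
  let ?x = "choice_map h (e *\<^sub>R y)" and ?x' = "choice_map h (e *\<^sub>R y')"
  have "norm (?x' - ?x) \<le> L * norm (e *\<^sub>R y' - e *\<^sub>R y)" by (rule L)
  also have "\<dots> = L * e * norm (y' - y)"
    using e by (simp flip: scaleR_diff_right)
  finally have 1: "norm (?x' - ?x) \<le> L * e * norm (y' - y)" .
  have "norm (?x' - ?x) \<le> norm ?x' + norm ?x" by (rule norm_triangle_ineq4)
  with norm_mixed_strategies_le_1[OF choice_map_mixed[OF h]] have 2: "norm (?x' - ?x) \<le> 2"
    by (smt (verit))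
  have 3: "(y' - y) \<bullet> (?x' - ?x) \<le> norm (y' - y) * norm (?x' - ?x)"
    by (rule norm_cauchy_schwarz)
  have "norm (y' - y) * norm (?x' - ?x) \<le> norm (y' - y) * (L * e * norm (y' - y))"
    using 1 by (rule mult_left_mono) simp
  moreover have "norm (y' - y) * norm (?x' - ?x) \<le> norm (y' - y) * 2"
    using 2 by (rule mult_left_mono) simp
  ultimately have "(y' - y) \<bullet> (?x' - ?x) \<le> min (L * e * (norm (y' - y))\<^sup>2) (2 * norm (y' - y))"
    using 3 by (simp add: power2_eq_square mult_ac)
  moreover have "smoothed_max h B e y' = y' \<bullet> ?x' - (h ?x' + B) / e"
    by (simp add: smoothed_max_def)
  \<comment> \<open>Competing at \<open>y\<close> with the maximiser of \<open>y'\<close> bounds the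
    growth by the inner product of \<open>y' - y\<close> with \<open>?x'\<close>; the two bounds on
    \<open>?x' - ?x\<close> pay for replacing \<open>?x'\<close> by \<open>?x\<close>.\<close>
  moreover have "y \<bullet> ?x' - (h ?x' + B) / e \<le> smoothed_max h B e y"
    by (rule smoothed_max_ge[OF h e choice_map_mixed[OF h]])
  ultimately show ?thesis unfolding inner_diff_left inner_diff_right by linarith
qed

text \<open>Telescoping of \<open>smoothed_max\<close>, with the pure strategy \<open>a\<close> as
  the final competitor. Each increment is paired with the play at the left end of its step, so the
  noise part of the sum is non-anticipating and can later be treated as a martingale.\<close>

lemma discrete_regret_bound:
  fixes y :: "nat \<Rightarrow> real ^ 'a::finite"
  assumes h: "penalty_function h" and e: "\<And>n. 0 < e n" "decseq e"
    and L: "\<And>y y'. norm (choice_map h y - choice_map h y') \<le> L * norm (y - y')"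
    and B: "\<And>x. x \<in> mixed_strategies \<Longrightarrow> 0 \<le> h x + B"
  shows "y N $ a \<le> (h (axis a 1) + B) / e N + smoothed_max h B (e 0) (y 0)
     + (\<Sum>n<N. (y (Suc n) - y n) \<bullet> choice_map h (e n *\<^sub>R y n))
     + (\<Sum>n<N. min (L * e n * (norm (y (Suc n) - y n))\<^sup>2) (2 * norm (y (Suc n) - y n)))"
proof -
  have "smoothed_max h B (e N) (y N) \<le> smoothed_max h B (e 0) (y 0)
     + (\<Sum>n<N. (y (Suc n) - y n) \<bullet> choice_map h (e n *\<^sub>R y n))
     + (\<Sum>n<N. min (L * e n * (norm (y (Suc n) - y n))\<^sup>2) (2 * norm (y (Suc n) - y n)))"
  proof (induction N)
    case 0
    then show ?case by simp
  next
    case (Suc N)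
    \<comment> \<open>The score moves under the old parameter and the parameter is lowered
      afterwards, so the play in the inner product is the one in force at step
      \<open>N\<close>.\<close>
    have "smoothed_max h B (e (Suc N)) (y (Suc N)) \<le> smoothed_max h B (e N) (y (Suc N))"
      using e by (intro smoothed_max_antimono[OF h _ _ B]) (auto simp: decseq_Suc_iff)
    with Suc smoothed_max_step[OF h e(1) L, of B N "y (Suc N)" "y N"] show ?case by simp
  qed
  moreover have "y N $ a - (h (axis a 1) + B) / e N \<le> smoothed_max h B (e N) (y N)"
    using smoothed_max_ge[OF h e(1) axis_mixed_strategies, of "y N" a B N]
    by (simp add: inner_axis)
  ultimately show ?thesis by linarith
qed

section \<open>Martingale increments and simple integrals\<close>

lemma integrable_times_square:
  fixes f g :: "'w \<Rightarrow> real"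
  assumes "f \<in> borel_measurable M" "g \<in> borel_measurable M"
    and "integrable M (\<lambda>\<omega>. (f \<omega>)\<^sup>2)" "integrable M (\<lambda>\<omega>. (g \<omega>)\<^sup>2)"
  shows "integrable M (\<lambda>\<omega>. f \<omega> * g \<omega>)"
proof (rule Bochner_Integration.integrable_bound)
  show "integrable M (\<lambda>\<omega>. (f \<omega>)\<^sup>2 + (g \<omega>)\<^sup>2)" using assms by simp
  show "AE \<omega> in M. norm (f \<omega> * g \<omega>) \<le> norm ((f \<omega>)\<^sup>2 + (g \<omega>)\<^sup>2)"
  proof (rule AE_I2)
    fix \<omega>
    have "2 * \<bar>f \<omega>\<bar> * \<bar>g \<omega>\<bar> \<le> \<bar>f \<omega>\<bar>\<^sup>2 + \<bar>g \<omega>\<bar>\<^sup>2" by (rule sum_squares_bound)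
    moreover have "0 \<le> \<bar>f \<omega>\<bar> * \<bar>g \<omega>\<bar>" by simp
    ultimately have "\<bar>f \<omega>\<bar> * \<bar>g \<omega>\<bar> \<le> (f \<omega>)\<^sup>2 + (g \<omega>)\<^sup>2"
      unfolding power2_abs by linarith
    then show "norm (f \<omega> * g \<omega>) \<le> norm ((f \<omega>)\<^sup>2 + (g \<omega>)\<^sup>2)"
      by (simp add: abs_mult)
  qed
qed (use assms in measurable)

lemma integrable_square_add:
  fixes f g :: "'w \<Rightarrow> real"
  assumes "f \<in> borel_measurable M" "g \<in> borel_measurable M"
    and "integrable M (\<lambda>\<omega>. (f \<omega>)\<^sup>2)" "integrable M (\<lambda>\<omega>. (g \<omega>)\<^sup>2)"
  shows "integrable M (\<lambda>\<omega>. (f \<omega> + g \<omega>)\<^sup>2)"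
  using integrable_times_square[OF assms] assms(3,4)
  by (simp add: power2_sum mult.assoc)

lemma integrable_times_bounded:
  fixes f g :: "'w \<Rightarrow> real"
  assumes "integrable M f" "g \<in> borel_measurable M" "\<And>\<omega>. \<omega> \<in> space M \<Longrightarrow> \<bar>g \<omega>\<bar> \<le> c"
  shows "integrable M (\<lambda>\<omega>. g \<omega> * f \<omega>)"
proof (rule Bochner_Integration.integrable_bound)
  show "integrable M (\<lambda>\<omega>. c * f \<omega>)" using assms by simp
  show "AE \<omega> in M. norm (g \<omega> * f \<omega>) \<le> norm (c * f \<omega>)"
    using assms(3) by (intro AE_I2) (force simp: abs_mult intro!: mult_right_mono)
qed (use assms in measurable)

section \<open>Orthogonality relative to a filtration\<close>

locale filtered_prob_space = prob_space M
  for M :: "'w measure" +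
  fixes F :: "real \<Rightarrow> 'w measure"
  assumes filtration: "filtration_on M F"
begin

lemma space_filtration: "0 \<le> t \<Longrightarrow> space (F t) = space M"
  using filtration by (auto simp: filtration_on_def subalgebra_def)

lemma measurable_filtration_mono:
  "f \<in> measurable (F s) N \<Longrightarrow> 0 \<le> s \<Longrightarrow> s \<le> t \<Longrightarrow> f \<in> measurable (F t) N"
  by (rule measurable_from_subalg[of "F t" "F s"])
    (use filtration in \<open>simp_all add: filtration_on_def subalgebra_def\<close>)

lemma measurable_filtration: "f \<in> measurable (F s) N \<Longrightarrow> 0 \<le> s \<Longrightarrow> f \<in> measurable M N"
  using filtration by (intro measurable_from_subalg[of M "F s"]) (auto simp: filtration_on_def)

text \<open>For square-integrable \<open>d\<close>, orthogonality to all square-integrable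
  \<open>F s\<close>-measurable variables says that the conditional expectation of \<open>d\<close>
  given \<open>F s\<close> vanishes. In this form conditional statements become integrals against
  weights.\<close>

definition martingale_increment :: "real \<Rightarrow> real \<Rightarrow> ('w \<Rightarrow> real) \<Rightarrow> bool" where
  "martingale_increment s t d \<longleftrightarrow>
     d \<in> borel_measurable (F t) \<and> integrable M (\<lambda>\<omega>. (d \<omega>)\<^sup>2) \<and>
     (\<forall>\<kappa>. \<kappa> \<in> borel_measurable (F s) \<and> integrable M (\<lambda>\<omega>. (\<kappa> \<omega>)\<^sup>2) \<longrightarrow> expectation (\<lambda>\<omega>. \<kappa> \<omega> * d \<omega>) = 0)"

lemma martingale_increment_widen:
  assumes "martingale_increment s t d" "0 \<le> s'" "s' \<le> s" "s \<le> t" "t \<le> t'"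
  shows "martingale_increment s' t' d"
  using assms measurable_filtration_mono[of d t borel t']
    measurable_filtration_mono[OF _ assms(2,3), where N=borel]
  unfolding martingale_increment_def by (meson order_trans)

lemma martingale_increment_0: "martingale_increment s t (\<lambda>\<omega>. 0)"
  by (simp add: martingale_increment_def)

lemma martingale_increment_add:
  assumes "martingale_increment s t d" "martingale_increment s t d'" "0 \<le> s" "s \<le> t"
  shows "martingale_increment s t (\<lambda>\<omega>. d \<omega> + d' \<omega>)"
proof -
  have m: "d \<in> borel_measurable M" "d' \<in> borel_measurable M"
    using assms by (auto simp: martingale_increment_def intro!: measurable_filtration[of _ t])
  have "expectation (\<lambda>\<omega>. \<kappa> \<omega> * (d \<omega> + d' \<omega>)) = 0"
    if "\<kappa> \<in> borel_measurable (F s)" "integrable M (\<lambda>\<omega>. (\<kappa> \<omega>)\<^sup>2)" for \<kappa>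
  proof -
    have "\<kappa> \<in> borel_measurable M" using measurable_filtration[OF that(1) assms(3)] .
    with that m assms have "integrable M (\<lambda>\<omega>. \<kappa> \<omega> * d \<omega>)" "integrable M (\<lambda>\<omega>. \<kappa> \<omega> * d' \<omega>)"
      by (simp_all add: martingale_increment_def integrable_times_square)
    with that assms show ?thesis by (simp add: distrib_left martingale_increment_def)
  qed
  with m assms show ?thesis
    unfolding martingale_increment_def by (blast intro: integrable_square_add borel_measurable_add)
qed

text \<open>A bounded \<open>F s\<close>-measurable factor can be moved into the test variable,
  which stays square integrable.\<close>

lemma martingale_increment_mult:
  assumes d: "martingale_increment s t d" and st: "0 \<le> s" "s \<le> t"
    and \<zeta>: "\<zeta> \<in> borel_measurable (F s)" "\<And>\<omega>. \<omega> \<in> space M \<Longrightarrow> \<bar>\<zeta> \<omega>\<bar> \<le> c"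
  shows "martingale_increment s t (\<lambda>\<omega>. \<zeta> \<omega> * d \<omega>)"
proof -
  have m: "\<zeta> \<in> borel_measurable M" "\<zeta> \<in> borel_measurable (F t)"
    using \<zeta> st by (auto intro: measurable_filtration measurable_filtration_mono)
  have sq: "\<bar>(\<zeta> \<omega>)\<^sup>2\<bar> \<le> c\<^sup>2" if "\<omega> \<in> space M" for \<omega>
    using \<zeta>(2)[OF that] by (metis abs_ge_zero abs_power2 power2_abs power_mono)
  have int: "integrable M (\<lambda>\<omega>. (\<zeta> \<omega> * f \<omega>)\<^sup>2)" if "integrable M (\<lambda>\<omega>. (f \<omega>)\<^sup>2)" for f
    unfolding power_mult_distrib using m sq by (intro integrable_times_bounded[OF that]) auto
  have "expectation (\<lambda>\<omega>. \<kappa> \<omega> * (\<zeta> \<omega> * d \<omega>)) = 0"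
    if "\<kappa> \<in> borel_measurable (F s)" "integrable M (\<lambda>\<omega>. (\<kappa> \<omega>)\<^sup>2)" for \<kappa>
  proof -
    have "expectation (\<lambda>\<omega>. (\<zeta> \<omega> * \<kappa> \<omega>) * d \<omega>) = 0"
      using d that int[OF that(2)] \<zeta>(1) unfolding martingale_increment_def by simp
    then show ?thesis by (simp add: mult_ac)
  qed
  with d m int show ?thesis by (auto simp: martingale_increment_def)
qed

text \<open>Pythagoras with a weight known at the initial time, hence a conditional statement in
  integrated form. If \<open>D\<close> is the sum so far, \<open>g * D\<close> is a test variable
  for the next increment, so the cross term drops out.\<close>

lemma orthogonal_increments:
  fixes t :: "nat \<Rightarrow> real"
  assumes t: "mono t" "0 \<le> t 0"
    and d: "\<And>n. n < N \<Longrightarrow> martingale_increment (t n) (t (Suc n)) (d n)"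
    and g: "g \<in> borel_measurable (F (t 0))" "\<And>\<omega>. \<omega> \<in> space M \<Longrightarrow> \<bar>g \<omega>\<bar> \<le> c"
  shows "martingale_increment (t 0) (t N) (\<lambda>\<omega>. \<Sum>n<N. d n \<omega>) \<and>
    expectation (\<lambda>\<omega>. g \<omega> * (\<Sum>n<N. d n \<omega>)\<^sup>2) = (\<Sum>n<N. expectation (\<lambda>\<omega>. g \<omega> * (d n \<omega>)\<^sup>2))"
  using d
proof (induction N)
  case 0
  then show ?case by (simp add: martingale_increment_0)
next
  case (Suc N)
  let ?D = "\<lambda>\<omega>. \<Sum>n<N. d n \<omega>"
  have pos: "0 \<le> t n" "t 0 \<le> t n" "t n \<le> t (Suc n)" for n
    using t monoD[OF t(1), of 0 n] monoD[OF t(1), of n "Suc n"] by auto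
  have D: "martingale_increment (t 0) (t N) ?D" and
    eq: "expectation (\<lambda>\<omega>. g \<omega> * (?D \<omega>)\<^sup>2) = (\<Sum>n<N. expectation (\<lambda>\<omega>. g \<omega> * (d n \<omega>)\<^sup>2))"
    using Suc by auto
  have dN: "martingale_increment (t N) (t (Suc N)) (d N)" using Suc.prems by simp
  have DN: "martingale_increment (t 0) (t (Suc N)) (\<lambda>\<omega>. ?D \<omega> + d N \<omega>)"
    using pos[of N] pos[of "Suc N"] pos[of 0]
    by (intro martingale_increment_add martingale_increment_widen[OF D]
        martingale_increment_widen[OF dN]) auto
  have gD: "martingale_increment (t 0) (t N) (\<lambda>\<omega>. g \<omega> * ?D \<omega>)"
    using pos[of N] pos[of 0] g by (intro martingale_increment_mult[OF D]) auto
  have gM: "g \<in> borel_measurable M" using g pos by (auto intro: measurable_filtration)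
  have mM: "?D \<in> borel_measurable M" "d N \<in> borel_measurable M"
    using D dN pos by (auto simp: martingale_increment_def intro!: measurable_filtration)
  have i1: "integrable M (\<lambda>\<omega>. g \<omega> * (?D \<omega>)\<^sup>2)" and i2: "integrable M (\<lambda>\<omega>. g \<omega> * (d N \<omega>)\<^sup>2)"
    using D dN g gM unfolding martingale_increment_def
    by (auto intro!: integrable_times_bounded)
  have i3: "integrable M (\<lambda>\<omega>. g \<omega> * (?D \<omega> * d N \<omega>))"
  proof (rule integrable_times_bounded[OF _ gM g(2)])
    show "integrable M (\<lambda>\<omega>. ?D \<omega> * d N \<omega>)"
      using D dN by (intro integrable_times_square mM) (auto simp: martingale_increment_def)
  qed
  have 0: "expectation (\<lambda>\<omega>. g \<omega> * ?D \<omega> * d N \<omega>) = 0"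
    using gD dN unfolding martingale_increment_def by auto
  have "expectation (\<lambda>\<omega>. g \<omega> * (?D \<omega> + d N \<omega>)\<^sup>2)
      = expectation (\<lambda>\<omega>. g \<omega> * (?D \<omega>)\<^sup>2 + g \<omega> * (d N \<omega>)\<^sup>2 + 2 * (g \<omega> * (?D \<omega> * d N \<omega>)))"
    by (rule Bochner_Integration.integral_cong) (auto simp: power2_sum algebra_simps)
  also have "\<dots> = expectation (\<lambda>\<omega>. g \<omega> * (?D \<omega>)\<^sup>2) + expectation (\<lambda>\<omega>. g \<omega> * (d N \<omega>)\<^sup>2)"
    using i1 i2 i3 0 by (simp add: mult.assoc)
  finally show ?case using eq DN by simp
qed

text \<open>The increment is independent of \<open>F s\<close>, so expectations of products factor.
  For an integrable \<open>\<kappa>\<close>, independence also supplies integrability of the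
  products.\<close>

lemma
  assumes B: "standard_wiener M F B" and st: "0 \<le> s" "s \<le> t"
    and \<kappa>: "\<kappa> \<in> borel_measurable (F s)" "integrable M \<kappa>"
  shows wiener_increment_mean: "expectation (\<lambda>\<omega>. \<kappa> \<omega> * (B t \<omega> - B s \<omega>)) = 0"
    and wiener_increment_square_integrable: "integrable M (\<lambda>\<omega>. (B t \<omega> - B s \<omega>)\<^sup>2)"
    and wiener_increment_variance:
      "expectation (\<lambda>\<omega>. \<kappa> \<omega> * (B t \<omega> - B s \<omega>)\<^sup>2) = (t - s) * expectation \<kappa>"
proof -
  let ?d = "\<lambda>\<omega>. B t \<omega> - B s \<omega>"
  have "expectation (\<lambda>\<omega>. \<kappa> \<omega> * ?d \<omega>) = 0 \<and> integrable M (\<lambda>\<omega>. (?d \<omega>)\<^sup>2) \<and>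
     expectation (\<lambda>\<omega>. \<kappa> \<omega> * (?d \<omega>)\<^sup>2) = (t - s) * expectation \<kappa>"
  \<comment> \<open>The Gaussian law is postulated for \<open>s < t\<close>; the degenerate
    increment is zero.\<close>
  proof (cases "s = t")
    case True
    then show ?thesis by simp
  next
    case False
    with st have lt: "s < t" by simp
    define \<sigma> where "\<sigma> = sqrt (t - s)"
    have \<sigma>: "0 < \<sigma>" "\<sigma>\<^sup>2 = t - s" using lt by (auto simp: \<sigma>_def)
    have D: "distributed M lborel ?d (normal_density 0 \<sigma>)"
      and ind: "indep_set (sets (F s)) (sets (vimage_algebra (space M) ?d borel))"
      using B st lt by (auto simp: standard_wiener_def \<sigma>_def)
    have dm: "?d \<in> borel_measurable M" using distributed_measurable[OF D] by simp
    have \<kappa>M: "\<kappa> \<in> borel_measurable M" using \<kappa> st by (auto intro: measurable_filtration)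
    have e1: "expectation ?d = 0" using \<sigma> D by (rule_tac normal_distributed_expectation) auto
    have e2: "expectation (\<lambda>\<omega>. (?d \<omega>)\<^sup>2) = t - s"
      using normal_distributed_variance[OF \<sigma>(1) D] e1 \<sigma> by simp
    have i2: "integrable M (\<lambda>\<omega>. (?d \<omega>)\<^sup>2)"
      using integrable_normal_moment[OF \<sigma>(1), of 0 2] distributed_integrable[OF D, of "\<lambda>x. x\<^sup>2"] by simp
    have i1: "integrable M ?d"
      using square_integrable_imp_integrable[OF dm i2] .
    \<comment> \<open>The variable \<open>\<kappa>\<close> generates a sub-sigma-algebra of
      \<open>F s\<close>, so independence of \<open>F s\<close> from the increment passes to the two
      variables, and then to Borel functions of the increment.\<close>
    have iv: "indep_var borel \<kappa> borel (f \<circ> ?d)" if f: "f \<in> borel_measurable borel" for f :: "real \<Rightarrow> real"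
    proof -
      have "{\<kappa> -` A \<inter> space M |A. A \<in> sets borel} \<subseteq> sets (F s)"
        using measurable_sets[OF \<kappa>(1)] by (auto simp: space_filtration[OF st(1)])
      then have 1: "sigma_sets (space M) {\<kappa> -` A \<inter> space M |A. A \<in> sets borel} \<subseteq> sets (F s)"
        using sets.sigma_sets_subset[of _ "F s"] by (simp add: space_filtration[OF st(1)])
      have 2: "sigma_sets (space M) {?d -` A \<inter> space M |A. A \<in> sets borel}
          \<subseteq> sets (vimage_algebra (space M) ?d borel)"
        by (simp add: sets_vimage_algebra)
      have "indep_set (sigma_sets (space M) {\<kappa> -` A \<inter> space M |A. A \<in> sets borel})
         (sigma_sets (space M) {?d -` A \<inter> space M |A. A \<in> sets borel})"
        unfolding indep_set_def
        by (rule indep_sets_mono_sets[OF ind[unfolded indep_set_def]])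
          (use 1 2 in \<open>simp split: bool.split\<close>)
      then have "indep_var borel \<kappa> borel ?d"
        unfolding indep_var_eq using dm \<kappa>M by simp
      from indep_var_compose[OF this measurable_ident_sets[OF refl] f] show ?thesis
        by (simp add: comp_def)
    qed
    have "indep_var borel \<kappa> borel ?d" "indep_var borel \<kappa> borel (\<lambda>\<omega>. (?d \<omega>)\<^sup>2)"
      using iv[of "\<lambda>x. x"] iv[of "\<lambda>x. x\<^sup>2"] by (auto simp: comp_def)
    from this[THEN indep_var_lebesgue_integral] show ?thesis
      using i1 i2 e1 e2 \<kappa>(2) by simp
  qed
  then show "expectation (\<lambda>\<omega>. \<kappa> \<omega> * ?d \<omega>) = 0" "integrable M (\<lambda>\<omega>. (?d \<omega>)\<^sup>2)"
    "expectation (\<lambda>\<omega>. \<kappa> \<omega> * (?d \<omega>)\<^sup>2) = (t - s) * expectation \<kappa>" by auto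
qed

lemma wiener_martingale_increment:
  assumes B: "standard_wiener M F B" and st: "0 \<le> s" "s \<le> t"
  shows "martingale_increment s t (\<lambda>\<omega>. B t \<omega> - B s \<omega>)"
proof -
  have "(\<lambda>\<omega>. B t \<omega> - B s \<omega>) \<in> borel_measurable (F t)"
    using B st measurable_filtration_mono[of "B s" s borel t]
    by (intro borel_measurable_diff) (auto simp: standard_wiener_def adapted_def)
  moreover have "expectation (\<lambda>\<omega>. \<kappa> \<omega> * (B t \<omega> - B s \<omega>)) = 0"
    if "\<kappa> \<in> borel_measurable (F s)" "integrable M (\<lambda>\<omega>. (\<kappa> \<omega>)\<^sup>2)" for \<kappa>
    by (rule wiener_increment_mean[OF B st that(1) square_integrable_imp_integrable
          [OF measurable_filtration[OF that(1) st(1)] that(2)]])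
  moreover have "integrable M (\<lambda>\<omega>. (B t \<omega> - B s \<omega>)\<^sup>2)"
    by (rule wiener_increment_square_integrable[OF B st, of "\<lambda>_. 0"]) auto
  ultimately show ?thesis
    unfolding martingale_increment_def by blast
qed

end

text \<open>Clamping the partition points to \<open>{s..t}\<close> turns an increment of the
  integral into an elementary integral over \<open>{s..t}\<close>: cells before \<open>s\<close> or
  after \<open>t\<close> collapse to a point and contribute zero.\<close>

lemma simple_integral_increment:
  assumes "s \<le> t"
  shows "simple_integral n \<tau> \<xi> B t \<omega> - simple_integral n \<tau> \<xi> B s \<omega> =
    (\<Sum>i<n. \<xi> i \<omega> * (B (max s (min t (\<tau> (Suc i)))) \<omega> - B (max s (min t (\<tau> i))) \<omega>))"
proof -
  have *: "B (min t r) \<omega> - B (min s r) \<omega> = B (max s (min t r)) \<omega> - B s \<omega>" for r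
    using assms by (cases "r \<le> s") (simp_all add: min_absorb2 max_absorb1 min_absorb1 max_absorb2)
  show ?thesis
    unfolding simple_integral_def sum_subtractf[symmetric] right_diff_distrib[symmetric]
  proof (intro sum.cong refl arg_cong2[where f="(*)"])
    fix i
    show "B (min t (\<tau> (Suc i))) \<omega> - B (min t (\<tau> i)) \<omega>
        - (B (min s (\<tau> (Suc i))) \<omega> - B (min s (\<tau> i)) \<omega>)
      = B (max s (min t (\<tau> (Suc i)))) \<omega> - B (max s (min t (\<tau> i))) \<omega>"
      using *[of "\<tau> i"] *[of "\<tau> (Suc i)"] by linarith
  qed
qed

text \<open>The half-open cells are disjoint, so at each time at most one summand is nonzero and the
  cross terms of the square vanish.\<close>

lemma simple_process_square:
  assumes "mono \<tau>"
  shows "(simple_process n \<tau> \<xi> r \<omega>)\<^sup>2 = (\<Sum>i<n. (\<xi> i \<omega>)\<^sup>2 * indicator {\<tau> i <.. \<tau> (Suc i)} r)"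
proof (induction n)
  case 0
  then show ?case by (simp add: simple_process_def)
next
  case (Suc n)
  have "simple_process n \<tau> \<xi> r \<omega> = 0" if "r \<in> {\<tau> n <.. \<tau> (Suc n)}"
  proof -
    have "r \<notin> {\<tau> i <.. \<tau> (Suc i)}" if "i < n" for i
      using monoD[OF assms, of "Suc i" n] that \<open>r \<in> _\<close> by auto
    then show ?thesis by (simp add: simple_process_def)
  qed
  moreover have "simple_process (Suc n) \<tau> \<xi> r \<omega>
      = simple_process n \<tau> \<xi> r \<omega> + \<xi> n \<omega> * indicator {\<tau> n <.. \<tau> (Suc n)} r"
    by (simp add: simple_process_def)
  ultimately show ?case using Suc
    by (cases "r \<in> {\<tau> n <.. \<tau> (Suc n)}") auto
qed

text \<open>The clamped cell lengths on the right are the variances of the Wiener increments over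
  the clamped cells, which is what the isometry compares them with.\<close>

lemma simple_process_square_integral:
  assumes "mono \<tau>" "s \<le> t"
  shows "(\<integral>\<^sup>+r\<in>{s..t}. ennreal ((simple_process n \<tau> \<xi> r \<omega>)\<^sup>2) \<partial>lborel)
    = ennreal (\<Sum>i<n. (\<xi> i \<omega>)\<^sup>2 * (max s (min t (\<tau> (Suc i))) - max s (min t (\<tau> i))))"
proof -
  have "(\<integral>\<^sup>+r\<in>{s..t}. ennreal ((simple_process n \<tau> \<xi> r \<omega>)\<^sup>2) \<partial>lborel)
      = (\<integral>\<^sup>+r. (\<Sum>i<n. ennreal ((\<xi> i \<omega>)\<^sup>2) * indicator ({\<tau> i <.. \<tau> (Suc i)} \<inter> {s..t}) r) \<partial>lborel)"
    unfolding simple_process_square[OF assms(1)]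
    by (intro nn_integral_cong)
      (auto simp: sum_ennreal[symmetric] ennreal_mult' indicator_def sum_distrib_right simp del: sum_ennreal
        intro!: sum.cong)
  also have "\<dots> = (\<Sum>i<n. ennreal ((\<xi> i \<omega>)\<^sup>2) * emeasure lborel ({\<tau> i <.. \<tau> (Suc i)} \<inter> {s..t}))"
    by (subst nn_integral_sum) (auto simp: nn_integral_cmult)
  also have "\<dots> = (\<Sum>i<n. ennreal ((\<xi> i \<omega>)\<^sup>2 * (max s (min t (\<tau> (Suc i))) - max s (min t (\<tau> i)))))"
  proof (intro sum.cong refl)
    fix i
    have le: "\<tau> i \<le> \<tau> (Suc i)" using assms(1) by (simp add: monoD)
    have "emeasure lborel ({\<tau> i <.. \<tau> (Suc i)} \<inter> {s..t})
        = ennreal (max s (min t (\<tau> (Suc i))) - max s (min t (\<tau> i)))"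
    proof (cases "s \<le> \<tau> i")
      case True
      then have "{\<tau> i <.. \<tau> (Suc i)} \<inter> {s..t} = {\<tau> i <.. min t (\<tau> (Suc i))}" by auto
      then show ?thesis using True le assms(2)
        by (auto simp: emeasure_lborel_Ioc min_def max_def)
    next
      \<comment> \<open>The cell begins before \<open>s\<close>, so its part in
        \<open>{s..t}\<close> is a closed interval, possibly empty.\<close>
      case False
      then have "{\<tau> i <.. \<tau> (Suc i)} \<inter> {s..t} = {s .. min t (\<tau> (Suc i))}" by auto
      then show ?thesis using False le assms(2)
        by (auto simp: emeasure_lborel_Icc_eq min_def max_def)
    qed
    then show "ennreal ((\<xi> i \<omega>)\<^sup>2) * emeasure lborel ({\<tau> i <.. \<tau> (Suc i)} \<inter> {s..t})
       = ennreal ((\<xi> i \<omega>)\<^sup>2 * (max s (min t (\<tau> (Suc i))) - max s (min t (\<tau> i))))"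
      by (simp add: ennreal_mult')
  qed
  also have "\<dots> = ennreal (\<Sum>i<n. (\<xi> i \<omega>)\<^sup>2 * (max s (min t (\<tau> (Suc i))) - max s (min t (\<tau> i))))"
  proof (intro sum_ennreal mult_nonneg_nonneg)
    fix i
    have "max s (min t (\<tau> i)) \<le> max s (min t (\<tau> (Suc i)))"
      using assms(1) by (intro max.mono min.mono order_refl) (simp add: monoD)
    then show "0 \<le> max s (min t (\<tau> (Suc i))) - max s (min t (\<tau> i))" by simp
  qed simp
  finally show ?thesis .
qed

section \<open>The isometry for simple integrands\<close>

lemma square_sum_le:
  fixes f :: "nat \<Rightarrow> real"
  shows "(\<Sum>n<N. f n)\<^sup>2 \<le> real N * (\<Sum>n<N. (f n)\<^sup>2)"
  using Cauchy_Schwarz_ineq_sum[of "\<lambda>_. 1" f "{..<N}"] by simp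

lemma square_add_le: "((a::real) + b)\<^sup>2 \<le> 2 * a\<^sup>2 + 2 * b\<^sup>2"
  using sum_squares_bound[of a b] by (simp add: power2_sum)

lemma square_diff_le: "((a::real) - b)\<^sup>2 \<le> 2 * a\<^sup>2 + 2 * b\<^sup>2"
  using square_add_le[of a "- b"] by simp

context filtered_prob_space
begin

text \<open>On the clamped grid the pieces are Wiener increments multiplied by bounded variables
  known at their left ends, hence orthogonal martingale increments. A nonnegative weight
  \<open>g\<close> known at time \<open>s\<close> makes the isometry a conditional one.\<close>

lemma
  assumes B: "standard_wiener M F B" and S: "simple_integrand F n \<tau> \<xi>" and st: "0 \<le> s" "s \<le> t"
  shows simple_integral_martingale_increment:
      "martingale_increment s t (\<lambda>\<omega>. simple_integral n \<tau> \<xi> B t \<omega> - simple_integral n \<tau> \<xi> B s \<omega>)"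
    and simple_integral_isometry:
      "g \<in> borel_measurable (F s) \<Longrightarrow> (\<And>\<omega>. \<omega> \<in> space M \<Longrightarrow> 0 \<le> g \<omega> \<and> g \<omega> \<le> G) \<Longrightarrow>
        (\<integral>\<^sup>+\<omega>. ennreal (g \<omega> * (simple_integral n \<tau> \<xi> B t \<omega> - simple_integral n \<tau> \<xi> B s \<omega>)\<^sup>2) \<partial>M) =
        (\<integral>\<^sup>+\<omega>. ennreal (g \<omega>) *
            (\<integral>\<^sup>+r\<in>{s..t}. ennreal ((simple_process n \<tau> \<xi> r \<omega>)\<^sup>2) \<partial>lborel) \<partial>M)"
proof -
  define c where "c i = max s (min t (\<tau> i))" for i
  define d where "d i \<omega> = \<xi> i \<omega> * (B (c (Suc i)) \<omega> - B (c i) \<omega>)" for i \<omega>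
  have \<tau>: "mono \<tau>" "0 \<le> \<tau> 0" and
    \<xi>: "\<And>i. i < n \<Longrightarrow> \<xi> i \<in> borel_measurable (F (\<tau> i))"
      "\<And>i. i < n \<Longrightarrow> \<exists>k. \<forall>\<omega>\<in>space (F (\<tau> i)). \<bar>\<xi> i \<omega>\<bar> \<le> k"
    using S by (auto simp: simple_integrand_def)
  have \<tau>pos: "0 \<le> \<tau> i" for i using monoD[OF \<tau>(1), of 0 i] \<tau>(2) by simp
  have c: "mono c" "s \<le> c i" "c i \<le> t" "0 \<le> c i" "c i \<le> c (Suc i)" for i
  proof -
    show m: "mono c"
      unfolding c_def using \<tau>(1) by (intro monoI max.mono min.mono order_refl) (simp add: monoD)
    show "s \<le> c i" "c i \<le> t" "0 \<le> c i" using st by (auto simp: c_def)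
    show "c i \<le> c (Suc i)" using m by (simp add: monoD)
  qed
  have eq: "simple_integral n \<tau> \<xi> B t \<omega> - simple_integral n \<tau> \<xi> B s \<omega> = (\<Sum>i<n. d i \<omega>)" for \<omega>
    unfolding d_def c_def by (rule simple_integral_increment[OF st(2)])
  have bd: "\<exists>k. \<forall>\<omega>\<in>space M. \<bar>\<xi> i \<omega>\<bar> \<le> k" if "i < n" for i
    using \<xi>(2)[OF that] space_filtration[OF \<tau>pos] by auto
  \<comment> \<open>If \<open>t < \<tau> i\<close>, the value \<open>\<xi> i\<close> need not be
    known at the clamped point \<open>c i\<close>, but then the clamped cell is degenerate and its
    term vanishes. Hence the later case splits on \<open>t < \<tau> i\<close>.\<close>
  have flat: "c (Suc i) = c i" if "t < \<tau> i" for i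
    using that st monoD[OF \<tau>(1), of i "Suc i"] by (simp add: c_def)
  have meas: "\<xi> i \<in> borel_measurable (F (c i))" if "i < n" "\<not> t < \<tau> i" for i
    using measurable_filtration_mono[OF \<xi>(1)[OF that(1)] \<tau>pos, of "c i"] that by (simp add: c_def)
  have d: "martingale_increment (c i) (c (Suc i)) (d i)" if "i < n" for i
  proof (cases "t < \<tau> i")
    case True
    then have "d i = (\<lambda>_. 0)" by (auto simp: d_def flat)
    then show ?thesis by (simp add: martingale_increment_0)
  next
    case False
    from bd[OF that] obtain k where "\<forall>\<omega>\<in>space M. \<bar>\<xi> i \<omega>\<bar> \<le> k" by blast
    then show ?thesis unfolding d_def
      by (intro martingale_increment_mult[where c=k] wiener_martingale_increment[OF B] c
          meas[OF that False]) auto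
  qed
  have mi0: "martingale_increment (c 0) (c n) (\<lambda>\<omega>. \<Sum>i<n. d i \<omega>)"
    using orthogonal_increments[OF c(1) c(4) d, where g="\<lambda>_. 0"] by auto
  have mi: "martingale_increment s t (\<lambda>\<omega>. \<Sum>i<n. d i \<omega>)"
    by (rule martingale_increment_widen[OF mi0 st(1) c(2) monoD[OF c(1)] c(3)]) simp
  then show "martingale_increment s t
      (\<lambda>\<omega>. simple_integral n \<tau> \<xi> B t \<omega> - simple_integral n \<tau> \<xi> B s \<omega>)"
    by (simp add: eq)
  assume g: "g \<in> borel_measurable (F s)" "\<And>\<omega>. \<omega> \<in> space M \<Longrightarrow> 0 \<le> g \<omega> \<and> g \<omega> \<le> G"
  have gM: "g \<in> borel_measurable M" by (rule measurable_filtration[OF g(1) st(1)])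
  have gc: "g \<in> borel_measurable (F (c i))" for i
    by (rule measurable_filtration_mono[OF g(1) st(1) c(2)])
  have gabs: "\<bar>g \<omega>\<bar> \<le> G" if "\<omega> \<in> space M" for \<omega> using g(2)[OF that] by simp
  have gint: "integrable M g"
    using gabs gM by (intro integrable_const_bound[of _ G]) (auto intro!: AE_I2)
  have xi: "integrable M (\<lambda>\<omega>. g \<omega> * (\<xi> i \<omega>)\<^sup>2)" if i: "i < n" for i
  proof -
    from bd[OF i] obtain k where k: "\<forall>\<omega>\<in>space M. \<bar>\<xi> i \<omega>\<bar> \<le> k" by blast
    have "\<bar>(\<xi> i \<omega>)\<^sup>2\<bar> \<le> k\<^sup>2" if "\<omega> \<in> space M" for \<omega>
      using k that by (metis abs_ge_zero abs_power2 power2_abs power_mono)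
    moreover have "\<xi> i \<in> borel_measurable M" by (rule measurable_filtration[OF \<xi>(1)[OF i] \<tau>pos])
    ultimately have "integrable M (\<lambda>\<omega>. (\<xi> i \<omega>)\<^sup>2 * g \<omega>)"
      by (intro integrable_times_bounded[OF gint]) auto
    then show ?thesis by (simp add: mult.commute)
  qed
  have term_eq: "expectation (\<lambda>\<omega>. g \<omega> * (d i \<omega>)\<^sup>2)
      = (c (Suc i) - c i) * expectation (\<lambda>\<omega>. g \<omega> * (\<xi> i \<omega>)\<^sup>2)" if i: "i < n" for i
  proof (cases "t < \<tau> i")
    case True
    then show ?thesis by (simp add: d_def flat)
  next
    case False
    have "expectation (\<lambda>\<omega>. g \<omega> * (d i \<omega>)\<^sup>2)
        = expectation (\<lambda>\<omega>. (g \<omega> * (\<xi> i \<omega>)\<^sup>2) * (B (c (Suc i)) \<omega> - B (c i) \<omega>)\<^sup>2)"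
      by (simp add: d_def power_mult_distrib mult.assoc)
    also have "\<dots> = (c (Suc i) - c i) * expectation (\<lambda>\<omega>. g \<omega> * (\<xi> i \<omega>)\<^sup>2)"
      using meas[OF i False] gc[of i]
      by (intro wiener_increment_variance[OF B c(4) c(5)] xi i) auto
    finally show ?thesis .
  qed
  have "(\<integral>\<^sup>+\<omega>. ennreal (g \<omega> * (\<Sum>i<n. d i \<omega>)\<^sup>2) \<partial>M)
      = ennreal (expectation (\<lambda>\<omega>. g \<omega> * (\<Sum>i<n. d i \<omega>)\<^sup>2))"
    using mi g gM gabs unfolding martingale_increment_def
    by (intro nn_integral_eq_integral integrable_times_bounded[of _ _ _ G]) auto
  also have "expectation (\<lambda>\<omega>. g \<omega> * (\<Sum>i<n. d i \<omega>)\<^sup>2)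
      = (\<Sum>i<n. (c (Suc i) - c i) * expectation (\<lambda>\<omega>. g \<omega> * (\<xi> i \<omega>)\<^sup>2))"
    using orthogonal_increments[OF c(1) c(4) d gc gabs] term_eq by simp
  also have "\<dots> = expectation (\<lambda>\<omega>. g \<omega> * (\<Sum>i<n. (\<xi> i \<omega>)\<^sup>2 * (c (Suc i) - c i)))"
  proof -
    have "expectation (\<lambda>\<omega>. g \<omega> * (\<Sum>i<n. (\<xi> i \<omega>)\<^sup>2 * (c (Suc i) - c i)))
        = expectation (\<lambda>\<omega>. \<Sum>i<n. (c (Suc i) - c i) * (g \<omega> * (\<xi> i \<omega>)\<^sup>2))"
      by (simp add: sum_distrib_left mult_ac)
    also have "\<dots> = (\<Sum>i<n. expectation (\<lambda>\<omega>. (c (Suc i) - c i) * (g \<omega> * (\<xi> i \<omega>)\<^sup>2)))"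
      using xi by (intro Bochner_Integration.integral_sum) auto
    finally show ?thesis by simp
  qed
  also have "ennreal \<dots> = (\<integral>\<^sup>+\<omega>. ennreal (g \<omega> * (\<Sum>i<n. (\<xi> i \<omega>)\<^sup>2 * (c (Suc i) - c i))) \<partial>M)"
  proof (rule nn_integral_eq_integral[symmetric])
    have "integrable M (\<lambda>\<omega>. \<Sum>i<n. (c (Suc i) - c i) * (g \<omega> * (\<xi> i \<omega>)\<^sup>2))"
      using xi by auto
    then show "integrable M (\<lambda>\<omega>. g \<omega> * (\<Sum>i<n. (\<xi> i \<omega>)\<^sup>2 * (c (Suc i) - c i)))"
      by (simp add: sum_distrib_left mult_ac)
    show "AE \<omega> in M. 0 \<le> g \<omega> * (\<Sum>i<n. (\<xi> i \<omega>)\<^sup>2 * (c (Suc i) - c i))"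
      using g(2) c(5) by (intro AE_I2 mult_nonneg_nonneg sum_nonneg) auto
  qed
  also have "\<dots> = (\<integral>\<^sup>+\<omega>. ennreal (g \<omega>) *
      (\<integral>\<^sup>+r\<in>{s..t}. ennreal ((simple_process n \<tau> \<xi> r \<omega>)\<^sup>2) \<partial>lborel) \<partial>M)"
    unfolding simple_process_square_integral[OF \<tau>(1) st(2)] c_def
    using g(2) by (intro nn_integral_cong) (simp add: ennreal_mult')
  finally show "(\<integral>\<^sup>+\<omega>. ennreal (g \<omega> * (simple_integral n \<tau> \<xi> B t \<omega> - simple_integral n \<tau> \<xi> B s \<omega>)\<^sup>2) \<partial>M) =
        (\<integral>\<^sup>+\<omega>. ennreal (g \<omega>) *
            (\<integral>\<^sup>+r\<in>{s..t}. ennreal ((simple_process n \<tau> \<xi> r \<omega>)\<^sup>2) \<partial>lborel) \<partial>M)"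
    unfolding eq .
qed

end

section \<open>Second moments of It\^o integrals\<close>

context filtered_prob_space
begin

text \<open>After the isometry, the simple process is written as its error plus \<open>H\<close>,
  with \<open>H\<close> bounded by \<open>c\<close>; this costs a factor 2. The main term keeps the
  mean of \<open>g\<close>, as a conditional bound must. The error term may use the crude bound
  \<open>G\<close>, since it tends to zero along an approximating sequence.\<close>

lemma ito_integrand_error_bound:
  assumes B: "standard_wiener M F B" and S: "simple_integrand F n \<tau> \<xi>"
    and H: "(\<lambda>(s, \<omega>). H s \<omega>) \<in> borel_measurable (restrict_space borel {0..} \<Otimes>\<^sub>M M)"
      "\<And>r \<omega>. 0 \<le> r \<Longrightarrow> \<omega> \<in> space M \<Longrightarrow> \<bar>H r \<omega>\<bar> \<le> c"
    and st: "0 \<le> s" "s \<le> t" "t \<le> T"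
    and g: "g \<in> borel_measurable (F s)" "\<And>\<omega>. \<omega> \<in> space M \<Longrightarrow> 0 \<le> g \<omega> \<and> g \<omega> \<le> G"
  shows "(\<integral>\<^sup>+\<omega>. ennreal (g \<omega> * (simple_integral n \<tau> \<xi> B t \<omega> - simple_integral n \<tau> \<xi> B s \<omega>)\<^sup>2) \<partial>M)
    \<le> ennreal (2 * c\<^sup>2 * (t - s)) * (\<integral>\<^sup>+\<omega>. ennreal (g \<omega>) \<partial>M) +
      ennreal (2 * G) * (\<integral>\<^sup>+\<omega>. (\<integral>\<^sup>+r\<in>{0..T}. ennreal ((simple_process n \<tau> \<xi> r \<omega> - H r \<omega>)\<^sup>2) \<partial>lborel) \<partial>M)"
proof -
  \<comment> \<open>Measurability of \<open>H\<close> is given on nonnegative times only. Freezing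
    it at its value at time 0 for negative times yields a function jointly measurable with respect
    to \<open>lborel\<close>.\<close>
  define H' where "H' r \<omega> = H (max 0 r) \<omega>" for r \<omega>
  have "(\<lambda>(r, \<omega>). (max 0 r, \<omega>)) \<in> lborel \<Otimes>\<^sub>M M \<rightarrow>\<^sub>M restrict_space borel {0::real..} \<Otimes>\<^sub>M M"
    unfolding case_prod_beta
    by (intro measurable_Pair measurable_restrict_space2) auto
  from measurable_comp[OF this H(1)] have H'[measurable]: "(\<lambda>(r, \<omega>). H' r \<omega>) \<in> borel_measurable (lborel \<Otimes>\<^sub>M M)"
    by (simp add: comp_def case_prod_beta H'_def)
  have \<tau>: "mono \<tau>" "0 \<le> \<tau> 0" using S by (auto simp: simple_integrand_def)
  have [measurable]: "\<xi> i \<in> borel_measurable M" if "i < n" for i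
    using S that monoD[OF \<tau>(1), of 0 i] \<tau>(2)
    by (intro measurable_filtration[of _ "\<tau> i"]) (auto simp: simple_integrand_def)
  have sp[measurable]: "(\<lambda>(r, \<omega>). simple_process n \<tau> \<xi> r \<omega>) \<in> borel_measurable (lborel \<Otimes>\<^sub>M M)"
    unfolding simple_process_def case_prod_beta
    by (intro borel_measurable_sum borel_measurable_times) (auto intro!: measurable_compose[OF measurable_snd])
  define A where "A \<omega> = (\<integral>\<^sup>+r\<in>{0..T}. ennreal ((simple_process n \<tau> \<xi> r \<omega> - H r \<omega>)\<^sup>2) \<partial>lborel)" for \<omega>
  have A': "A \<omega> = (\<integral>\<^sup>+r. ennreal ((simple_process n \<tau> \<xi> r \<omega> - H' r \<omega>)\<^sup>2) * indicator {0..T} r \<partial>lborel)" for \<omega>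
    unfolding A_def by (intro nn_integral_cong) (auto simp: H'_def indicator_def)
  have Am[measurable]: "A \<in> borel_measurable M"
    unfolding A'
    by (rule lborel.borel_measurable_nn_integral)
      (use measurable_compose[OF measurable_pair_swap' sp] measurable_compose[OF measurable_pair_swap' H'] in
        \<open>simp add: case_prod_beta\<close>)
  have le: "(\<integral>\<^sup>+r\<in>{s..t}. ennreal ((simple_process n \<tau> \<xi> r \<omega>)\<^sup>2) \<partial>lborel)
      \<le> 2 * A \<omega> + ennreal (2 * c\<^sup>2 * (t - s))" if \<omega>: "\<omega> \<in> space M" for \<omega>
  proof -
    have m: "(\<lambda>r. ennreal ((simple_process n \<tau> \<xi> r \<omega> - H' r \<omega>)\<^sup>2) * indicator {0..T} r) \<in> borel_measurable lborel"
      using measurable_Pair2'[OF \<omega>, THEN measurable_compose, OF sp]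
        measurable_Pair2'[OF \<omega>, THEN measurable_compose, OF H'] by simp
    have "(\<integral>\<^sup>+r\<in>{s..t}. ennreal ((simple_process n \<tau> \<xi> r \<omega>)\<^sup>2) \<partial>lborel)
      \<le> (\<integral>\<^sup>+r. 2 * (ennreal ((simple_process n \<tau> \<xi> r \<omega> - H' r \<omega>)\<^sup>2) * indicator {0..T} r)
            + ennreal (2 * c\<^sup>2) * indicator {s..t} r \<partial>lborel)"
    proof (intro nn_integral_mono)
      fix r
      show "ennreal ((simple_process n \<tau> \<xi> r \<omega>)\<^sup>2) * indicator {s..t} r
        \<le> 2 * (ennreal ((simple_process n \<tau> \<xi> r \<omega> - H' r \<omega>)\<^sup>2) * indicator {0..T} r)
            + ennreal (2 * c\<^sup>2) * indicator {s..t} r"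
      proof (cases "r \<in> {s..t}")
        case True
        have "\<bar>H' r \<omega>\<bar> \<le> c" using H(2)[OF _ \<omega>] by (simp add: H'_def)
        then have "(H' r \<omega>)\<^sup>2 \<le> c\<^sup>2" by (metis abs_ge_zero power2_abs power_mono)
        with square_add_le[of "simple_process n \<tau> \<xi> r \<omega> - H' r \<omega>" "H' r \<omega>"]
        have "(simple_process n \<tau> \<xi> r \<omega>)\<^sup>2 \<le> 2 * (simple_process n \<tau> \<xi> r \<omega> - H' r \<omega>)\<^sup>2 + 2 * c\<^sup>2"
          by simp
        then have "ennreal ((simple_process n \<tau> \<xi> r \<omega>)\<^sup>2)
            \<le> ennreal (2 * (simple_process n \<tau> \<xi> r \<omega> - H' r \<omega>)\<^sup>2 + 2 * c\<^sup>2)" by (rule ennreal_leI)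
        with True st show ?thesis by (simp add: ennreal_plus ennreal_mult')
      qed simp
    qed
    also have "\<dots> = 2 * A \<omega> + ennreal (2 * c\<^sup>2 * (t - s))"
      unfolding A' using m st
      by (subst nn_integral_add) (auto simp: nn_integral_cmult nn_integral_cmult_indicator ennreal_mult')
    finally show ?thesis .
  qed
  have gM[measurable]: "g \<in> borel_measurable M" by (rule measurable_filtration[OF g(1) st(1)])
  have "(\<integral>\<^sup>+\<omega>. ennreal (g \<omega> * (simple_integral n \<tau> \<xi> B t \<omega> - simple_integral n \<tau> \<xi> B s \<omega>)\<^sup>2) \<partial>M)
     = (\<integral>\<^sup>+\<omega>. ennreal (g \<omega>) * (\<integral>\<^sup>+r\<in>{s..t}. ennreal ((simple_process n \<tau> \<xi> r \<omega>)\<^sup>2) \<partial>lborel) \<partial>M)"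
    by (rule simple_integral_isometry[OF B S st(1,2) g])
  also have "\<dots> \<le> (\<integral>\<^sup>+\<omega>. ennreal (2 * c\<^sup>2 * (t - s)) * ennreal (g \<omega>) + ennreal (2 * G) * A \<omega> \<partial>M)"
  proof (intro nn_integral_mono)
    fix \<omega> assume \<omega>: "\<omega> \<in> space M"
    have "ennreal (g \<omega>) * (\<integral>\<^sup>+r\<in>{s..t}. ennreal ((simple_process n \<tau> \<xi> r \<omega>)\<^sup>2) \<partial>lborel)
       \<le> ennreal (g \<omega>) * (2 * A \<omega> + ennreal (2 * c\<^sup>2 * (t - s)))"
      by (intro mult_left_mono le \<omega>) simp
    also have "\<dots> = ennreal (2 * c\<^sup>2 * (t - s)) * ennreal (g \<omega>) + ennreal (2 * g \<omega>) * A \<omega>"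
      using g(2)[OF \<omega>] by (simp add: distrib_left mult_ac add.commute ennreal_mult')
    also have "\<dots> \<le> ennreal (2 * c\<^sup>2 * (t - s)) * ennreal (g \<omega>) + ennreal (2 * G) * A \<omega>"
      using g(2)[OF \<omega>] by (intro add_left_mono mult_right_mono ennreal_leI) auto
    finally show "ennreal (g \<omega>) * (\<integral>\<^sup>+r\<in>{s..t}. ennreal ((simple_process n \<tau> \<xi> r \<omega>)\<^sup>2) \<partial>lborel)
       \<le> ennreal (2 * c\<^sup>2 * (t - s)) * ennreal (g \<omega>) + ennreal (2 * G) * A \<omega>" .
  qed
  also have "\<dots> = ennreal (2 * c\<^sup>2 * (t - s)) * (\<integral>\<^sup>+\<omega>. ennreal (g \<omega>) \<partial>M) + ennreal (2 * G) * (\<integral>\<^sup>+\<omega>. A \<omega> \<partial>M)"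
    by (subst nn_integral_add) (auto simp: nn_integral_cmult)
  finally show ?thesis unfolding A_def .
qed

text \<open>For the approximating simple integrals the transform is a sum of orthogonal martingale
  increments, so the bounds for the single cells add up. The passage to \<open>J\<close> is an
  \<open>L2\<close> limit at finitely many grid times, with \<open>N\<close> and \<open>G\<close>
  fixed, so crude losses in them disappear. The 4 is two factors 2: one from replacing
  \<open>J\<close> by simple integrals, one from \<open>ito_integrand_error_bound\<close>.\<close>

lemma ito_transform_bounded_weight:
  fixes t :: "nat \<Rightarrow> real"
  assumes B: "standard_wiener M F B" and J: "ito_integral M F B H J"
    and H: "\<And>r \<omega>. 0 \<le> r \<Longrightarrow> \<omega> \<in> space M \<Longrightarrow> \<bar>H r \<omega>\<bar> \<le> c"
    and t: "mono t" "0 \<le> t 0"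
    and \<zeta>: "\<And>n. \<zeta> n \<in> borel_measurable (F (t n))" "\<And>n \<omega>. \<omega> \<in> space M \<Longrightarrow> \<bar>\<zeta> n \<omega>\<bar> \<le> 1"
    and g: "g \<in> borel_measurable (F (t 0))" "\<And>\<omega>. \<omega> \<in> space M \<Longrightarrow> 0 \<le> g \<omega> \<and> g \<omega> \<le> G"
  shows "(\<integral>\<^sup>+\<omega>. ennreal (g \<omega> * (\<Sum>n<N. \<zeta> n \<omega> * (J (t (Suc n)) \<omega> - J (t n) \<omega>))\<^sup>2) \<partial>M)
    \<le> ennreal (4 * c\<^sup>2 * (t N - t 0)) * (\<integral>\<^sup>+\<omega>. ennreal (g \<omega>) \<partial>M)"
proof -
  have tpos: "0 \<le> t n" "t n \<le> t (Suc n)" "t 0 \<le> t n" for n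
    using t monoD[OF t(1), of 0 n] monoD[OF t(1), of n "Suc n"] by auto
  have tN: "t (Suc n) \<le> t N" if "n < N" for n using monoD[OF t(1), of "Suc n" N] that by simp
  obtain \<omega>0 where "\<omega>0 \<in> space M" using not_empty by blast
  with g(2) have G: "0 \<le> G" by force
  have gM[measurable]: "g \<in> borel_measurable M" by (rule measurable_filtration[OF g(1) t(2)])
  have zM[measurable]: "\<zeta> n \<in> borel_measurable M" for n by (rule measurable_filtration[OF \<zeta>(1) tpos(1)])
  have JM[measurable]: "J (t n) \<in> borel_measurable M" for n
    using J tpos by (auto simp: ito_integral_def)
  have Hm: "(\<lambda>(s, \<omega>). H s \<omega>) \<in> borel_measurable (restrict_space borel {0..} \<Otimes>\<^sub>M M)"
    using J by (simp add: ito_integral_def)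
  obtain k \<tau> \<xi> where S: "\<And>m. simple_integrand F (k m) (\<tau> m) (\<xi> m)"
    and lim1: "\<And>t. 0 \<le> t \<Longrightarrow> (\<lambda>m. \<integral>\<^sup>+\<omega>. (\<integral>\<^sup>+s\<in>{0..t}. ennreal ((simple_process (k m) (\<tau> m) (\<xi> m) s \<omega> - H s \<omega>)\<^sup>2) \<partial>lborel) \<partial>M) \<longlonglongrightarrow> 0"
    and lim2: "\<And>t. 0 \<le> t \<Longrightarrow> (\<lambda>m. \<integral>\<^sup>+\<omega>. ennreal ((simple_integral (k m) (\<tau> m) (\<xi> m) B t \<omega> - J t \<omega>)\<^sup>2) \<partial>M) \<longlonglongrightarrow> 0"
    using J unfolding ito_integral_def by blast
  define I where "I m = simple_integral (k m) (\<tau> m) (\<xi> m) B" for m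
  define a where "a m = (\<integral>\<^sup>+\<omega>. (\<integral>\<^sup>+s\<in>{0..t N}. ennreal ((simple_process (k m) (\<tau> m) (\<xi> m) s \<omega> - H s \<omega>)\<^sup>2) \<partial>lborel) \<partial>M)" for m
  define e where "e m r = (\<integral>\<^sup>+\<omega>. ennreal ((I m r \<omega> - J r \<omega>)\<^sup>2) \<partial>M)" for m r
  have IM[measurable]: "I m (t n) \<in> borel_measurable M" for m n
  proof -
    have "(\<lambda>\<omega>. I m (t n) \<omega> - I m 0 \<omega>) \<in> borel_measurable (F (t n))"
      using simple_integral_martingale_increment[OF B S order_refl tpos(1)]
      unfolding I_def martingale_increment_def by blast
    \<comment> \<open>The preceding fact gives measurability of increments only. At time 0 the
      integral vanishes, as all partition points are nonnegative, so the increment from 0 is the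
      integral itself.\<close>
    moreover have "I m 0 \<omega> = 0" for \<omega>
    proof -
      have "0 \<le> \<tau> m i" for i
        using S[of m] monoD[of "\<tau> m" 0 i] by (auto simp: simple_integrand_def)
      then show ?thesis by (simp add: I_def simple_integral_def)
    qed
    ultimately show ?thesis by (simp add: measurable_filtration[OF _ tpos(1)])
  qed
  let ?g = "\<integral>\<^sup>+\<omega>. ennreal (g \<omega>) \<partial>M"
  let ?J = "\<lambda>\<omega>. \<Sum>n<N. \<zeta> n \<omega> * (J (t (Suc n)) \<omega> - J (t n) \<omega>)"
  have bound: "(\<integral>\<^sup>+\<omega>. ennreal (g \<omega> * (?J \<omega>)\<^sup>2) \<partial>M)
     \<le> 2 * (ennreal (2 * c\<^sup>2 * (t N - t 0)) * ?g + of_nat N * (ennreal (2 * G) * a m))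
       + ennreal (4 * G * N) * (\<Sum>n<N. e m (t (Suc n)) + e m (t n))" for m
  proof -
    let ?d = "\<lambda>n \<omega>. I m (t (Suc n)) \<omega> - I m (t n) \<omega>"
    let ?S = "\<lambda>\<omega>. \<Sum>n<N. \<zeta> n \<omega> * ?d n \<omega>"
    have md: "martingale_increment (t n) (t (Suc n)) (\<lambda>\<omega>. \<zeta> n \<omega> * ?d n \<omega>)" for n
      unfolding I_def
      by (intro martingale_increment_mult[where c=1] simple_integral_martingale_increment[OF B S] tpos \<zeta>)
    have gabs: "\<bar>g \<omega>\<bar> \<le> G" if "\<omega> \<in> space M" for \<omega> using g(2)[OF that] by simp
    have int: "integrable M (\<lambda>\<omega>. g \<omega> * (d \<omega>)\<^sup>2)" if "martingale_increment s r d" for s r d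
      using that by (intro integrable_times_bounded[OF _ gM gabs]) (auto simp: martingale_increment_def)
    note orth = orthogonal_increments[OF t md g(1) gabs, of N]
    have "(\<integral>\<^sup>+\<omega>. ennreal (g \<omega> * (?S \<omega>)\<^sup>2) \<partial>M) = ennreal (expectation (\<lambda>\<omega>. g \<omega> * (?S \<omega>)\<^sup>2))"
      using orth g(2) by (intro nn_integral_eq_integral int) auto
    also have "expectation (\<lambda>\<omega>. g \<omega> * (?S \<omega>)\<^sup>2) = (\<Sum>n<N. expectation (\<lambda>\<omega>. g \<omega> * (\<zeta> n \<omega> * ?d n \<omega>)\<^sup>2))"
      using orth by simp
    also have "ennreal \<dots> = (\<Sum>n<N. ennreal (expectation (\<lambda>\<omega>. g \<omega> * (\<zeta> n \<omega> * ?d n \<omega>)\<^sup>2)))"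
      using g(2) by (intro sum_ennreal[symmetric] integral_nonneg_AE AE_I2 mult_nonneg_nonneg) auto
    also have "\<dots> = (\<Sum>n<N. \<integral>\<^sup>+\<omega>. ennreal (g \<omega> * (\<zeta> n \<omega> * ?d n \<omega>)\<^sup>2) \<partial>M)"
      using g(2) by (intro sum.cong refl nn_integral_eq_integral[symmetric] int[OF md]) auto
    also have "\<dots> \<le> (\<Sum>n<N. \<integral>\<^sup>+\<omega>. ennreal (g \<omega> * (?d n \<omega>)\<^sup>2) \<partial>M)"
    proof (intro sum_mono nn_integral_mono ennreal_leI mult_left_mono)
      fix n \<omega> assume \<omega>: "\<omega> \<in> space M"
      have "(\<zeta> n \<omega>)\<^sup>2 \<le> 1" using \<zeta>(2)[OF \<omega>] by (simp add: abs_square_le_1)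
      then show "(\<zeta> n \<omega> * ?d n \<omega>)\<^sup>2 \<le> (?d n \<omega>)\<^sup>2"
        unfolding power_mult_distrib by (intro mult_left_le_one_le) auto
      show "0 \<le> g \<omega>" using g(2)[OF \<omega>] by simp
    qed
    also have "\<dots> \<le> (\<Sum>n<N. ennreal (2 * c\<^sup>2 * (t (Suc n) - t n)) * ?g + ennreal (2 * G) * a m)"
      unfolding I_def a_def using tN
      by (intro sum_mono ito_integrand_error_bound[OF B S Hm H] tpos g
          measurable_filtration_mono[OF g(1) t(2)]) auto
    also have "\<dots> = (\<Sum>n<N. ennreal (2 * c\<^sup>2 * (t (Suc n) - t n))) * ?g + of_nat N * (ennreal (2 * G) * a m)"
      by (simp add: sum.distrib sum_distrib_right)
    also have "(\<Sum>n<N. ennreal (2 * c\<^sup>2 * (t (Suc n) - t n))) = ennreal (2 * c\<^sup>2 * (t N - t 0))"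
      using tpos by (subst sum_ennreal)
        (auto simp: sum_lessThan_telescope simp flip: sum_distrib_left)
    finally have 1: "(\<integral>\<^sup>+\<omega>. ennreal (g \<omega> * (?S \<omega>)\<^sup>2) \<partial>M)
      \<le> ennreal (2 * c\<^sup>2 * (t N - t 0)) * ?g + of_nat N * (ennreal (2 * G) * a m)" .
    have pt: "g \<omega> * (?J \<omega>)\<^sup>2 \<le> 2 * (g \<omega> * (?S \<omega>)\<^sup>2)
        + 4 * G * N * (\<Sum>n<N. (I m (t (Suc n)) \<omega> - J (t (Suc n)) \<omega>)\<^sup>2 + (I m (t n) \<omega> - J (t n) \<omega>)\<^sup>2)"
      if \<omega>: "\<omega> \<in> space M" for \<omega>
    proof -
      let ?x = "\<lambda>n. I m (t n) \<omega> - J (t n) \<omega>"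
      have "(\<Sum>n<N. \<zeta> n \<omega> * (?x n - ?x (Suc n)))\<^sup>2 \<le> N * (\<Sum>n<N. (\<zeta> n \<omega> * (?x n - ?x (Suc n)))\<^sup>2)"
        by (rule square_sum_le)
      also have "\<dots> \<le> N * (\<Sum>n<N. 2 * ((?x (Suc n))\<^sup>2 + (?x n)\<^sup>2))"
      proof (intro mult_left_mono sum_mono)
        fix n
        have "(\<zeta> n \<omega>)\<^sup>2 \<le> 1" using \<zeta>(2)[OF \<omega>] by (simp add: abs_square_le_1)
        then have "(\<zeta> n \<omega> * (?x n - ?x (Suc n)))\<^sup>2 \<le> (?x n - ?x (Suc n))\<^sup>2"
          unfolding power_mult_distrib by (intro mult_left_le_one_le) auto
        also have "\<dots> \<le> 2 * ((?x (Suc n))\<^sup>2 + (?x n)\<^sup>2)"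
          using square_diff_le[of "?x n" "?x (Suc n)"] by simp
        finally show "(\<zeta> n \<omega> * (?x n - ?x (Suc n)))\<^sup>2 \<le> 2 * ((?x (Suc n))\<^sup>2 + (?x n)\<^sup>2)" .
      qed simp
      finally have sq: "(\<Sum>n<N. \<zeta> n \<omega> * (?x n - ?x (Suc n)))\<^sup>2 \<le> 2 * N * (\<Sum>n<N. (?x (Suc n))\<^sup>2 + (?x n)\<^sup>2)"
        unfolding sum_distrib_left[symmetric] by (simp only: mult_ac)
      \<comment> \<open>The correction is the transform of \<open>J - I m\<close>, whose increments
        are \<open>?x n - ?x (Suc n)\<close>.\<close>
      have "?J \<omega> = ?S \<omega> + (\<Sum>n<N. \<zeta> n \<omega> * (?x n - ?x (Suc n)))"
        by (simp add: sum.distrib[symmetric] algebra_simps)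
      then have "(?J \<omega>)\<^sup>2 \<le> 2 * (?S \<omega>)\<^sup>2 + 2 * (\<Sum>n<N. \<zeta> n \<omega> * (?x n - ?x (Suc n)))\<^sup>2"
        by (simp only: square_add_le)
      also have "\<dots> \<le> 2 * (?S \<omega>)\<^sup>2 + 4 * N * (\<Sum>n<N. (?x (Suc n))\<^sup>2 + (?x n)\<^sup>2)"
        using sq by simp
      finally have "g \<omega> * (?J \<omega>)\<^sup>2 \<le> g \<omega> * (2 * (?S \<omega>)\<^sup>2 + 4 * N * (\<Sum>n<N. (?x (Suc n))\<^sup>2 + (?x n)\<^sup>2))"
        using g(2)[OF \<omega>] by (intro mult_left_mono) auto
      also have "\<dots> = 2 * (g \<omega> * (?S \<omega>)\<^sup>2) + g \<omega> * (4 * N * (\<Sum>n<N. (?x (Suc n))\<^sup>2 + (?x n)\<^sup>2))"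
        by (simp only: distrib_left mult.left_commute)
      also have "\<dots> \<le> 2 * (g \<omega> * (?S \<omega>)\<^sup>2) + G * (4 * N * (\<Sum>n<N. (?x (Suc n))\<^sup>2 + (?x n)\<^sup>2))"
        using g(2)[OF \<omega>] by (intro add_left_mono mult_right_mono mult_nonneg_nonneg sum_nonneg) auto
      finally show ?thesis by (simp only: mult_ac)
    qed
    have "(\<integral>\<^sup>+\<omega>. ennreal (g \<omega> * (?J \<omega>)\<^sup>2) \<partial>M)
      \<le> (\<integral>\<^sup>+\<omega>. 2 * ennreal (g \<omega> * (?S \<omega>)\<^sup>2) + ennreal (4 * G * N) *
           (\<Sum>n<N. ennreal ((I m (t (Suc n)) \<omega> - J (t (Suc n)) \<omega>)\<^sup>2) + ennreal ((I m (t n) \<omega> - J (t n) \<omega>)\<^sup>2)) \<partial>M)"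
    proof (intro nn_integral_mono)
      fix \<omega> assume \<omega>: "\<omega> \<in> space M"
      let ?x = "\<lambda>n. I m (t n) \<omega> - J (t n) \<omega>"
      have "ennreal (g \<omega> * (?J \<omega>)\<^sup>2) \<le> ennreal (2 * (g \<omega> * (?S \<omega>)\<^sup>2)
        + 4 * G * N * (\<Sum>n<N. (?x (Suc n))\<^sup>2 + (?x n)\<^sup>2))"
        by (intro ennreal_leI pt \<omega>)
      also have "\<dots> = ennreal (2 * (g \<omega> * (?S \<omega>)\<^sup>2)) + ennreal (4 * G * N) * ennreal (\<Sum>n<N. (?x (Suc n))\<^sup>2 + (?x n)\<^sup>2)"
        using g(2)[OF \<omega>] G by (subst ennreal_plus) (auto simp: ennreal_mult' intro!: sum_nonneg mult_nonneg_nonneg)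
      also have "ennreal (\<Sum>n<N. (?x (Suc n))\<^sup>2 + (?x n)\<^sup>2)
          = (\<Sum>n<N. ennreal ((?x (Suc n))\<^sup>2) + ennreal ((?x n)\<^sup>2))"
        by (simp flip: sum_ennreal ennreal_plus)
      also have "ennreal (2 * (g \<omega> * (?S \<omega>)\<^sup>2)) = 2 * ennreal (g \<omega> * (?S \<omega>)\<^sup>2)"
        using ennreal_mult'[of 2 "g \<omega> * (?S \<omega>)\<^sup>2"] by simp
      finally show "ennreal (g \<omega> * (?J \<omega>)\<^sup>2) \<le> 2 * ennreal (g \<omega> * (?S \<omega>)\<^sup>2) + ennreal (4 * G * N) *
           (\<Sum>n<N. ennreal ((?x (Suc n))\<^sup>2) + ennreal ((?x n)\<^sup>2))" .
    qed
    also have "\<dots> = 2 * (\<integral>\<^sup>+\<omega>. ennreal (g \<omega> * (?S \<omega>)\<^sup>2) \<partial>M)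
        + ennreal (4 * G * N) * (\<Sum>n<N. e m (t (Suc n)) + e m (t n))"
      unfolding e_def by (simp add: nn_integral_add nn_integral_cmult nn_integral_sum)
    also have "\<dots> \<le> 2 * (ennreal (2 * c\<^sup>2 * (t N - t 0)) * ?g + of_nat N * (ennreal (2 * G) * a m))
       + ennreal (4 * G * N) * (\<Sum>n<N. e m (t (Suc n)) + e m (t n))"
      by (intro add_right_mono mult_left_mono 1) simp
    finally show ?thesis .
  qed
  \<comment> \<open>For fixed \<open>N\<close> and \<open>G\<close> both error terms vanish as
    \<open>m\<close> grows; the isometry term does not depend on \<open>m\<close> and
    survives.\<close>
  have "(\<lambda>m. 2 * (ennreal (2 * c\<^sup>2 * (t N - t 0)) * ?g + of_nat N * (ennreal (2 * G) * a m))
       + ennreal (4 * G * N) * (\<Sum>n<N. e m (t (Suc n)) + e m (t n)))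
    \<longlonglongrightarrow> 2 * (ennreal (2 * c\<^sup>2 * (t N - t 0)) * ?g + of_nat N * (ennreal (2 * G) * 0))
       + ennreal (4 * G * N) * (\<Sum>n<N. 0 + 0)"
    unfolding a_def e_def I_def
    by (intro tendsto_add ennreal_tendsto_cmult tendsto_sum tendsto_const lim1 lim2 tpos)
      (auto simp: of_nat_less_top)
  from LIMSEQ_le_const[OF this] bound
  have "(\<integral>\<^sup>+\<omega>. ennreal (g \<omega> * (?J \<omega>)\<^sup>2) \<partial>M) \<le> 2 * (ennreal (2 * c\<^sup>2 * (t N - t 0)) * ?g)"
    by simp
  also have "\<dots> = ennreal (4 * c\<^sup>2 * (t N - t 0)) * ?g"
    using ennreal_mult'[of 2 "2 * c\<^sup>2 * (t N - t 0)"] by (simp add: mult_ac)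
  finally show ?thesis .
qed

text \<open>The constant 4 instead of 1 avoids passing to the limit in the isometry itself.\<close>

lemma ito_transform_bound:
  fixes t :: "nat \<Rightarrow> real"
  assumes B: "standard_wiener M F B" and J: "ito_integral M F B H J"
    and H: "\<And>r \<omega>. 0 \<le> r \<Longrightarrow> \<omega> \<in> space M \<Longrightarrow> \<bar>H r \<omega>\<bar> \<le> c"
    and t: "mono t" "0 \<le> t 0"
    and \<zeta>: "\<And>n. \<zeta> n \<in> borel_measurable (F (t n))" "\<And>n \<omega>. \<omega> \<in> space M \<Longrightarrow> \<bar>\<zeta> n \<omega>\<bar> \<le> 1"
    and g: "g \<in> borel_measurable (F (t 0))" "\<And>\<omega>. \<omega> \<in> space M \<Longrightarrow> 0 \<le> g \<omega>"
  shows "(\<integral>\<^sup>+\<omega>. ennreal (g \<omega> * (\<Sum>n<N. \<zeta> n \<omega> * (J (t (Suc n)) \<omega> - J (t n) \<omega>))\<^sup>2) \<partial>M)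
    \<le> ennreal (4 * c\<^sup>2 * (t N - t 0)) * (\<integral>\<^sup>+\<omega>. ennreal (g \<omega>) \<partial>M)"
proof -
  let ?D = "\<lambda>\<omega>. \<Sum>n<N. \<zeta> n \<omega> * (J (t (Suc n)) \<omega> - J (t n) \<omega>)"
  have tpos: "0 \<le> t n" for n
    using t monoD[OF t(1), of 0 n] by auto
  have [measurable]: "g \<in> borel_measurable M" by (rule measurable_filtration[OF g(1) t(2)])
  have [measurable]: "\<zeta> n \<in> borel_measurable M" for n by (rule measurable_filtration[OF \<zeta>(1) tpos(1)])
  have [measurable]: "J (t n) \<in> borel_measurable M" for n
    using J tpos by (auto simp: ito_integral_def)
  \<comment> \<open>The weight is truncated at level \<open>k\<close>, and monotone convergence
    removes the truncation. Unbounded weights matter because the reflected sums below serve as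
    weights.\<close>
  have "ennreal (g \<omega> * (?D \<omega>)\<^sup>2) = (SUP k. ennreal (min (g \<omega>) (real k) * (?D \<omega>)\<^sup>2))"
    if \<omega>: "\<omega> \<in> space M" for \<omega>
  proof (rule antisym)
    obtain k where "g \<omega> \<le> real k" using real_arch_simple by blast
    then show "ennreal (g \<omega> * (?D \<omega>)\<^sup>2) \<le> (SUP k. ennreal (min (g \<omega>) (real k) * (?D \<omega>)\<^sup>2))"
      by (intro SUP_upper2[of k]) auto
    show "(SUP k. ennreal (min (g \<omega>) (real k) * (?D \<omega>)\<^sup>2)) \<le> ennreal (g \<omega> * (?D \<omega>)\<^sup>2)"
      by (intro SUP_least ennreal_leI mult_right_mono) auto
  qed
  then have "(\<integral>\<^sup>+\<omega>. ennreal (g \<omega> * (?D \<omega>)\<^sup>2) \<partial>M)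
     = (\<integral>\<^sup>+\<omega>. (SUP k. ennreal (min (g \<omega>) (real k) * (?D \<omega>)\<^sup>2)) \<partial>M)"
    by (rule nn_integral_cong)
  also have "\<dots> = (SUP k. \<integral>\<^sup>+\<omega>. ennreal (min (g \<omega>) (real k) * (?D \<omega>)\<^sup>2) \<partial>M)"
    by (rule nn_integral_monotone_convergence_SUP)
      (auto simp: incseq_def le_fun_def intro!: ennreal_leI mult_right_mono)
  also have "\<dots> \<le> ennreal (4 * c\<^sup>2 * (t N - t 0)) * (\<integral>\<^sup>+\<omega>. ennreal (g \<omega>) \<partial>M)"
  proof (rule SUP_least)
    fix k
    have "(\<integral>\<^sup>+\<omega>. ennreal (min (g \<omega>) (real k) * (?D \<omega>)\<^sup>2) \<partial>M)
      \<le> ennreal (4 * c\<^sup>2 * (t N - t 0)) * (\<integral>\<^sup>+\<omega>. ennreal (min (g \<omega>) (real k)) \<partial>M)"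
      using g by (intro ito_transform_bounded_weight[OF B J H t \<zeta>, where G="real k"]) auto
    also have "\<dots> \<le> ennreal (4 * c\<^sup>2 * (t N - t 0)) * (\<integral>\<^sup>+\<omega>. ennreal (g \<omega>) \<partial>M)"
      by (intro mult_left_mono nn_integral_mono ennreal_leI) auto
    finally show "(\<integral>\<^sup>+\<omega>. ennreal (min (g \<omega>) (real k) * (?D \<omega>)\<^sup>2) \<partial>M)
      \<le> ennreal (4 * c\<^sup>2 * (t N - t 0)) * (\<integral>\<^sup>+\<omega>. ennreal (g \<omega>) \<partial>M)" .
  qed
  finally show ?thesis .
qed

end

section \<open>Scores and plays of one player\<close>

text \<open>The Lindley recursion: partial sums of \<open>\<rho> - c\<close> reflected at zero. It
  dominates these sums and, unlike them, is nonnegative, so it can act as a weight in a one-sided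
  conditional bound.\<close>

primrec excess :: "(nat \<Rightarrow> 'w \<Rightarrow> real) \<Rightarrow> (nat \<Rightarrow> real) \<Rightarrow> nat \<Rightarrow> 'w \<Rightarrow> real" where
  "excess \<rho> c 0 \<omega> = 0"
| "excess \<rho> c (Suc n) \<omega> = max 0 (excess \<rho> c n \<omega> + \<rho> n \<omega> - c n)"

lemma excess_nonneg: "0 \<le> excess \<rho> c n \<omega>"
  by (cases n) auto

lemma sum_le_excess: "(\<Sum>n<N. \<rho> n \<omega>) \<le> (\<Sum>n<N. c n) + excess \<rho> c N \<omega>"
  by (induction N) (simp_all add: max_def)

context filtered_prob_space
begin

text \<open>The reflected sum plays the role of a martingale, without conditional expectations:
  the cross term is nonpositive because \<open>excess \<rho> c n\<close> is a nonnegative weight in \<open>comp\<close>.\<close>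

lemma excess_second_moment:
  fixes t :: "nat \<Rightarrow> real"
  assumes t: "mono t" "0 \<le> t 0"
    and \<rho>: "\<And>n. \<rho> n \<in> borel_measurable (F (t (Suc n)))" "\<And>n \<omega>. \<omega> \<in> space M \<Longrightarrow> 0 \<le> \<rho> n \<omega>"
    and c: "\<And>n. 0 \<le> c n"
    and comp: "\<And>n g. g \<in> borel_measurable (F (t n)) \<Longrightarrow> (\<And>\<omega>. \<omega> \<in> space M \<Longrightarrow> 0 \<le> g \<omega>) \<Longrightarrow>
       (\<integral>\<^sup>+\<omega>. ennreal (g \<omega> * \<rho> n \<omega>) \<partial>M) \<le> ennreal (c n) * (\<integral>\<^sup>+\<omega>. ennreal (g \<omega>) \<partial>M)"
    and v: "\<And>n. (\<integral>\<^sup>+\<omega>. ennreal ((\<rho> n \<omega>)\<^sup>2) \<partial>M) + ennreal ((c n)\<^sup>2) \<le> ennreal v" "0 \<le> v"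
  shows "excess \<rho> c n \<in> borel_measurable (F (t n)) \<and>
    (\<integral>\<^sup>+\<omega>. ennreal ((excess \<rho> c n \<omega>)\<^sup>2) \<partial>M) \<le> ennreal (real n * v)"
proof (induction n)
  case 0
  then show ?case by (simp cong: measurable_cong)
next
  case (Suc n)
  let ?P = "excess \<rho> c n"
  have tpos: "0 \<le> t n" "t n \<le> t (Suc n)" for n
    using t monoD[OF t(1), of 0 n] monoD[OF t(1), of n "Suc n"] by auto
  have P: "?P \<in> borel_measurable (F (t n))" using Suc by simp
  have m: "?P \<in> borel_measurable (F (t (Suc n)))"
    by (rule measurable_filtration_mono[OF P tpos])
  have S: "excess \<rho> c (Suc n) = (\<lambda>\<omega>. max 0 (?P \<omega> + \<rho> n \<omega> - c n))"
    by (rule ext) simp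
  have meas: "excess \<rho> c (Suc n) \<in> borel_measurable (F (t (Suc n)))"
    unfolding S using m \<rho>(1) by measurable
  have [measurable]: "?P \<in> borel_measurable M" "\<rho> n \<in> borel_measurable M"
    using measurable_filtration[OF P tpos(1)] measurable_filtration[OF \<rho>(1) tpos(1)] by auto
  have PM[measurable]: "excess \<rho> c (Suc n) \<in> borel_measurable M"
    by (rule measurable_filtration[OF meas tpos(1)])
  let ?e = "\<integral>\<^sup>+\<omega>. ennreal (?P \<omega>) \<partial>M" and ?e2 = "\<integral>\<^sup>+\<omega>. ennreal ((?P \<omega>)\<^sup>2) \<partial>M"
  have e2: "?e2 \<le> ennreal (real n * v)" using Suc by simp
  \<comment> \<open>Finiteness of the first moment, obtained from the second moment of the induction
    hypothesis, allows \<open>2 * c n * ?e\<close> to be cancelled at the end.\<close>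
  have "?e \<le> (\<integral>\<^sup>+\<omega>. 1 + ennreal ((?P \<omega>)\<^sup>2) \<partial>M)"
  proof (intro nn_integral_mono)
    fix \<omega>
    have "0 \<le> (?P \<omega> - 1/2)\<^sup>2" by simp
    then have "?P \<omega> \<le> 1 + (?P \<omega>)\<^sup>2" by (simp add: power2_diff power_divide)
    then have "ennreal (?P \<omega>) \<le> ennreal (1 + (?P \<omega>)\<^sup>2)" by (rule ennreal_leI)
    then show "ennreal (?P \<omega>) \<le> 1 + ennreal ((?P \<omega>)\<^sup>2)" by (simp add: ennreal_plus)
  qed
  also have "\<dots> = 1 + ?e2"
    by (subst nn_integral_add) (auto simp: emeasure_space_1)
  also have "\<dots> < \<top>" using e2 by (simp add: less_top[symmetric] top_unique)
       (metis ennreal_less_top linorder_not_less top.extremum_unique)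
  finally have fin: "ennreal (2 * c n) * ?e \<noteq> \<infinity>"
    by (simp add: ennreal_mult_eq_top_iff)
  \<comment> \<open>The negative cross term is kept on the left as a positive one, because
    subtraction in \<open>ennreal\<close> is truncated at zero.\<close>
  have "ennreal (2 * c n) * ?e + (\<integral>\<^sup>+\<omega>. ennreal ((excess \<rho> c (Suc n) \<omega>)\<^sup>2) \<partial>M)
    = (\<integral>\<^sup>+\<omega>. ennreal (2 * c n) * ennreal (?P \<omega>) + ennreal ((excess \<rho> c (Suc n) \<omega>)\<^sup>2) \<partial>M)"
    by (subst nn_integral_add) (auto simp: nn_integral_cmult)
  also have "\<dots> \<le> (\<integral>\<^sup>+\<omega>. ennreal ((?P \<omega>)\<^sup>2) + 2 * ennreal (?P \<omega> * \<rho> n \<omega>) + ennreal ((\<rho> n \<omega>)\<^sup>2) + ennreal ((c n)\<^sup>2) \<partial>M)"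
  proof (intro nn_integral_mono)
    fix \<omega> assume \<omega>: "\<omega> \<in> space M"
    let ?x = "?P \<omega> + \<rho> n \<omega> - c n"
    have nn: "0 \<le> ?P \<omega>" "0 \<le> \<rho> n \<omega>" "0 \<le> c n" using excess_nonneg \<rho>(2)[OF \<omega>] c by auto
    have "(max 0 ?x)\<^sup>2 \<le> ?x\<^sup>2" by (simp add: max_def)
    also have "\<dots> = (?P \<omega>)\<^sup>2 + 2 * (?P \<omega> * \<rho> n \<omega>) + (\<rho> n \<omega>)\<^sup>2 + (c n)\<^sup>2 - 2 * (c n * ?P \<omega>) - 2 * (c n * \<rho> n \<omega>)"
      by (simp add: power2_eq_square algebra_simps)
    also have "\<dots> \<le> (?P \<omega>)\<^sup>2 + 2 * (?P \<omega> * \<rho> n \<omega>) + (\<rho> n \<omega>)\<^sup>2 + (c n)\<^sup>2 - 2 * (c n * ?P \<omega>)"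
      using nn by simp
    finally have "ennreal (2 * c n * ?P \<omega> + (excess \<rho> c (Suc n) \<omega>)\<^sup>2)
       \<le> ennreal ((?P \<omega>)\<^sup>2 + 2 * (?P \<omega> * \<rho> n \<omega>) + (\<rho> n \<omega>)\<^sup>2 + (c n)\<^sup>2)"
      by (intro ennreal_leI) simp
    then show "ennreal (2 * c n) * ennreal (?P \<omega>) + ennreal ((excess \<rho> c (Suc n) \<omega>)\<^sup>2)
      \<le> ennreal ((?P \<omega>)\<^sup>2) + 2 * ennreal (?P \<omega> * \<rho> n \<omega>) + ennreal ((\<rho> n \<omega>)\<^sup>2) + ennreal ((c n)\<^sup>2)"
      using nn by (simp add: ennreal_plus ennreal_mult' mult_ac)
  qed
  also have "\<dots> = ?e2 + 2 * (\<integral>\<^sup>+\<omega>. ennreal (?P \<omega> * \<rho> n \<omega>) \<partial>M) + (\<integral>\<^sup>+\<omega>. ennreal ((\<rho> n \<omega>)\<^sup>2) \<partial>M) + ennreal ((c n)\<^sup>2)"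
    by (simp add: nn_integral_add nn_integral_cmult emeasure_space_1)
  \<comment> \<open>\<open>comp\<close> with weight \<open>?P\<close> bounds the positive cross term
    by exactly the one kept on the left, so each step gains only \<open>v\<close>.\<close>
  also have "\<dots> \<le> ennreal (real n * v) + 2 * (ennreal (c n) * ?e) + ennreal v"
    unfolding add.assoc
    by (intro add_mono e2 mult_left_mono comp P v[unfolded add.assoc]) (auto simp: excess_nonneg)
  also have "\<dots> = ennreal (2 * c n) * ?e + ennreal (real (Suc n) * v)"
  proof -
    have "ennreal (real (Suc n) * v) = ennreal (real n * v) + ennreal v"
      using v(2) by (simp add: distrib_right add.commute flip: ennreal_plus)
    moreover have "2 * (ennreal (c n) * ?e) = ennreal (2 * c n) * ?e"
      using c by (simp add: ennreal_mult' mult.assoc)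
    ultimately show ?thesis by (simp only: add_ac)
  qed
  finally have "(\<integral>\<^sup>+\<omega>. ennreal ((excess \<rho> c (Suc n) \<omega>)\<^sup>2) \<partial>M) \<le> ennreal (real (Suc n) * v)"
    using fin by (simp only: ennreal_add_left_cancel_le simp_thms)
  with meas show ?case by blast
qed

end

section \<open>One learner facing a given drift\<close>

lemma borel_measurable_vec_nth:
  fixes f :: "'w \<Rightarrow> real ^ 'a::finite"
  assumes "\<And>a. (\<lambda>\<omega>. f \<omega> $ a) \<in> borel_measurable N"
  shows "f \<in> borel_measurable N"
proof -
  have "(\<lambda>\<omega>. f \<omega> \<bullet> i) \<in> borel_measurable N" if "i \<in> Basis" for i
    using that assms by (auto simp: Basis_vec_def inner_axis)
  then show ?thesis using borel_measurable_euclidean_space by blast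
qed

lemma norm_square_vec: "(norm (x :: real ^ 'a::finite))\<^sup>2 = (\<Sum>a\<in>UNIV. (x $ a)\<^sup>2)"
  by (simp add: norm_vec_def L2_set_def sum_nonneg)

text \<open>The opponent enters only through the drift \<open>b\<close>, which is assumed bounded
  and almost surely continuous. The regret estimate is thus unilateral, and each player of the game
  is one instance.\<close>

locale perturbed_learner = filtered_prob_space M F
  for M :: "'w measure" and F :: "real \<Rightarrow> 'w measure" +
  fixes B :: "'a::finite \<Rightarrow> real \<Rightarrow> 'w \<Rightarrow> real"
    and b :: "real \<Rightarrow> 'w \<Rightarrow> real ^ 'a"
    and s :: "'a \<Rightarrow> real \<Rightarrow> 'w \<Rightarrow> real"
    and Y :: "real \<Rightarrow> 'w \<Rightarrow> real ^ 'a"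
    and h :: "real ^ 'a \<Rightarrow> real"
    and \<eta> :: "real \<Rightarrow> real"
    and X :: "real \<Rightarrow> 'w \<Rightarrow> real ^ 'a"
    and c V :: real
  assumes wiener: "\<And>a. standard_wiener M F (B a)"
    and ito: "\<And>a. ito_process M F (B a) (\<lambda>t \<omega>. b t \<omega> $ a) (s a) (\<lambda>t \<omega>. Y t \<omega> $ a)"
    and s_bound: "\<And>a t \<omega>. 0 \<le> t \<Longrightarrow> \<omega> \<in> space M \<Longrightarrow> \<bar>s a t \<omega>\<bar> \<le> c"
    and b_bound: "\<And>a t \<omega>. 0 \<le> t \<Longrightarrow> \<omega> \<in> space M \<Longrightarrow> \<bar>b t \<omega> $ a\<bar> \<le> V"
    and b_cont: "AE \<omega> in M. continuous_on {0..} (\<lambda>t. b t \<omega>)"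
    and penalty: "penalty_function h"
    and learning: "learning_parameter \<eta>"
    and X_eq: "\<And>t \<omega>. 0 \<le> t \<Longrightarrow> \<omega> \<in> space M \<Longrightarrow> X t \<omega> = choice_map h (\<eta> t *\<^sub>R Y t \<omega>)"
begin

text \<open>Fixes the stochastic integral that \<open>ito_process\<close> hides behind an
  existential quantifier. It is a version at each time separately, so its identity with the scores
  is used at countably many times at once.\<close>

definition noise :: "'a \<Rightarrow> real \<Rightarrow> 'w \<Rightarrow> real" where
  "noise a = (SOME J. ito_integral M F (B a) (s a) J \<and>
     (\<forall>t\<ge>0. AE \<omega> in M. Y t \<omega> $ a = Y 0 \<omega> $ a + integral {0..t} (\<lambda>r. b r \<omega> $ a) + J t \<omega>))"

lemma
  shows noise_ito_integral: "ito_integral M F (B a) (s a) (noise a)"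
    and noise_eq: "0 \<le> t \<Longrightarrow>
      AE \<omega> in M. Y t \<omega> $ a = Y 0 \<omega> $ a + integral {0..t} (\<lambda>r. b r \<omega> $ a) + noise a t \<omega>"
proof -
  have "\<exists>J. ito_integral M F (B a) (s a) J \<and>
     (\<forall>t\<ge>0. AE \<omega> in M. Y t \<omega> $ a = Y 0 \<omega> $ a + integral {0..t} (\<lambda>r. b r \<omega> $ a) + J t \<omega>)"
    using ito[of a] unfolding ito_process_def by blast
  from someI_ex[OF this] show "ito_integral M F (B a) (s a) (noise a)"
    "0 \<le> t \<Longrightarrow> AE \<omega> in M. Y t \<omega> $ a = Y 0 \<omega> $ a + integral {0..t} (\<lambda>r. b r \<omega> $ a) + noise a t \<omega>"
    unfolding noise_def by blast+
qed

lemma noise_measurable [measurable]: "0 \<le> t \<Longrightarrow> noise a t \<in> borel_measurable M"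
  using noise_ito_integral[of a] by (simp add: ito_integral_def)

lemma drift_integrable:
  assumes "continuous_on {0..} (\<lambda>t. b t \<omega>)" "0 \<le> r"
  shows "(\<lambda>t. b t \<omega>) integrable_on {r..t}" "(\<lambda>t. b t \<omega> $ a) integrable_on {r..t}"
proof -
  have "continuous_on {r..t} (\<lambda>t. b t \<omega>)"
    using assms(2) by (intro continuous_on_subset[OF assms(1)]) auto
  then show "(\<lambda>t. b t \<omega>) integrable_on {r..t}" "(\<lambda>t. b t \<omega> $ a) integrable_on {r..t}"
    by (auto intro!: integrable_continuous_real continuous_intros)
qed

lemma score_increment:
  assumes "0 \<le> r" "r \<le> t"
  shows "AE \<omega> in M. Y t \<omega> $ a - Y r \<omega> $ a
    = integral {r..t} (\<lambda>u. b u \<omega> $ a) + (noise a t \<omega> - noise a r \<omega>)"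
  using noise_eq[OF order_trans[OF assms], of a] noise_eq[OF assms(1), of a] b_cont
proof eventually_elim
  case (elim \<omega>)
  have "integral {0..r} (\<lambda>u. b u \<omega> $ a) + integral {r..t} (\<lambda>u. b u \<omega> $ a) = integral {0..t} (\<lambda>u. b u \<omega> $ a)"
    using elim assms by (intro Henstock_Kurzweil_Integration.integral_combine drift_integrable) auto
  with elim show ?case by simp
qed

lemma score_adapted: "0 \<le> t \<Longrightarrow> Y t \<in> borel_measurable (F t)"
  using ito by (intro borel_measurable_vec_nth) (auto simp: ito_process_def adapted_def)

lemma play_adapted:
  assumes "0 \<le> t"
  shows "X t \<in> borel_measurable (F t)"
proof -
  have "choice_map h \<in> borel_measurable borel"
    by (intro borel_measurable_continuous_onI choice_map_continuous penalty)
  then have "(\<lambda>\<omega>. choice_map h (\<eta> t *\<^sub>R Y t \<omega>)) \<in> borel_measurable (F t)"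
    using score_adapted[OF assms] by measurable
  then show ?thesis
    by (subst measurable_cong[OF X_eq]) (simp_all add: assms space_filtration)
qed

lemma play_mixed: "0 \<le> t \<Longrightarrow> \<omega> \<in> space M \<Longrightarrow> X t \<omega> \<in> mixed_strategies"
  using X_eq choice_map_mixed[OF penalty] by simp

lemma play_component_le: "0 \<le> t \<Longrightarrow> \<omega> \<in> space M \<Longrightarrow> \<bar>X t \<omega> $ a\<bar> \<le> 1"
  using play_mixed mixed_strategies_le_1[of "X t \<omega>" a] by (force simp: mixed_strategies_def)

text \<open>A conditional \<open>O(t - r)\<close> bound in integrated form. Per coordinate, the
  drift contributes \<open>(V * (t - r))^2\<close>, at most \<open>V^2 * (t - r)\<close> as
  \<open>t - r \<le> 1\<close>, and the noise \<open>4 * c^2 * (t - r)\<close>. Splitting the square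
  doubles both, and \<open>CARD('a)\<close> counts the coordinates.\<close>

lemma score_increment_second_moment:
  assumes t: "0 \<le> r" "r \<le> t" "t \<le> r + 1"
    and g: "g \<in> borel_measurable (F r)" "\<And>\<omega>. \<omega> \<in> space M \<Longrightarrow> 0 \<le> g \<omega>"
  shows "(\<integral>\<^sup>+\<omega>. ennreal (g \<omega> * (norm (Y t \<omega> - Y r \<omega>))\<^sup>2) \<partial>M)
    \<le> ennreal (CARD('a) * (2 * V\<^sup>2 + 8 * c\<^sup>2) * (t - r)) * (\<integral>\<^sup>+\<omega>. ennreal (g \<omega>) \<partial>M)"
proof -
  let ?g = "\<integral>\<^sup>+\<omega>. ennreal (g \<omega>) \<partial>M"
  have [measurable]: "g \<in> borel_measurable M" by (rule measurable_filtration[OF g(1) t(1)])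
  have Ym: "Y t \<in> borel_measurable M" "Y r \<in> borel_measurable M"
    using measurable_filtration[OF score_adapted] t by auto
  have [measurable]: "(\<lambda>\<omega>. Y t \<omega> $ a - Y r \<omega> $ a) \<in> borel_measurable M" for a
    using Ym by (intro borel_measurable_diff) (auto intro: borel_measurable_continuous_on[OF continuous_on_component[OF continuous_on_id]])
  have [measurable]: "noise a t \<in> borel_measurable M" "noise a r \<in> borel_measurable M" for a
    using t by (auto intro: noise_measurable)
  have V: "0 \<le> V" using b_bound[OF order_refl] not_empty by fastforce
  have comp: "(\<integral>\<^sup>+\<omega>. ennreal (g \<omega> * (Y t \<omega> $ a - Y r \<omega> $ a)\<^sup>2) \<partial>M)
      \<le> ennreal ((2 * V\<^sup>2 + 8 * c\<^sup>2) * (t - r)) * ?g" for a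
  proof -
    \<comment> \<open>A grid that jumps from \<open>r\<close> to \<open>t\<close> and stays there;
      the transform bound with \<open>N = 1\<close> and multiplier 1 then speaks about a single
      increment.\<close>
    let ?t = "\<lambda>n::nat. if n = 0 then r else t"
    have "(\<integral>\<^sup>+\<omega>. ennreal (g \<omega> * (\<Sum>n<1. 1 * (noise a (?t (Suc n)) \<omega> - noise a (?t n) \<omega>))\<^sup>2) \<partial>M)
      \<le> ennreal (4 * c\<^sup>2 * (?t 1 - ?t 0)) * ?g"
      using t g s_bound
      by (intro ito_transform_bound[OF wiener noise_ito_integral]) (auto simp: mono_def)
    then have n: "(\<integral>\<^sup>+\<omega>. ennreal (g \<omega> * (noise a t \<omega> - noise a r \<omega>)\<^sup>2) \<partial>M) \<le> ennreal (4 * c\<^sup>2 * (t - r)) * ?g"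
      by simp
    have "(\<integral>\<^sup>+\<omega>. ennreal (g \<omega> * (Y t \<omega> $ a - Y r \<omega> $ a)\<^sup>2) \<partial>M)
      \<le> (\<integral>\<^sup>+\<omega>. ennreal (2 * V\<^sup>2 * (t - r)) * ennreal (g \<omega>) + 2 * ennreal (g \<omega> * (noise a t \<omega> - noise a r \<omega>)\<^sup>2) \<partial>M)"
    proof (rule nn_integral_mono_AE)
      show "AE \<omega> in M. ennreal (g \<omega> * (Y t \<omega> $ a - Y r \<omega> $ a)\<^sup>2)
        \<le> ennreal (2 * V\<^sup>2 * (t - r)) * ennreal (g \<omega>) + 2 * ennreal (g \<omega> * (noise a t \<omega> - noise a r \<omega>)\<^sup>2)"
        using score_increment[OF t(1,2), of a] b_cont AE_space
      proof eventually_elim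
        case (elim \<omega>)
        let ?i = "integral {r..t} (\<lambda>u. b u \<omega> $ a)" and ?n = "noise a t \<omega> - noise a r \<omega>"
        have "norm ?i \<le> V * (t - r)"
          using elim t b_bound by (intro integral_bound) (auto intro!: continuous_on_subset[OF elim(2)] continuous_intros)
        then have "?i\<^sup>2 \<le> (V * (t - r))\<^sup>2" by (metis norm_ge_zero power_mono real_norm_def power2_abs)
        also have "\<dots> \<le> V\<^sup>2 * (t - r)"
        proof -
          have "(t - r)\<^sup>2 \<le> t - r" using t by (simp add: power2_eq_square mult_left_le_one_le)
          then show ?thesis unfolding power_mult_distrib by (intro mult_left_mono) auto
        qed
        finally have "(Y t \<omega> $ a - Y r \<omega> $ a)\<^sup>2 \<le> 2 * (V\<^sup>2 * (t - r)) + 2 * ?n\<^sup>2"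
          using elim(1) square_add_le[of ?i ?n] by simp
        then have "g \<omega> * (Y t \<omega> $ a - Y r \<omega> $ a)\<^sup>2 \<le> g \<omega> * (2 * (V\<^sup>2 * (t - r)) + 2 * ?n\<^sup>2)"
          using g(2)[OF elim(3)] by (rule mult_left_mono)
        then have "ennreal (g \<omega> * (Y t \<omega> $ a - Y r \<omega> $ a)\<^sup>2) \<le> ennreal ((2 * V\<^sup>2 * (t - r)) * g \<omega> + 2 * (g \<omega> * ?n\<^sup>2))"
          by (intro ennreal_leI) (simp add: algebra_simps)
        also have "\<dots> = ennreal (2 * V\<^sup>2 * (t - r)) * ennreal (g \<omega>) + 2 * ennreal (g \<omega> * ?n\<^sup>2)"
          using g(2)[OF elim(3)] t by (subst ennreal_plus) (auto simp: ennreal_mult')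
        finally show ?case .
      qed
    qed
    also have "\<dots> = ennreal (2 * V\<^sup>2 * (t - r)) * ?g + 2 * (\<integral>\<^sup>+\<omega>. ennreal (g \<omega> * (noise a t \<omega> - noise a r \<omega>)\<^sup>2) \<partial>M)"
      by (subst nn_integral_add) (auto simp: nn_integral_cmult)
    also have "\<dots> \<le> ennreal (2 * V\<^sup>2 * (t - r)) * ?g + 2 * (ennreal (4 * c\<^sup>2 * (t - r)) * ?g)"
      by (intro add_left_mono mult_left_mono n) simp
    also have "\<dots> = (ennreal (2 * V\<^sup>2 * (t - r)) + ennreal (8 * c\<^sup>2 * (t - r))) * ?g"
      using ennreal_mult'[of 2 "4 * c\<^sup>2 * (t - r)"] by (simp add: distrib_left distrib_right mult_ac)
    also have "\<dots> = ennreal ((2 * V\<^sup>2 + 8 * c\<^sup>2) * (t - r)) * ?g"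
      using t by (simp add: distrib_right flip: ennreal_plus)
    finally show ?thesis .
  qed
  have "(\<integral>\<^sup>+\<omega>. ennreal (g \<omega> * (norm (Y t \<omega> - Y r \<omega>))\<^sup>2) \<partial>M)
    = (\<integral>\<^sup>+\<omega>. (\<Sum>a\<in>UNIV. ennreal (g \<omega> * (Y t \<omega> $ a - Y r \<omega> $ a)\<^sup>2)) \<partial>M)"
    using g(2) by (intro nn_integral_cong) (simp add: norm_square_vec sum_distrib_left)
  also have "\<dots> = (\<Sum>a\<in>UNIV. \<integral>\<^sup>+\<omega>. ennreal (g \<omega> * (Y t \<omega> $ a - Y r \<omega> $ a)\<^sup>2) \<partial>M)"
    by (rule nn_integral_sum) measurable
  also have "\<dots> \<le> (\<Sum>a\<in>(UNIV::'a set). ennreal ((2 * V\<^sup>2 + 8 * c\<^sup>2) * (t - r)) * ?g)"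
    by (intro sum_mono comp)
  also have "\<dots> = ennreal (CARD('a) * (2 * V\<^sup>2 + 8 * c\<^sup>2) * (t - r)) * ?g"
    using ennreal_mult'[of "CARD('a)" "(2 * V\<^sup>2 + 8 * c\<^sup>2) * (t - r)"]
    by (simp add: mult.assoc ennreal_of_nat_eq_real_of_nat)
  finally show ?thesis .
qed

end

section \<open>Riemann sums, averages and compactness\<close>

lemma integral_grid_split:
  fixes f :: "real \<Rightarrow> 'e::euclidean_space"
  assumes "continuous_on {0..} f" "0 \<le> d"
  shows "integral {0..real N * d} f = (\<Sum>n<N. integral {real n * d..real (Suc n) * d} f)"
proof (induction N)
  case (Suc N)
  have "integral {0..real N * d} f + integral {real N * d..real (Suc N) * d} f
      = integral {0..real (Suc N) * d} f"
    using assms by (intro Henstock_Kurzweil_Integration.integral_combine integrable_continuous_real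
        continuous_on_subset[OF assms(1)]) (auto intro: mult_right_mono)
  with Suc show ?case by simp
qed simp

text \<open>Only \<open>x\<close> is frozen at the left end of a cell, while \<open>f\<close> is
  integrated exactly, so the error is controlled by a bound for \<open>f\<close> and the modulus of
  continuity of \<open>x\<close>. This is the shape in which the drift part of the score increments
  appears.\<close>

lemma grid_integral_inner_limit:
  fixes f x :: "real \<Rightarrow> 'e::euclidean_space"
  assumes f: "continuous_on {0..} f" and x: "continuous_on {0..} x"
  shows "(\<lambda>k. \<Sum>n<Suc k * T. integral {real n / real (Suc k)..real (Suc n) / real (Suc k)} f
             \<bullet> x (real n / real (Suc k))) \<longlonglongrightarrow> integral {0..real T} (\<lambda>r. f r \<bullet> x r)"
proof (rule LIMSEQ_I)
  fix e :: real assume e: "0 < e"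
  have sub: "{0..real T} \<subseteq> {0..}" by auto
  have "bounded (f ` {0..real T})"
    by (intro compact_imp_bounded compact_continuous_image continuous_on_subset[OF f sub]) auto
  then obtain C where C: "0 < C" "\<And>r. r \<in> {0..real T} \<Longrightarrow> norm (f r) \<le> C"
    unfolding bounded_pos by auto
  \<comment> \<open>\<open>T + 1\<close> keeps the denominator positive at \<open>T = 0\<close>; the
    total error \<open>C * \<epsilon> * T\<close> stays below \<open>e\<close>.\<close>
  define \<epsilon> where "\<epsilon> = e / (2 * C * (real T + 1))"
  have \<epsilon>: "0 < \<epsilon>" using e C by (simp add: \<epsilon>_def)
  have "uniformly_continuous_on {0..real T} x"
    by (intro compact_uniformly_continuous continuous_on_subset[OF x sub]) auto
  then obtain \<delta> where \<delta>: "0 < \<delta>"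
    "\<And>r r'. r \<in> {0..real T} \<Longrightarrow> r' \<in> {0..real T} \<Longrightarrow> dist r' r < \<delta> \<Longrightarrow> dist (x r') (x r) < \<epsilon>"
    unfolding uniformly_continuous_on_def using \<epsilon> by metis
  obtain k0 where k0: "1 / real (Suc k0) < \<delta>"
    using \<delta>(1) nat_approx_posE by blast
  have "norm ((\<Sum>n<Suc k * T. integral {real n / real (Suc k)..real (Suc n) / real (Suc k)} f
             \<bullet> x (real n / real (Suc k))) - integral {0..real T} (\<lambda>r. f r \<bullet> x r)) < e" if "k0 \<le> k" for k
  proof -
    define d where "d = 1 / real (Suc k)"
    have d: "0 < d" "d < \<delta>" "real (Suc k) * d = 1"
    proof -
      have "d \<le> 1 / real (Suc k0)" using that by (auto simp: d_def intro!: divide_left_mono)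
      with k0 show "d < \<delta>" by simp
    qed (auto simp: d_def)
    have NT: "real (Suc k * T) * d = real T"
    proof -
      have "real (Suc k * T) * d = real T * (real (Suc k) * d)"
        by (simp only: of_nat_mult mult_ac)
      then show ?thesis unfolding d(3) by simp
    qed
    have split: "integral {0..real T} (\<lambda>r. f r \<bullet> x r)
       = (\<Sum>n<Suc k * T. integral {real n * d..real (Suc n) * d} (\<lambda>r. f r \<bullet> x r))"
      using integral_grid_split[of "\<lambda>r. f r \<bullet> x r" d "Suc k * T"] f x d unfolding NT
      by (auto intro: continuous_intros)
    have piece: "norm (integral {real n * d..real (Suc n) * d} f \<bullet> x (real n * d)
        - integral {real n * d..real (Suc n) * d} (\<lambda>r. f r \<bullet> x r)) \<le> C * \<epsilon> * d" if n: "n < Suc k * T" for n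
    proof -
      let ?I = "{real n * d..real (Suc n) * d}"
      have up: "real (Suc n) * d \<le> real (Suc k * T) * d"
        using n d by (intro mult_right_mono iffD2[OF of_nat_le_iff]) auto
      have "0 \<le> real n * d" using d by simp
      with up[unfolded NT] have I: "?I \<subseteq> {0..real T}" and I0: "?I \<subseteq> {0..}"
        by (simp_all add: subset_iff)
      have le: "real n * d \<le> real (Suc n) * d" using d by (simp add: mult_right_mono)
      have fi: "f integrable_on ?I"
        by (intro integrable_continuous_real continuous_on_subset[OF f I0])
      have fxi: "(\<lambda>r. f r \<bullet> x r) integrable_on ?I"
        by (intro integrable_continuous_real continuous_on_subset[OF _ I0] continuous_intros f x)
      have fvi: "(\<lambda>r. f r \<bullet> x (real n * d)) integrable_on ?I"
        by (intro integrable_continuous_real continuous_on_subset[OF _ I0] continuous_intros f x)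
      have "integral ?I f \<bullet> x (real n * d) = integral ?I (\<lambda>r. f r \<bullet> x (real n * d))"
        using integral_linear[OF fi bounded_linear_inner_left[of "x (real n * d)"]] by (simp add: comp_def)
      then have "integral ?I f \<bullet> x (real n * d) - integral ?I (\<lambda>r. f r \<bullet> x r)
          = integral ?I (\<lambda>r. f r \<bullet> (x (real n * d) - x r))"
        using Henstock_Kurzweil_Integration.integral_diff[OF fvi fxi] by (simp add: inner_diff_right)
      moreover have "norm (integral ?I (\<lambda>r. f r \<bullet> (x (real n * d) - x r))) \<le> C * \<epsilon> * (real (Suc n) * d - real n * d)"
      proof (rule integral_bound[OF le])
        show "continuous_on ?I (\<lambda>r. f r \<bullet> (x (real n * d) - x r))"
          by (intro continuous_on_subset[OF _ I0] continuous_intros f x)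
        fix r assume r: "r \<in> ?I"
        have "norm (f r \<bullet> (x (real n * d) - x r)) \<le> norm (f r) * norm (x (real n * d) - x r)"
          using Cauchy_Schwarz_ineq2 by simp
        also have "\<dots> \<le> C * \<epsilon>"
        proof (rule mult_mono)
          show "norm (f r) \<le> C" using C r I by blast
          have "real n * d \<in> ?I" using le by simp
          moreover have "dist (real n * d) r < \<delta>"
          proof -
            have "real (Suc n) * d = real n * d + d" by (simp add: algebra_simps)
            with r d show ?thesis by (simp add: dist_real_def)
          qed
          ultimately show "norm (x (real n * d) - x r) \<le> \<epsilon>"
            using \<delta>(2)[of r "real n * d"] r I by (auto simp: dist_norm)
        qed (use C in auto)
        finally show "norm (f r \<bullet> (x (real n * d) - x r)) \<le> C * \<epsilon>" .
      qed
      moreover have "real (Suc n) * d - real n * d = d" by (simp add: algebra_simps)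
      ultimately show ?thesis by simp
    qed
    have "norm ((\<Sum>n<Suc k * T. integral {real n * d..real (Suc n) * d} f \<bullet> x (real n * d))
        - integral {0..real T} (\<lambda>r. f r \<bullet> x r)) \<le> (\<Sum>n<Suc k * T. C * \<epsilon> * d)"
      unfolding split sum_subtractf[symmetric] using piece by (intro sum_norm_le) auto
    also have "\<dots> = C * \<epsilon> * (real (Suc k * T) * d)" by (simp only: sum_constant card_lessThan mult_ac)
    also have "\<dots> = C * \<epsilon> * T" unfolding NT ..
    also have "\<dots> < e"
    proof -
      have "2 * C * (real T + 1) * \<epsilon> = e" using C by (simp add: \<epsilon>_def)
      moreover have "0 < C * \<epsilon>" "0 \<le> C * \<epsilon> * T" using C \<epsilon> by auto
      ultimately show ?thesis by (simp add: algebra_simps)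
    qed
    finally show ?thesis by (simp add: d_def)
  qed
  then show "\<exists>k0. \<forall>k\<ge>k0. norm ((\<Sum>n<Suc k * T. integral {real n / real (Suc k)..real (Suc n) / real (Suc k)} f
             \<bullet> x (real n / real (Suc k))) - integral {0..real T} (\<lambda>r. f r \<bullet> x r)) < e" by blast
qed

lemma cesaro_mean_zero:
  fixes a :: "nat \<Rightarrow> real"
  assumes a: "a \<longlonglongrightarrow> 0"
  shows "(\<lambda>n. (\<Sum>j<n. a j) / real n) \<longlonglongrightarrow> 0"
proof (rule LIMSEQ_I)
  fix e :: real assume e: "0 < e"
  from LIMSEQ_D[OF a, of "e / 2"] e obtain N where N: "\<And>j. N \<le> j \<Longrightarrow> \<bar>a j\<bar> < e / 2" by auto
  define S where "S = (\<Sum>j<N. \<bar>a j\<bar>)"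
  obtain K where K: "2 * S / e < real K" using reals_Archimedean2 by blast
  have "norm ((\<Sum>j<n. a j) / real n - 0) < e" if n: "max (Suc N) K \<le> n" for n
  proof -
    have "{..<n} = {..<N} \<union> {N..<n}" using n by auto
    then have "(\<Sum>j<n. \<bar>a j\<bar>) = S + (\<Sum>j\<in>{N..<n}. \<bar>a j\<bar>)"
      unfolding S_def by (simp add: sum.union_disjoint ivl_disj_int)
    also have "(\<Sum>j\<in>{N..<n}. \<bar>a j\<bar>) \<le> (\<Sum>j\<in>{N..<n}. e / 2)"
      using N by (intro sum_mono) (simp add: less_imp_le)
    also have "\<dots> \<le> real n * (e / 2)"
      using e by (simp add: mult_right_mono)
    finally have "\<bar>\<Sum>j<n. a j\<bar> \<le> S + real n * (e / 2)"
      using sum_abs[of a "{..<n}"] by linarith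
    moreover have "S < real n * (e / 2)"
    proof -
      have "2 * S / e < real n" using K n by linarith
      then show ?thesis using e by (simp add: field_simps)
    qed
    ultimately have "\<bar>\<Sum>j<n. a j\<bar> < e * real n" by (simp add: field_simps)
    then show ?thesis using n by (simp add: field_simps)
  qed
  then show "\<exists>n0. \<forall>n\<ge>n0. norm ((\<Sum>j<n. a j) / real n - 0) < e" by blast
qed

text \<open>The last square before \<open>t\<close> is at distance \<open>O(sqrt t)\<close>, and the
  upper bound on \<open>f\<close> limits the growth of the integral over that gap to
  \<open>O(sqrt t)\<close>. All bounds are one-sided, as regret is only ever bounded from
  above.\<close>

lemma integral_growth_from_squares:
  fixes f :: "real \<Rightarrow> real"
  assumes f: "continuous_on {0..} f" "\<And>t. 0 \<le> t \<Longrightarrow> f t \<le> C"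
    and sq: "\<And>e. 0 < e \<Longrightarrow> \<forall>\<^sub>F m in sequentially. integral {0..real (m\<^sup>2)} f \<le> e * real (m\<^sup>2)"
    and e: "0 < e"
  shows "\<forall>\<^sub>F t in at_top. integral {0..t} f \<le> e * t"
proof -
  define K where "K = max C 0"
  from sq[of "e / 2"] e obtain m0 where m0: "\<And>m. m0 \<le> m \<Longrightarrow> integral {0..real (m\<^sup>2)} f \<le> e / 2 * real (m\<^sup>2)"
    by (auto simp: eventually_sequentially)
  \<comment> \<open>The three thresholds ensure, in this order, \<open>m0 \<le> m\<close>,
    \<open>2 * m + 1 \<le> 3 * sqrt t\<close> and
    \<open>3 * K * sqrt t \<le> e / 2 * t\<close>.\<close>
  have "integral {0..t} f \<le> e * t" if t: "max ((real m0)\<^sup>2) (max 1 ((6 * K / e)\<^sup>2)) \<le> t" for t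
  proof -
    define m where "m = nat \<lfloor>sqrt t\<rfloor>"
    have t1: "1 \<le> t" "(real m0)\<^sup>2 \<le> t" "(6 * K / e)\<^sup>2 \<le> t" using t by auto
    then have s: "1 \<le> sqrt t" "real m0 \<le> sqrt t" "6 * K / e \<le> sqrt t"
      by (auto intro: real_le_rsqrt)
    have m: "real m \<le> sqrt t" "sqrt t < real m + 1" using s unfolding m_def by linarith+
    have "m0 \<le> m" using m s by linarith
    have mt: "real (m\<^sup>2) \<le> t"
    proof -
      have "(real m)\<^sup>2 \<le> (sqrt t)\<^sup>2" using m by (intro power_mono) auto
      then show ?thesis using t1 by simp
    qed
    have diff: "t - real (m\<^sup>2) \<le> 3 * sqrt t"
    proof -
      have "(sqrt t)\<^sup>2 \<le> (real m + 1)\<^sup>2" using m s by (intro power_mono) auto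
      then have "t \<le> (real m)\<^sup>2 + 2 * real m + 1" using t1 by (simp add: power2_sum)
      moreover have "real (m\<^sup>2) = (real m)\<^sup>2" by simp
      ultimately show ?thesis using m s by linarith
    qed
    have int: "f integrable_on {r..t'}" if "0 \<le> r" for r t'
      using that by (intro integrable_continuous_real continuous_on_subset[OF f(1)]) auto
    have "integral {0..t} f = integral {0..real (m\<^sup>2)} f + integral {real (m\<^sup>2)..t} f"
      using mt by (intro Henstock_Kurzweil_Integration.integral_combine[symmetric] int) auto
    also have "integral {real (m\<^sup>2)..t} f \<le> integral {real (m\<^sup>2)..t} (\<lambda>_. K)"
    proof (intro Henstock_Kurzweil_Integration.integral_le int)
      fix r assume "r \<in> {real (m\<^sup>2)..t}"
      then have "0 \<le> r" by (auto intro: order_trans[of _ "real (m\<^sup>2)"])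
      then show "f r \<le> K" using f(2) by (simp add: K_def le_max_iff_disj)
    qed auto
    also have "\<dots> = K * (t - real (m\<^sup>2))" using mt by simp
    also have "\<dots> \<le> K * (3 * sqrt t)" using diff by (intro mult_left_mono) (auto simp: K_def)
    also have "\<dots> \<le> e / 2 * t"
    proof -
      have "6 * K \<le> e * sqrt t" using s(3) e by (simp add: field_simps)
      then have "6 * K * sqrt t \<le> e * sqrt t * sqrt t" using s by (intro mult_right_mono) auto
      then show ?thesis using t1 by (simp add: mult.assoc)
    qed
    also have "integral {0..real (m\<^sup>2)} f \<le> e / 2 * t"
      using m0[OF \<open>m0 \<le> m\<close>] mult_left_mono[OF mt, of "e / 2"] e by linarith
    finally show ?thesis by simp
  qed
  then show ?thesis unfolding eventually_at_top_linorder by blast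
qed

text \<open>On the compact part of \<open>K\<close> at distance at least \<open>e\<close> from
  \<open>S\<close>, the sum of the positive parts of the gaps attains a positive minimum; gaps that
  become small force the path out of that part.\<close>

lemma infdist_tendsto_0_from_gaps:
  fixes x :: "real \<Rightarrow> 'e::metric_space" and \<phi> :: "'i::finite \<Rightarrow> 'e \<Rightarrow> real"
  assumes K: "compact K" and x: "\<forall>\<^sub>F t in at_top. x t \<in> K"
    and \<phi>: "\<And>i. continuous_on K (\<phi> i)"
    and S: "S \<noteq> {}" "\<And>z. z \<in> K \<Longrightarrow> (\<And>i. \<phi> i z \<le> 0) \<Longrightarrow> z \<in> S"
    and gap: "\<And>i e. 0 < e \<Longrightarrow> \<forall>\<^sub>F t in at_top. \<phi> i (x t) \<le> e"
  shows "((\<lambda>t. infdist (x t) S) \<longlongrightarrow> 0) at_top"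
proof (rule tendstoI)
  fix e :: real assume e: "0 < e"
  define G where "G z = (\<Sum>i\<in>UNIV. max 0 (\<phi> i z))" for z
  define K' where "K' = K \<inter> {z. e \<le> infdist z S}"
  have K': "compact K'" unfolding K'_def
    by (intro compact_Int_closed K closed_Collect_le continuous_intros)
  have Gc: "continuous_on K' G"
    unfolding G_def K'_def by (intro continuous_intros continuous_on_subset[OF \<phi>]) auto
  have Gpos: "0 < G z" if "z \<in> K'" for z
  proof -
    have "z \<notin> S" using that e by (auto simp: K'_def)
    then have "\<exists>i. \<not> \<phi> i z \<le> 0" using S(2)[of z] that unfolding K'_def by blast
    then obtain i where "0 < \<phi> i z" by (auto simp: not_le)
    then have "0 < max 0 (\<phi> i z)" by simp
    also have "\<dots> \<le> G z" unfolding G_def by (rule member_le_sum) auto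
    finally show ?thesis .
  qed
  obtain \<mu> where \<mu>: "0 < \<mu>" "\<And>z. z \<in> K' \<Longrightarrow> \<mu> \<le> G z"
  proof (cases "K' = {}")
    case False
    then obtain z where "z \<in> K'" "\<forall>y\<in>K'. G z \<le> G y"
      using continuous_attains_inf[OF K' _ Gc] by blast
    then show ?thesis using Gpos that by blast
  qed (use that[of 1] in auto)
  \<comment> \<open>If every gap is at most \<open>\<nu>\<close>, the sum of the positive parts is
    at most \<open>\<mu> / 2\<close>.\<close>
  define \<nu> where "\<nu> = \<mu> / (2 * real CARD('i))"
  have \<nu>: "0 < \<nu>" using \<mu> by (simp add: \<nu>_def)
  have "\<forall>\<^sub>F t in at_top. \<forall>i\<in>UNIV. \<phi> i (x t) \<le> \<nu>"
    using gap[OF \<nu>] by (intro eventually_ball_finite) auto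
  with x show "\<forall>\<^sub>F t in at_top. dist (infdist (x t) S) 0 < e"
  proof eventually_elim
    case (elim t)
    have "G (x t) \<le> (\<Sum>i\<in>(UNIV::'i set). \<nu>)"
      unfolding G_def using elim \<nu> by (intro sum_mono) auto
    also have "\<dots> < \<mu>" using \<mu> by (simp add: \<nu>_def)
    finally have "x t \<notin> K'" using \<mu>(2) by force
    with elim show ?case by (auto simp: K'_def infdist_nonneg)
  qed
qed

section \<open>Absence of regret\<close>

text \<open>Fatou bounds the mean of the lower limit over \<open>k\<close> by
  \<open>C * m^2\<close>. Divided by \<open>m^4\<close> this is summable in \<open>m\<close>, so the
  quotients tend to zero almost surely. Fatou controls only the lower limit, hence infinitely many
  \<open>k\<close> instead of all large ones.\<close>

lemma (in prob_space) AE_frequently_small: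
  fixes \<Psi> :: "nat \<Rightarrow> nat \<Rightarrow> 'a \<Rightarrow> ennreal"
  assumes [measurable]: "\<And>k m. \<Psi> k m \<in> borel_measurable M"
    and \<Psi>: "\<And>k m. (\<integral>\<^sup>+\<omega>. \<Psi> k m \<omega> \<partial>M) \<le> ennreal (C * (real m)\<^sup>2)" and C: "0 \<le> C"
  shows "AE \<omega> in M. \<forall>e>0. \<forall>\<^sub>F m in sequentially. \<exists>\<^sub>F k in sequentially. \<Psi> k m \<omega> < ennreal ((e * (real m)\<^sup>2)\<^sup>2)"
proof -
  define W where "W m \<omega> = liminf (\<lambda>k. \<Psi> k m \<omega>)" for m \<omega>
  \<comment> \<open>The factor \<open>1 / m^4\<close> turns the threshold \<open>(e * m^2)^2\<close>
    into the constant \<open>e^2\<close>; at \<open>m = 0\<close> division by zero makes it 0, so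
    that term is harmless.\<close>
  define U where "U m \<omega> = ennreal (1 / ((real m)\<^sup>2)\<^sup>2) * W m \<omega>" for m \<omega>
  have [measurable]: "W m \<in> borel_measurable M" for m unfolding W_def by measurable
  have W: "(\<integral>\<^sup>+\<omega>. W m \<omega> \<partial>M) \<le> ennreal (C * (real m)\<^sup>2)" for m
  proof -
    have "(\<integral>\<^sup>+\<omega>. W m \<omega> \<partial>M) \<le> liminf (\<lambda>k. \<integral>\<^sup>+\<omega>. \<Psi> k m \<omega> \<partial>M)"
      unfolding W_def by (rule nn_integral_liminf) measurable
    also have "\<dots> \<le> ennreal (C * (real m)\<^sup>2)" using \<Psi> by (intro Liminf_le) auto
    finally show ?thesis .
  qed
  have "(\<integral>\<^sup>+\<omega>. (\<Sum>m. U m \<omega>) \<partial>M) = (\<Sum>m. \<integral>\<^sup>+\<omega>. U m \<omega> \<partial>M)"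
    unfolding U_def by (rule nn_integral_suminf) measurable
  also have "\<dots> \<le> (\<Sum>m. ennreal (C * inverse ((real m)\<^sup>2)))"
  proof (intro suminf_le summableI)
    fix m
    have "(\<integral>\<^sup>+\<omega>. U m \<omega> \<partial>M) = ennreal (1 / ((real m)\<^sup>2)\<^sup>2) * (\<integral>\<^sup>+\<omega>. W m \<omega> \<partial>M)"
      unfolding U_def by (rule nn_integral_cmult) measurable
    also have "\<dots> \<le> ennreal (1 / ((real m)\<^sup>2)\<^sup>2) * ennreal (C * (real m)\<^sup>2)"
      by (intro mult_left_mono W) simp
    also have "\<dots> = ennreal (C * inverse ((real m)\<^sup>2))"
      by (simp add: ennreal_mult'[symmetric] power2_eq_square divide_simps)
    finally show "(\<integral>\<^sup>+\<omega>. U m \<omega> \<partial>M) \<le> ennreal (C * inverse ((real m)\<^sup>2))" .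
  qed
  also have "\<dots> < \<top>"
    using C inverse_power_summable[of 2, where 'a=real]
    by (simp add: less_top[symmetric] ennreal_suminf_neq_top)
  finally have "(\<integral>\<^sup>+\<omega>. (\<Sum>m. U m \<omega>) \<partial>M) \<noteq> \<infinity>" by simp
  moreover have "(\<lambda>\<omega>. \<Sum>m. U m \<omega>) \<in> borel_measurable M" unfolding U_def by measurable
  ultimately have "AE \<omega> in M. (\<Sum>m. U m \<omega>) \<noteq> \<infinity>" by (rule nn_integral_PInf_AE[rotated])
  then show ?thesis
  proof eventually_elim
    case (elim \<omega>)
    define u where "u m = enn2real (U m \<omega>)" for m
    have "U m \<omega> < \<top>" for m
      using elim by (intro ennreal_suminf_lessD[of "\<lambda>m. U m \<omega>"]) (simp add: less_top)
    then have u': "U m \<omega> = ennreal (u m)" for m by (simp add: u_def)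
    have u0: "0 \<le> u m" for m by (simp add: u_def)
    have "summable (\<lambda>m. u m)"
      using elim unfolding u' by (intro summable_suminf_not_top u0) auto
    then have lim: "(\<lambda>m. u m) \<longlonglongrightarrow> 0" by (rule summable_LIMSEQ_zero)
    show ?case
    proof (intro allI impI)
      fix e :: real assume e: "0 < e"
      have "\<forall>\<^sub>F m in sequentially. u m < e\<^sup>2"
        using order_tendstoD(2)[OF lim, of "e\<^sup>2"] e by simp
      with eventually_gt_at_top[of 0]
      show "\<forall>\<^sub>F m in sequentially. \<exists>\<^sub>F k in sequentially. \<Psi> k m \<omega> < ennreal ((e * (real m)\<^sup>2)\<^sup>2)"
      proof eventually_elim
        case (elim m)
        have m: "0 < real m" using elim by simp
        show ?case
        proof (rule ccontr)
          assume "\<not> (\<exists>\<^sub>F k in sequentially. \<Psi> k m \<omega> < ennreal ((e * (real m)\<^sup>2)\<^sup>2))"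
          then have "ennreal ((e * (real m)\<^sup>2)\<^sup>2) \<le> W m \<omega>"
            unfolding W_def by (intro Liminf_bounded) (simp add: frequently_def not_less)
          then have "ennreal (1 / ((real m)\<^sup>2)\<^sup>2) * ennreal ((e * (real m)\<^sup>2)\<^sup>2) \<le> U m \<omega>"
            unfolding U_def by (intro mult_left_mono) auto
          also have "ennreal (1 / ((real m)\<^sup>2)\<^sup>2) * ennreal ((e * (real m)\<^sup>2)\<^sup>2) = ennreal (e\<^sup>2)"
            using m by (simp add: ennreal_mult'[symmetric] power_mult_distrib)
          finally have "e\<^sup>2 \<le> u m" unfolding u' by (subst (asm) ennreal_le_iff) (auto simp: u0)
          with elim show False by simp
        qed
      qed
    qed
  qed
qed

text \<open>On each unit interval a nonincreasing \<open>f\<close> is at most its value at the left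
  integer, and the \<open>k + 1\<close> cells there have total length 1. The resulting bound is
  uniform in \<open>k\<close>.\<close>

lemma sum_subgrid_le:
  fixes f :: "real \<Rightarrow> real"
  assumes "\<And>s t. 0 \<le> s \<Longrightarrow> s \<le> t \<Longrightarrow> f t \<le> f s"
  shows "(\<Sum>n<Suc k * T. f (real n / real (Suc k)) / real (Suc k)) \<le> (\<Sum>j<T. f (real j))"
proof (induction T)
  case (Suc T)
  let ?g = "\<lambda>n. f (real n / real (Suc k)) / real (Suc k)"
  have "(\<Sum>n<Suc k * Suc T. ?g n) = (\<Sum>n<Suc k * T. ?g n) + (\<Sum>n\<in>{Suc k * T..<Suc k * T + Suc k}. ?g n)"
  proof -
    have "{..<Suc k * Suc T} = {..<Suc k * T} \<union> {Suc k * T..<Suc k * T + Suc k}" by auto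
    then show ?thesis by (simp add: sum.union_disjoint ivl_disj_int del: mult_Suc mult_Suc_right)
  qed
  also have "(\<Sum>n\<in>{Suc k * T..<Suc k * T + Suc k}. ?g n)
      \<le> (\<Sum>n\<in>{Suc k * T..<Suc k * T + Suc k}. f (real T) / real (Suc k))"
  proof (intro sum_mono divide_right_mono assms)
    fix n assume "n \<in> {Suc k * T..<Suc k * T + Suc k}"
    then have "real (Suc k * T) \<le> real n" unfolding of_nat_le_iff by simp
    then show "real T \<le> real n / real (Suc k)" by (simp add: field_simps)
  qed auto
  also have "\<dots> = f (real T)" by simp
  finally show ?case using Suc by simp
qed simp

lemma square_le_of_ennreal_sum:
  assumes "finite I" "i \<in> I" "(\<Sum>i\<in>I. ennreal ((f i)\<^sup>2)) + r < ennreal (d\<^sup>2)" "0 \<le> d"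
  shows "\<bar>f i\<bar> \<le> d"
proof -
  have "ennreal ((f i)\<^sup>2) \<le> (\<Sum>i\<in>I. ennreal ((f i)\<^sup>2)) + r"
    using assms(1,2) by (intro order_trans[OF member_le_sum[of i I "\<lambda>i. ennreal ((f i)\<^sup>2)"]]) auto
  then have "ennreal ((f i)\<^sup>2) \<le> ennreal (d\<^sup>2)"
    using assms(3) by (intro less_imp_le) (rule le_less_trans)
  then have "(f i)\<^sup>2 \<le> d\<^sup>2" by (subst (asm) ennreal_le_iff) auto
  then show ?thesis using assms(4) by (simp add: abs_le_square_iff[symmetric])
qed

section \<open>The regret of one learner\<close>

context perturbed_learner
begin

lemma
  shows learning_pos: "0 \<le> t \<Longrightarrow> 0 < \<eta> t"
    and learning_antimono: "0 \<le> r \<Longrightarrow> r \<le> t \<Longrightarrow> \<eta> t \<le> \<eta> r"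
    and learning_continuous: "continuous_on {0..} \<eta>"
proof -
  show "0 \<le> t \<Longrightarrow> 0 < \<eta> t" using learning by (simp add: learning_parameter_def)
  show "0 \<le> r \<Longrightarrow> r \<le> t \<Longrightarrow> \<eta> t \<le> \<eta> r"
    using learning by (auto simp: learning_parameter_def monotone_on_def)
  show "continuous_on {0..} \<eta>" by (rule learning_parameter_continuous[OF learning])
qed

lemma play_continuous: "AE \<omega> in M. continuous_on {0..} (\<lambda>t. X t \<omega>)"
proof -
  have "AE \<omega> in M. \<forall>a. continuous_on {0..} (\<lambda>t. Y t \<omega> $ a)"
    using ito by (subst AE_all_countable) (auto simp: ito_process_def continuous_paths_def)
  then show ?thesis using AE_space
  proof eventually_elim
    case (elim \<omega>)
    have "continuous_on {0..} (\<lambda>t. choice_map h (\<eta> t *\<^sub>R Y t \<omega>))"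
      using elim by (intro choice_path_continuous penalty learning_continuous) auto
    then show ?case by (rule continuous_on_eq) (simp add: X_eq elim)
  qed
qed

text \<open>Three random errors occur: the noise integrated against the play (\<open>N\<close>), the
  noise of the fixed strategy (\<open>Z\<close>), and the overshoot of the remainders over their
  compensators (\<open>P\<close>). Their squares are gathered in one sum, so that
  \<open>AE_frequently_small\<close> yields an index \<open>k\<close> good for all of them
  simultaneously.\<close>

lemma no_regret_along_squares:
  "AE \<omega> in M. \<forall>a. \<forall>e>0. \<forall>\<^sub>F m in sequentially.
     integral {0..real (m\<^sup>2)} (\<lambda>r. b r \<omega> $ a - b r \<omega> \<bullet> X r \<omega>) \<le> e * real (m\<^sup>2)"
proof -
  obtain L where L: "0 < L" "\<And>y y'. norm (choice_map h y - choice_map h y') \<le> L * norm (y - y')"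
    using choice_map_lipschitz[OF penalty] by blast
  obtain \<beta> where \<beta>: "\<And>x. x \<in> mixed_strategies \<Longrightarrow> 0 \<le> h x + \<beta>"
    using penalty_bounded_below[OF penalty] by blast
  define D where "D = CARD('a) * (2 * V\<^sup>2 + 8 * c\<^sup>2)"
  have D: "0 \<le> D" by (simp add: D_def)
  \<comment> \<open>Chosen so that \<open>v / (k + 1)\<close> dominates the mean of
    \<open>\<rho>^2\<close> plus \<open>\<gamma>^2\<close>; the first summand handles
    \<open>\<rho>\<close>, the second \<open>\<gamma>\<close> with \<open>\<eta>\<close> bounded by
    \<open>\<eta> 0\<close>.\<close>
  define v where "v = 4 * D + (L * \<eta> 0 * D)\<^sup>2"
  have v: "0 \<le> v" using D by (simp add: v_def)
  \<comment> \<open>The mesh is \<open>1 / Suc k\<close> so that \<open>k = 0\<close> is admissible.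
    Every natural number is a grid point, so all grids share the times \<open>m^2\<close>.\<close>
  define \<tau> where "\<tau> k n = real n / real (Suc k)" for k n :: nat
  have \<tau>: "mono (\<tau> k)" "0 \<le> \<tau> k n" "\<tau> k 0 = 0" "\<tau> k n \<le> \<tau> k (Suc n)" "\<tau> k (Suc n) - \<tau> k n = 1 / real (Suc k)"
    "\<tau> k (Suc k * m) = real m" for k n m
    by (auto simp: \<tau>_def monotone_def divide_right_mono diff_divide_distrib[symmetric])
       (simp add: field_simps)
  have \<tau>1: "\<tau> k (Suc n) \<le> \<tau> k n + 1" for k n
  proof -
    have "1 / real (Suc k) \<le> 1" by simp
    with \<tau>(5)[of k n] show ?thesis by linarith
  qed
  define \<rho> where "\<rho> k n \<omega> = min (L * \<eta> (\<tau> k n) * (norm (Y (\<tau> k (Suc n)) \<omega> - Y (\<tau> k n) \<omega>))\<^sup>2)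
      (2 * norm (Y (\<tau> k (Suc n)) \<omega> - Y (\<tau> k n) \<omega>))" for k n \<omega>
  \<comment> \<open>A deterministic compensator: the quadratic branch of \<open>\<rho>\<close>
    bounds its weighted means by \<open>\<gamma>\<close> times the mean of the weight.\<close>
  define \<gamma> where "\<gamma> k n = L * \<eta> (\<tau> k n) * (D * (1 / real (Suc k)))" for k n
  have L\<eta>: "0 \<le> L * \<eta> (\<tau> k n)" for k n using L learning_pos[OF \<tau>(2)] by (simp add: less_imp_le)
  have \<gamma>0: "0 \<le> \<gamma> k n" for k n using L\<eta> D by (simp add: \<gamma>_def)
  have \<rho>0: "0 \<le> \<rho> k n \<omega>" for k n \<omega> using L\<eta> by (simp add: \<rho>_def)
  have YF: "(\<lambda>\<omega>. norm (Y (\<tau> k (Suc n)) \<omega> - Y (\<tau> k n) \<omega>)) \<in> borel_measurable (F (\<tau> k (Suc n)))" for k n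
    using score_adapted[OF \<tau>(2)[of k "Suc n"]]
      measurable_filtration_mono[OF score_adapted[OF \<tau>(2)] \<tau>(2) \<tau>(4)[of k n]] by measurable
  have YM[measurable]: "(\<lambda>\<omega>. norm (Y (\<tau> k (Suc n)) \<omega> - Y (\<tau> k n) \<omega>)) \<in> borel_measurable M" for k n
    by (rule measurable_filtration[OF YF \<tau>(2)])
  have inc: "(\<integral>\<^sup>+\<omega>. ennreal (g \<omega> * (norm (Y (\<tau> k (Suc n)) \<omega> - Y (\<tau> k n) \<omega>))\<^sup>2) \<partial>M)
      \<le> ennreal (D * (1 / real (Suc k))) * (\<integral>\<^sup>+\<omega>. ennreal (g \<omega>) \<partial>M)"
    if "g \<in> borel_measurable (F (\<tau> k n))" "\<And>\<omega>. \<omega> \<in> space M \<Longrightarrow> 0 \<le> g \<omega>" for g k n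
    using score_increment_second_moment[OF \<tau>(2) \<tau>(4) \<tau>1 that] by (simp only: D_def \<tau>(5))
  have excess: "excess (\<rho> k) (\<gamma> k) n \<in> borel_measurable (F (\<tau> k n)) \<and>
      (\<integral>\<^sup>+\<omega>. ennreal ((excess (\<rho> k) (\<gamma> k) n \<omega>)\<^sup>2) \<partial>M) \<le> ennreal (real n * (v / real (Suc k)))" for k n
  proof (rule excess_second_moment[OF \<tau>(1) \<tau>(2) _ \<rho>0 \<gamma>0])
    fix n
    show "\<rho> k n \<in> borel_measurable (F (\<tau> k (Suc n)))"
      unfolding \<rho>_def using YF by measurable
    show "(\<integral>\<^sup>+\<omega>. ennreal (g \<omega> * \<rho> k n \<omega>) \<partial>M) \<le> ennreal (\<gamma> k n) * (\<integral>\<^sup>+\<omega>. ennreal (g \<omega>) \<partial>M)"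
      if g: "g \<in> borel_measurable (F (\<tau> k n))" "\<And>\<omega>. \<omega> \<in> space M \<Longrightarrow> 0 \<le> g \<omega>" for g
    proof -
      have [measurable]: "g \<in> borel_measurable M" by (rule measurable_filtration[OF g(1) \<tau>(2)])
      have "(\<integral>\<^sup>+\<omega>. ennreal (g \<omega> * \<rho> k n \<omega>) \<partial>M)
        \<le> (\<integral>\<^sup>+\<omega>. ennreal (L * \<eta> (\<tau> k n)) * ennreal (g \<omega> * (norm (Y (\<tau> k (Suc n)) \<omega> - Y (\<tau> k n) \<omega>))\<^sup>2) \<partial>M)"
      proof (intro nn_integral_mono)
        fix \<omega> assume "\<omega> \<in> space M"
        then have "g \<omega> * \<rho> k n \<omega> \<le> g \<omega> * (L * \<eta> (\<tau> k n) * (norm (Y (\<tau> k (Suc n)) \<omega> - Y (\<tau> k n) \<omega>))\<^sup>2)"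
          using g(2) by (intro mult_left_mono) (auto simp: \<rho>_def)
        then show "ennreal (g \<omega> * \<rho> k n \<omega>)
          \<le> ennreal (L * \<eta> (\<tau> k n)) * ennreal (g \<omega> * (norm (Y (\<tau> k (Suc n)) \<omega> - Y (\<tau> k n) \<omega>))\<^sup>2)"
          using L\<eta>[of k n] by (simp add: ennreal_mult'[symmetric] ennreal_leI mult_ac)
      qed
      also have "\<dots> \<le> ennreal (L * \<eta> (\<tau> k n)) * (ennreal (D * (1 / real (Suc k))) * (\<integral>\<^sup>+\<omega>. ennreal (g \<omega>) \<partial>M))"
      proof -
        have "(\<lambda>\<omega>. ennreal (g \<omega> * (norm (Y (\<tau> k (Suc n)) \<omega> - Y (\<tau> k n) \<omega>))\<^sup>2)) \<in> borel_measurable M"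
          by measurable
        from nn_integral_cmult[OF this] show ?thesis
          by (simp only:) (intro mult_left_mono inc g, simp_all)
      qed
      also have "\<dots> = ennreal (\<gamma> k n) * (\<integral>\<^sup>+\<omega>. ennreal (g \<omega>) \<partial>M)"
        unfolding \<gamma>_def ennreal_mult'[OF L\<eta>] by (simp only: mult.assoc)
      finally show ?thesis .
    qed
    have "(\<integral>\<^sup>+\<omega>. ennreal ((\<rho> k n \<omega>)\<^sup>2) \<partial>M)
      \<le> (\<integral>\<^sup>+\<omega>. 4 * ennreal (1 * (norm (Y (\<tau> k (Suc n)) \<omega> - Y (\<tau> k n) \<omega>))\<^sup>2) \<partial>M)"
    proof (intro nn_integral_mono)
      fix \<omega>
      \<comment> \<open>Here the linear branch of the minimum is used; the quadratic one would
        require a fourth moment of the score increment.\<close>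
      have "(\<rho> k n \<omega>)\<^sup>2 \<le> (2 * norm (Y (\<tau> k (Suc n)) \<omega> - Y (\<tau> k n) \<omega>))\<^sup>2"
        by (intro power_mono \<rho>0) (simp add: \<rho>_def)
      then have "ennreal ((\<rho> k n \<omega>)\<^sup>2) \<le> ennreal (4 * (1 * (norm (Y (\<tau> k (Suc n)) \<omega> - Y (\<tau> k n) \<omega>))\<^sup>2))"
        by (intro ennreal_leI) (simp add: power_mult_distrib)
      then show "ennreal ((\<rho> k n \<omega>)\<^sup>2) \<le> 4 * ennreal (1 * (norm (Y (\<tau> k (Suc n)) \<omega> - Y (\<tau> k n) \<omega>))\<^sup>2)"
        by (simp add: ennreal_mult')
    qed
    also have "\<dots> = 4 * (\<integral>\<^sup>+\<omega>. ennreal (1 * (norm (Y (\<tau> k (Suc n)) \<omega> - Y (\<tau> k n) \<omega>))\<^sup>2) \<partial>M)"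
      by (rule nn_integral_cmult) measurable
    also have "\<dots> \<le> 4 * (ennreal (D * (1 / real (Suc k))) * (\<integral>\<^sup>+\<omega>. ennreal 1 \<partial>M))"
      by (intro mult_left_mono inc) auto
    also have "\<dots> = ennreal (4 * D * (1 / real (Suc k)))"
      using ennreal_mult'[of 4 "D * (1 / real (Suc k))"] by (simp add: emeasure_space_1 mult.assoc)
    finally have 1: "(\<integral>\<^sup>+\<omega>. ennreal ((\<rho> k n \<omega>)\<^sup>2) \<partial>M) \<le> ennreal (4 * D * (1 / real (Suc k)))" .
    have "\<gamma> k n \<le> L * \<eta> 0 * D * (1 / real (Suc k))"
      unfolding \<gamma>_def mult.assoc using L D learning_antimono[OF order_refl \<tau>(2)]
      by (intro mult_left_mono mult_right_mono) auto
    then have "(\<gamma> k n)\<^sup>2 \<le> (L * \<eta> 0 * D * (1 / real (Suc k)))\<^sup>2" by (intro power_mono \<gamma>0)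
    also have "\<dots> = (L * \<eta> 0 * D)\<^sup>2 * ((1 / real (Suc k)) * (1 / real (Suc k)))"
      by (simp only: power2_eq_square mult_ac)
    also have "\<dots> \<le> (L * \<eta> 0 * D)\<^sup>2 * ((1 / real (Suc k)) * 1)"
      by (intro mult_left_mono) auto
    finally have 2: "(\<gamma> k n)\<^sup>2 \<le> (L * \<eta> 0 * D)\<^sup>2 * (1 / real (Suc k))" by simp
    have "(\<integral>\<^sup>+\<omega>. ennreal ((\<rho> k n \<omega>)\<^sup>2) \<partial>M) + ennreal ((\<gamma> k n)\<^sup>2)
      \<le> ennreal (4 * D * (1 / real (Suc k))) + ennreal ((L * \<eta> 0 * D)\<^sup>2 * (1 / real (Suc k)))"
      by (intro add_mono 1 ennreal_leI 2)
    also have "\<dots> = ennreal (v / real (Suc k))"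
      using D by (simp add: v_def add_divide_distrib flip: ennreal_plus)
    finally show "(\<integral>\<^sup>+\<omega>. ennreal ((\<rho> k n \<omega>)\<^sup>2) \<partial>M) + ennreal ((\<gamma> k n)\<^sup>2) \<le> ennreal (v / real (Suc k))" .
  qed (use v in auto)
  define P where "P k m = excess (\<rho> k) (\<gamma> k) (Suc k * m\<^sup>2)" for k m
  have PM[measurable]: "P k m \<in> borel_measurable M" for k m
    unfolding P_def using excess measurable_filtration[OF _ \<tau>(2)] by blast
  define N where "N k m a \<omega> = (\<Sum>n<Suc k * m\<^sup>2. X (\<tau> k n) \<omega> $ a * (noise a (\<tau> k (Suc n)) \<omega> - noise a (\<tau> k n) \<omega>))" for k m a \<omega>
  define Z where "Z m a \<omega> = noise a (real (m\<^sup>2)) \<omega> - noise a 0 \<omega>" for m a \<omega>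
  have XF: "(\<lambda>\<omega>. X (\<tau> k n) \<omega> $ a) \<in> borel_measurable (F (\<tau> k n))" for k n a
    using play_adapted[OF \<tau>(2)] by (rule borel_measurable_continuous_on[OF continuous_on_component[OF continuous_on_id], rotated])
  have XM[measurable]: "(\<lambda>\<omega>. X (\<tau> k n) \<omega> $ a) \<in> borel_measurable M" for k n a
    by (rule measurable_filtration[OF XF \<tau>(2)])
  have nM[measurable]: "noise a (\<tau> k n) \<in> borel_measurable M" "noise a (real m) \<in> borel_measurable M"
    "noise a 0 \<in> borel_measurable M" for a k n m
    using \<tau>(2) by (auto intro: noise_measurable)
  have NM[measurable]: "N k m a \<in> borel_measurable M" for k m a unfolding N_def by measurable
  have ZM[measurable]: "Z m a \<in> borel_measurable M" for m a unfolding Z_def by measurable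
  have P2: "(\<integral>\<^sup>+\<omega>. ennreal ((P k m \<omega>)\<^sup>2) \<partial>M) \<le> ennreal (v * (real m)\<^sup>2)" for k m
  proof -
    \<comment> \<open>The number of steps cancels the \<open>1 / (k + 1)\<close> of the bound per
      step, which makes the estimate uniform in \<open>k\<close>.\<close>
    have "real (Suc k * m\<^sup>2) * (v / real (Suc k)) = v * (real m)\<^sup>2" by (simp add: field_simps)
    then show ?thesis using excess[of k "Suc k * m\<^sup>2"] unfolding P_def by simp
  qed
  have N2: "(\<integral>\<^sup>+\<omega>. ennreal ((N k m a \<omega>)\<^sup>2) \<partial>M) \<le> ennreal (4 * c\<^sup>2 * (real m)\<^sup>2)" for k m a
  proof -
    have "(\<integral>\<^sup>+\<omega>. ennreal (1 * (N k m a \<omega>)\<^sup>2) \<partial>M)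
        \<le> ennreal (4 * c\<^sup>2 * (\<tau> k (Suc k * m\<^sup>2) - \<tau> k 0)) * (\<integral>\<^sup>+\<omega>. ennreal 1 \<partial>M)"
      unfolding N_def
      by (rule ito_transform_bound[OF wiener noise_ito_integral s_bound \<tau>(1) \<tau>(2) XF play_component_le[OF \<tau>(2)]])
        auto
    then show ?thesis by (simp add: \<tau>(3,6) emeasure_space_1 del: mult_Suc)
  qed
  have Z2: "(\<integral>\<^sup>+\<omega>. ennreal ((Z m a \<omega>)\<^sup>2) \<partial>M) \<le> ennreal (4 * c\<^sup>2 * (real m)\<^sup>2)" for m a
  proof -
    let ?t = "\<lambda>n::nat. if n = 0 then 0 else real (m\<^sup>2)"
    have "(\<integral>\<^sup>+\<omega>. ennreal (1 * (\<Sum>n<1. 1 * (noise a (?t (Suc n)) \<omega> - noise a (?t n) \<omega>))\<^sup>2) \<partial>M)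
      \<le> ennreal (4 * c\<^sup>2 * (?t 1 - ?t 0)) * (\<integral>\<^sup>+\<omega>. ennreal 1 \<partial>M)"
      using s_bound by (intro ito_transform_bound[OF wiener noise_ito_integral]) (auto simp: mono_def)
    then show ?thesis by (simp add: Z_def emeasure_space_1)
  qed
  define err where "err k m i = (case i of None \<Rightarrow> P k m | Some (Inl a) \<Rightarrow> N k m a | Some (Inr a) \<Rightarrow> Z m a)"
    for k m i
  have err: "err k m None = P k m" "err k m (Some (Inl a)) = N k m a" "err k m (Some (Inr a)) = Z m a" for k m a
    by (simp_all add: err_def)
  have [measurable]: "err k m i \<in> borel_measurable M" for k m i
    by (auto simp: err_def split: option.split sum.split)
  define \<Psi> where "\<Psi> k m \<omega> = (\<Sum>i\<in>UNIV. ennreal ((err k m i \<omega>)\<^sup>2))" for k m \<omega>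
  define C where "C = real CARD(('a + 'a) option) * (v + 4 * c\<^sup>2)"
  have C: "0 \<le> C" using v by (simp add: C_def)
  have [measurable]: "\<Psi> k m \<in> borel_measurable M" for k m
    unfolding \<Psi>_def by measurable
  have \<Psi>2: "(\<integral>\<^sup>+\<omega>. \<Psi> k m \<omega> \<partial>M) \<le> ennreal (C * (real m)\<^sup>2)" for k m
  proof -
    have le: "v * (real m)\<^sup>2 \<le> (v + 4 * c\<^sup>2) * (real m)\<^sup>2" "4 * c\<^sup>2 * (real m)\<^sup>2 \<le> (v + 4 * c\<^sup>2) * (real m)\<^sup>2"
      using v by (auto intro!: mult_right_mono)
    have "(\<integral>\<^sup>+\<omega>. \<Psi> k m \<omega> \<partial>M) = (\<Sum>i\<in>UNIV. \<integral>\<^sup>+\<omega>. ennreal ((err k m i \<omega>)\<^sup>2) \<partial>M)"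
      unfolding \<Psi>_def by (rule nn_integral_sum) measurable
    also have "\<dots> \<le> (\<Sum>i\<in>(UNIV :: ('a + 'a) option set). ennreal ((v + 4 * c\<^sup>2) * (real m)\<^sup>2))"
      using order_trans[OF P2 ennreal_leI[OF le(1)]] order_trans[OF N2 ennreal_leI[OF le(2)]]
        order_trans[OF Z2 ennreal_leI[OF le(2)]]
      by (intro sum_mono) (auto simp: err_def split: option.split sum.split)
    also have "\<dots> = ennreal (C * (real m)\<^sup>2)"
      using v unfolding C_def mult.assoc by (subst sum_ennreal) auto
    finally show ?thesis .
  qed
  \<comment> \<open>All grids together have countably many points, so one null set serves for all
    increment identities.\<close>
  have "AE \<omega> in M. \<forall>k n a. Y (\<tau> k (Suc n)) \<omega> $ a - Y (\<tau> k n) \<omega> $ a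
    = integral {\<tau> k n..\<tau> k (Suc n)} (\<lambda>u. b u \<omega> $ a) + (noise a (\<tau> k (Suc n)) \<omega> - noise a (\<tau> k n) \<omega>)"
    unfolding AE_all_countable by (intro allI score_increment \<tau>(2,4))
  moreover have "AE \<omega> in M. \<forall>m a. Y (real (m\<^sup>2)) \<omega> $ a - Y 0 \<omega> $ a
    = integral {0..real (m\<^sup>2)} (\<lambda>u. b u \<omega> $ a) + Z m a \<omega>"
    unfolding AE_all_countable Z_def by (intro allI score_increment order_refl of_nat_0_le_iff)
  moreover have "AE \<omega> in M. \<forall>e>0. \<forall>\<^sub>F m in sequentially. \<exists>\<^sub>F k in sequentially. \<Psi> k m \<omega> < ennreal ((e * (real m)\<^sup>2)\<^sup>2)"
    by (rule AE_frequently_small[OF _ \<Psi>2 C]) measurable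
  ultimately show ?thesis using b_cont play_continuous AE_space
  proof eventually_elim
    case (elim \<omega>)
    note bc = elim(4) and xc = elim(5) and \<omega> = elim(6)
    define R where "R k m = (\<Sum>n<Suc k * m. integral {\<tau> k n..\<tau> k (Suc n)} (\<lambda>r. b r \<omega>) \<bullet> X (\<tau> k n) \<omega>)" for k m
    have R: "(\<lambda>k. R k m) \<longlonglongrightarrow> integral {0..real m} (\<lambda>r. b r \<omega> \<bullet> X r \<omega>)" for m
      unfolding R_def \<tau>_def by (rule grid_integral_inner_limit[OF bc xc])
    define S where "S = smoothed_max h \<beta> (\<eta> 0) (Y 0 \<omega>)"
    \<comment> \<open>The terms that do not depend on \<open>k\<close>, each of them
      \<open>o(m^2)\<close>: the penalty because \<open>t * \<eta> t\<close> diverges, the initial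
      values because they are constant in \<open>m\<close>, and the summed compensators as a Cesaro
      mean.\<close>
    define Q where "Q a m = (h (axis a 1) + \<beta>) / \<eta> (real (m\<^sup>2)) + S + L * D * (\<Sum>j<m\<^sup>2. \<eta> (real j)) - Y 0 \<omega> $ a" for a m
    have main: "integral {0..real (m\<^sup>2)} (\<lambda>u. b u \<omega> $ a)
       \<le> Q a m + R k (m\<^sup>2) + (\<Sum>a\<in>UNIV. N k m a \<omega>) + P k m \<omega> - Z m a \<omega>" for a k m
    proof -
      have "decseq (\<lambda>n. \<eta> (\<tau> k n))"
        using \<tau>(2,4) by (intro decseq_SucI learning_antimono)
      from discrete_regret_bound[OF penalty learning_pos[OF \<tau>(2)] this L(2) \<beta>, of "\<lambda>n. Y (\<tau> k n) \<omega>" "Suc k * m\<^sup>2" a]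
      have "Y (real (m\<^sup>2)) \<omega> $ a \<le> (h (axis a 1) + \<beta>) / \<eta> (real (m\<^sup>2)) + S
        + (\<Sum>n<Suc k * m\<^sup>2. (Y (\<tau> k (Suc n)) \<omega> - Y (\<tau> k n) \<omega>) \<bullet> X (\<tau> k n) \<omega>) + (\<Sum>n<Suc k * m\<^sup>2. \<rho> k n \<omega>)"
        unfolding \<tau>(3,6) S_def \<rho>_def X_eq[OF \<tau>(2) \<omega>] .
      moreover have "(\<Sum>n<Suc k * m\<^sup>2. \<rho> k n \<omega>) \<le> L * D * (\<Sum>j<m\<^sup>2. \<eta> (real j)) + P k m \<omega>"
      proof -
        have "(\<Sum>n<Suc k * m\<^sup>2. \<gamma> k n) = L * D * (\<Sum>n<Suc k * m\<^sup>2. \<eta> (real n / real (Suc k)) / real (Suc k))"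
          unfolding \<gamma>_def \<tau>_def sum_distrib_left by (intro sum.cong) auto
        also have "\<dots> \<le> L * D * (\<Sum>j<m\<^sup>2. \<eta> (real j))"
          using L D learning_antimono by (intro mult_left_mono sum_subgrid_le) auto
        finally show ?thesis using sum_le_excess[of "\<rho> k" \<omega> "Suc k * m\<^sup>2" "\<gamma> k"] unfolding P_def by linarith
      qed
      moreover have "(\<Sum>n<Suc k * m\<^sup>2. (Y (\<tau> k (Suc n)) \<omega> - Y (\<tau> k n) \<omega>) \<bullet> X (\<tau> k n) \<omega>)
          = R k (m\<^sup>2) + (\<Sum>a\<in>UNIV. N k m a \<omega>)"
      proof -
        have "(Y (\<tau> k (Suc n)) \<omega> - Y (\<tau> k n) \<omega>) \<bullet> X (\<tau> k n) \<omega>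
          = integral {\<tau> k n..\<tau> k (Suc n)} (\<lambda>r. b r \<omega>) \<bullet> X (\<tau> k n) \<omega>
            + (\<Sum>a\<in>UNIV. X (\<tau> k n) \<omega> $ a * (noise a (\<tau> k (Suc n)) \<omega> - noise a (\<tau> k n) \<omega>))" for n
        proof -
          have Yinc: "(Y (\<tau> k (Suc n)) \<omega> - Y (\<tau> k n) \<omega>) $ a = integral {\<tau> k n..\<tau> k (Suc n)} (\<lambda>r. b r \<omega>) $ a
              + (noise a (\<tau> k (Suc n)) \<omega> - noise a (\<tau> k n) \<omega>)" for a
            using elim(1) drift_integrable(1)[OF bc \<tau>(2)] by simp
          show ?thesis
            unfolding inner_vec_def sum.distrib[symmetric] Yinc
            by (simp only: inner_real_def distrib_left mult.commute)
        qed
        then show ?thesis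
          unfolding R_def N_def by (subst sum.swap) (simp add: sum.distrib)
      qed
      moreover have "Y (real (m\<^sup>2)) \<omega> $ a - Y 0 \<omega> $ a
          = integral {0..real (m\<^sup>2)} (\<lambda>u. b u \<omega> $ a) + Z m a \<omega>"
        using elim(2) by blast
      ultimately show ?thesis unfolding Q_def by linarith
    qed
    have Q: "(\<lambda>m. Q a m / real (m\<^sup>2)) \<longlonglongrightarrow> 0" for a
    proof -
      have sq: "filterlim (\<lambda>m::nat. m\<^sup>2) at_top sequentially"
        by (rule filterlim_subseq) (auto intro!: strict_monoI power_strict_mono)
      have sqr: "filterlim (\<lambda>m::nat. real (m\<^sup>2)) at_top sequentially"
        by (rule filterlim_compose[OF filterlim_real_sequentially sq])
      have lp: "filterlim (\<lambda>t. t * \<eta> t) at_top at_top" "(\<eta> \<longlongrightarrow> 0) at_top"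
        using learning by (auto simp: learning_parameter_def)
      have \<eta>0: "(\<lambda>j. \<eta> (real j)) \<longlonglongrightarrow> 0"
        by (rule filterlim_compose[OF lp(2) filterlim_real_sequentially])
      have 1: "(\<lambda>m. (h (axis a 1) + \<beta>) * inverse (real (m\<^sup>2) * \<eta> (real (m\<^sup>2)))) \<longlonglongrightarrow> (h (axis a 1) + \<beta>) * 0"
        by (intro tendsto_mult tendsto_const filterlim_compose[OF tendsto_inverse_0_at_top[OF lp(1)] sqr])
      have 2: "(\<lambda>m. (S - Y 0 \<omega> $ a) * inverse (real (m\<^sup>2))) \<longlonglongrightarrow> (S - Y 0 \<omega> $ a) * 0"
        by (intro tendsto_mult tendsto_const tendsto_inverse_0_at_top sqr)
      have 3: "(\<lambda>m. L * D * ((\<Sum>j<m\<^sup>2. \<eta> (real j)) / real (m\<^sup>2))) \<longlonglongrightarrow> L * D * 0"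
        by (intro tendsto_mult tendsto_const filterlim_compose[OF cesaro_mean_zero[OF \<eta>0] sq])
      have "Q a m / real (m\<^sup>2) = (h (axis a 1) + \<beta>) * inverse (real (m\<^sup>2) * \<eta> (real (m\<^sup>2)))
        + (S - Y 0 \<omega> $ a) * inverse (real (m\<^sup>2)) + L * D * ((\<Sum>j<m\<^sup>2. \<eta> (real j)) / real (m\<^sup>2))" for m
        unfolding Q_def by (simp add: add_divide_distrib diff_divide_distrib divide_inverse algebra_simps)
      then show ?thesis using tendsto_add[OF tendsto_add[OF 1 2] 3] by simp
    qed
    show ?case
    proof (intro allI impI)
      fix a and e :: real assume e: "0 < e"
      \<comment> \<open>One share for each of the \<open>CARD('a)\<close> terms \<open>N\<close>,
        and four more for \<open>P\<close>, \<open>Z\<close>, \<open>Q\<close> and the distance of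
        \<open>R\<close> from its limit.\<close>
      define d where "d = e / real (CARD('a) + 4)"
      have d: "0 < d" using e by (simp add: d_def)
      have "\<forall>\<^sub>F m in sequentially. Q a m / real (m\<^sup>2) < d"
        using order_tendstoD(2)[OF Q d] .
      with elim(3)[rule_format, OF d] eventually_gt_at_top[of 0]
      show "\<forall>\<^sub>F m in sequentially. integral {0..real (m\<^sup>2)} (\<lambda>r. b r \<omega> $ a - b r \<omega> \<bullet> X r \<omega>) \<le> e * real (m\<^sup>2)"
      proof eventually_elim
        case (elim m)
        define x where "x = real (m\<^sup>2)"
        have x: "0 < x" using elim by (simp add: x_def)
        have dx: "0 < d * x" using d x by simp
        \<comment> \<open>For fixed \<open>m\<close> this holds for all large \<open>k\<close>,
          while the error bound holds for infinitely many \<open>k\<close>; so some \<open>k\<close>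
          satisfies both.\<close>
        have "\<forall>\<^sub>F k in sequentially. R k (m\<^sup>2) < integral {0..x} (\<lambda>r. b r \<omega> \<bullet> X r \<omega>) + d * x"
          using order_tendstoD(2)[OF R] dx unfolding x_def by simp
        with elim(1) obtain k where k: "\<Psi> k m \<omega> < ennreal ((d * (real m)\<^sup>2)\<^sup>2)"
          "R k (m\<^sup>2) < integral {0..x} (\<lambda>r. b r \<omega> \<bullet> X r \<omega>) + d * x"
          using frequently_eventually_frequently frequently_ex by blast
        have bd: "\<bar>err k m i \<omega>\<bar> \<le> d * x" for i
          using k(1) d unfolding \<Psi>_def x_def
          by (intro square_le_of_ennreal_sum[where I=UNIV and r=0]) auto
        have "(\<Sum>a\<in>UNIV. N k m a \<omega>) \<le> (\<Sum>a\<in>(UNIV::'a set). d * x)"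
          using bd[of "Some (Inl _)"] by (intro sum_mono) (simp add: err abs_le_iff)
        then have "(\<Sum>a\<in>UNIV. N k m a \<omega>) \<le> real CARD('a) * (d * x)" by simp
        moreover have "P k m \<omega> \<le> d * x" "- Z m a \<omega> \<le> d * x"
          using bd[of None] bd[of "Some (Inr a)"] by (auto simp: err abs_le_iff)
        moreover have "Q a m \<le> d * x" using elim(3) x unfolding x_def by (simp add: field_simps)
        ultimately have "integral {0..x} (\<lambda>u. b u \<omega> $ a) - integral {0..x} (\<lambda>r. b r \<omega> \<bullet> X r \<omega>)
            \<le> real CARD('a) * (d * x) + 4 * (d * x)"
          using main[of m a k] k(2) unfolding x_def by linarith
        also have "\<dots> = (d * real (CARD('a) + 4)) * x" by (simp add: algebra_simps)
        also have "d * real (CARD('a) + 4) = e" by (simp add: d_def)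
        also have "integral {0..x} (\<lambda>u. b u \<omega> $ a) - integral {0..x} (\<lambda>r. b r \<omega> \<bullet> X r \<omega>)
            = integral {0..x} (\<lambda>r. b r \<omega> $ a - b r \<omega> \<bullet> X r \<omega>)"
          by (intro Henstock_Kurzweil_Integration.integral_diff[symmetric] integrable_continuous_real
              continuous_on_subset[of "{0..}" _ "{0..x}"] continuous_intros bc xc) auto
        finally show ?case unfolding x_def .
      qed
    qed
  qed
qed

text \<open>The drift and the play are bounded, so the regret rate is bounded and the estimate at
  squares extends to all times.\<close>

lemma no_regret:
  "AE \<omega> in M. \<forall>a. \<forall>e>0. \<forall>\<^sub>F t in at_top.
     integral {0..t} (\<lambda>r. b r \<omega> $ a - b r \<omega> \<bullet> X r \<omega>) \<le> e * t"
  using no_regret_along_squares b_cont play_continuous AE_space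
proof eventually_elim
  case (elim \<omega>)
  show ?case
  proof (intro allI impI)
    fix a and e :: real assume e: "0 < e"
    have "b r \<omega> $ a - b r \<omega> \<bullet> X r \<omega> \<le> V + real CARD('a) * V" if r: "0 \<le> r" for r
    proof -
      have "\<bar>b r \<omega> \<bullet> X r \<omega>\<bar> \<le> (\<Sum>a\<in>UNIV. \<bar>b r \<omega> $ a * X r \<omega> $ a\<bar>)"
        unfolding inner_vec_def by (simp add: sum_abs)
      also have "\<dots> \<le> (\<Sum>a\<in>(UNIV::'a set). V * 1)"
        unfolding abs_mult using b_bound[OF r elim(4)] play_component_le[OF r elim(4)]
        by (intro sum_mono mult_mono) (auto intro: order_trans[OF abs_ge_zero])
      finally show ?thesis using b_bound[OF r elim(4), of a] by simp
    qed
    with e elim show "\<forall>\<^sub>F t in at_top. integral {0..t} (\<lambda>r. b r \<omega> $ a - b r \<omega> \<bullet> X r \<omega>) \<le> e * t"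
      by (intro integral_growth_from_squares) (auto intro!: continuous_intros)
  qed
qed

end

section \<open>Zero-sum games\<close>

lemma mixed_payoff_axis:
  "mixed_payoff u (axis a 1, y) = (\<Sum>b\<in>UNIV. y $ b * u a b)"
  "mixed_payoff u (x, axis b 1) = (\<Sum>a\<in>UNIV. x $ a * u a b)"
proof -
  have "mixed_payoff u (axis a 1, y) = (\<Sum>i\<in>UNIV. if i = a then \<Sum>b\<in>UNIV. y $ b * u i b else 0)"
    unfolding mixed_payoff_def by (intro sum.cong) (auto simp: axis_def)
  then show "mixed_payoff u (axis a 1, y) = (\<Sum>b\<in>UNIV. y $ b * u a b)" by simp
  have "mixed_payoff u (x, axis b 1) = (\<Sum>a\<in>UNIV. \<Sum>i\<in>UNIV. if i = b then x $ a * u a i else 0)"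
    unfolding mixed_payoff_def by (intro sum.cong) (auto simp: axis_def)
  then show "mixed_payoff u (x, axis b 1) = (\<Sum>a\<in>UNIV. x $ a * u a b)" by simp
qed

lemma payoff_vector_nth:
  "payoff_vector1 u z $ a = (\<Sum>b\<in>UNIV. snd z $ b * u a b)"
  "payoff_vector2 u z $ b = (\<Sum>a\<in>UNIV. fst z $ a * u a b)"
  by (simp_all add: payoff_vector1_def payoff_vector2_def mixed_payoff_axis)

lemma payoff_vector_inner:
  "payoff_vector1 u z \<bullet> x = mixed_payoff u (x, snd z)"
  "payoff_vector2 u z \<bullet> y = mixed_payoff u (fst z, y)"
proof -
  show "payoff_vector1 u z \<bullet> x = mixed_payoff u (x, snd z)"
    unfolding inner_vec_def payoff_vector_nth mixed_payoff_def
    by (simp add: sum_distrib_right sum_distrib_left mult_ac)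
  have "payoff_vector2 u z \<bullet> y = (\<Sum>b\<in>UNIV. \<Sum>a\<in>UNIV. fst z $ a * y $ b * u a b)"
    unfolding inner_vec_def payoff_vector_nth
    by (simp add: sum_distrib_right sum_distrib_left mult_ac)
  then show "payoff_vector2 u z \<bullet> y = mixed_payoff u (fst z, y)"
    unfolding mixed_payoff_def by (subst sum.swap) simp
qed

lemma mixed_payoff_zero_sum:
  assumes "zero_sum u1 u2"
  shows "mixed_payoff u2 z = - mixed_payoff u1 z"
proof -
  have "u2 a b = - u1 a b" for a b
    using assms by (simp add: zero_sum_def eq_neg_iff_add_eq_0 add.commute)
  then show ?thesis by (simp add: mixed_payoff_def sum_negf)
qed

lemma weighted_sum_le_mixed:
  fixes v x :: "real ^ 'a::finite"
  assumes x: "x \<in> mixed_strategies" and "\<And>a. v $ a \<le> k"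
  shows "v \<bullet> x \<le> k"
proof -
  have "v \<bullet> x \<le> (\<Sum>a\<in>UNIV. k * x $ a)"
    unfolding inner_vec_def inner_real_def using assms
    by (intro sum_mono mult_right_mono) (auto simp: mixed_strategies_def)
  also have "\<dots> = k" using x by (simp add: mixed_strategies_def flip: sum_distrib_left)
  finally show ?thesis .
qed

text \<open>By the zero-sum property the left side of \<open>gap\<close> is player 1's payoff from
  \<open>a\<close> minus player 1's payoff when player 2 plays \<open>b\<close>; its maximum over
  both is the duality gap of \<open>z\<close>. Averaging over \<open>b\<close> with weights
  \<open>snd z\<close>, or over \<open>a\<close> with weights \<open>fst z\<close>, leaves one
  player's inequality for pure deviations, and linearity extends it to mixed ones.\<close>

lemma nash_equilibriumI_gap:
  assumes zs: "zero_sum u1 u2" and z: "z \<in> mixed_profiles"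
    and gap: "\<And>a b. payoff_vector1 u1 z $ a + payoff_vector2 u2 z $ b \<le> 0"
  shows "z \<in> nash_equilibria u1 u2"
proof -
  have m: "fst z \<in> mixed_strategies" "snd z \<in> mixed_strategies"
    using z by (auto simp: mixed_profiles_def)
  have z2: "mixed_payoff u2 z = - mixed_payoff u1 z" by (rule mixed_payoff_zero_sum[OF zs])
  have 1: "payoff_vector1 u1 z $ a \<le> mixed_payoff u1 z" for a
  proof -
    have "payoff_vector2 u2 z $ b \<le> - (payoff_vector1 u1 z $ a)" for b using gap[of a b] by simp
    from weighted_sum_le_mixed[OF m(2) this] z2 show ?thesis by (simp add: payoff_vector_inner)
  qed
  have 2: "payoff_vector2 u2 z $ b \<le> mixed_payoff u2 z" for b
  proof -
    have "payoff_vector1 u1 z $ a \<le> - (payoff_vector2 u2 z $ b)" for a using gap[of a b] by simp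
    from weighted_sum_le_mixed[OF m(1) this] z2 show ?thesis by (simp add: payoff_vector_inner)
  qed
  show ?thesis
    using z weighted_sum_le_mixed[OF _ 1] weighted_sum_le_mixed[OF _ 2]
    by (auto simp: nash_equilibria_def payoff_vector_inner)
qed

text \<open>The payoff vectors, unlike the payoff of a profile, are linear in the profile; this lets
  them commute with time averaging.\<close>

lemma bounded_linear_payoff_vector:
  "bounded_linear (\<lambda>z. payoff_vector1 u z $ a)" "bounded_linear (\<lambda>z. payoff_vector2 u z $ b)"
  unfolding payoff_vector_nth
  by (intro bounded_linear_sum bounded_linear_mult_left[THEN bounded_linear_compose]
      bounded_linear_compose[OF bounded_linear_vec_nth] bounded_linear_fst bounded_linear_snd)+

lemma payoff_vector_bound:
  assumes "z \<in> mixed_profiles"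
  shows "\<bar>payoff_vector1 u z $ a\<bar> \<le> (\<Sum>a\<in>UNIV. \<Sum>b\<in>UNIV. \<bar>u a b\<bar>)"
    and "\<bar>payoff_vector2 u z $ b\<bar> \<le> (\<Sum>a\<in>UNIV. \<Sum>b\<in>UNIV. \<bar>u a b\<bar>)"
proof -
  have m: "fst z \<in> mixed_strategies" "snd z \<in> mixed_strategies"
    using assms by (auto simp: mixed_profiles_def)
  have x: "\<bar>fst z $ a\<bar> \<le> 1" for a using m(1) mixed_strategies_le_1[OF m(1)] by (auto simp: mixed_strategies_def)
  have y: "\<bar>snd z $ b\<bar> \<le> 1" for b using m(2) mixed_strategies_le_1[OF m(2)] by (auto simp: mixed_strategies_def)
  have le: "\<bar>u a b\<bar> \<le> (\<Sum>b\<in>UNIV. \<bar>u a b\<bar>)" for a b by (rule member_le_sum) auto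
  have "\<bar>payoff_vector1 u z $ a\<bar> \<le> (\<Sum>b\<in>UNIV. \<bar>snd z $ b * u a b\<bar>)"
    unfolding payoff_vector_nth by (rule sum_abs)
  also have "\<dots> \<le> (\<Sum>b\<in>UNIV. \<bar>u a b\<bar>)"
    unfolding abs_mult using y by (intro sum_mono mult_left_le_one_le) auto
  also have "\<dots> \<le> (\<Sum>a\<in>UNIV. \<Sum>b\<in>UNIV. \<bar>u a b\<bar>)"
    by (rule member_le_sum) (auto intro: sum_nonneg)
  finally show "\<bar>payoff_vector1 u z $ a\<bar> \<le> (\<Sum>a\<in>UNIV. \<Sum>b\<in>UNIV. \<bar>u a b\<bar>)" .
  have "\<bar>payoff_vector2 u z $ b\<bar> \<le> (\<Sum>a\<in>UNIV. \<bar>fst z $ a * u a b\<bar>)"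
    unfolding payoff_vector_nth by (rule sum_abs)
  also have "\<dots> \<le> (\<Sum>a\<in>UNIV. \<bar>u a b\<bar>)"
    unfolding abs_mult using x by (intro sum_mono mult_left_le_one_le) auto
  also have "\<dots> \<le> (\<Sum>a\<in>UNIV. \<Sum>b\<in>UNIV. \<bar>u a b\<bar>)" by (intro sum_mono le)
  finally show "\<bar>payoff_vector2 u z $ b\<bar> \<le> (\<Sum>a\<in>UNIV. \<Sum>b\<in>UNIV. \<bar>u a b\<bar>)" .
qed

section \<open>Time averages of mixed profiles\<close>

lemma compact_mixed_profiles: "compact mixed_profiles"
  unfolding mixed_profiles_def by (intro compact_Times compact_mixed_strategies)

lemma bounded_linear_time_average:
  fixes X :: "real \<Rightarrow> 'w \<Rightarrow> 'e::euclidean_space" and f :: "'e \<Rightarrow> real"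
  assumes "bounded_linear f" "(\<lambda>s. X s \<omega>) integrable_on {0..t}"
  shows "f (time_average X t \<omega>) = integral {0..t} (\<lambda>s. f (X s \<omega>)) / t"
  using integral_linear[OF assms(2,1)] linear_scale[OF bounded_linear.linear[OF assms(1)]]
  by (simp add: time_average_def comp_def)

text \<open>The simplex is cut out by linear equations and inequalities, and bounded linear
  functionals commute with time averaging, so the constraints pass to the average one by
  one.\<close>

lemma time_average_mixed:
  assumes X: "\<And>s. 0 \<le> s \<Longrightarrow> X s \<omega> \<in> mixed_profiles" "(\<lambda>s. X s \<omega>) integrable_on {0..t}" and t: "0 < t"
  shows "time_average X t \<omega> \<in> mixed_profiles"
proof -
  let ?z = "time_average X t \<omega>"
  have lin: "bounded_linear (\<lambda>z. fst z $ a)" "bounded_linear (\<lambda>z. snd z $ b)" for a b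
    by (intro bounded_linear_compose[OF bounded_linear_vec_nth] bounded_linear_fst bounded_linear_snd)+
  have lins: "bounded_linear (\<lambda>z. \<Sum>a\<in>UNIV. fst z $ a)" "bounded_linear (\<lambda>z. \<Sum>b\<in>UNIV. snd z $ b)"
    by (intro bounded_linear_sum lin)+
  have nn: "0 \<le> f ?z" if "bounded_linear f" "\<And>z. z \<in> mixed_profiles \<Longrightarrow> 0 \<le> f z" for f :: "_ \<Rightarrow> real"
  proof -
    have "0 \<le> integral {0..t} (\<lambda>s. f (X s \<omega>))"
      using that X integrable_linear[OF X(2) that(1)]
      by (intro Henstock_Kurzweil_Integration.integral_nonneg) (auto simp: comp_def)
    then show ?thesis unfolding bounded_linear_time_average[where X=X and \<omega>=\<omega>, OF that(1) X(2)] using t by simp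
  qed
  have one: "f ?z = 1" if "bounded_linear f" "\<And>z. z \<in> mixed_profiles \<Longrightarrow> f z = 1" for f :: "_ \<Rightarrow> real"
  proof -
    have "integral {0..t} (\<lambda>s. f (X s \<omega>)) = integral {0..t} (\<lambda>s. 1)"
      using that X by (intro Henstock_Kurzweil_Integration.integral_cong) auto
    then show ?thesis unfolding bounded_linear_time_average[where X=X and \<omega>=\<omega>, OF that(1) X(2)] using t by simp
  qed
  have "0 \<le> fst ?z $ a" "0 \<le> snd ?z $ b" for a b
    by (rule nn[OF lin(1)] nn[OF lin(2)]; auto simp: mixed_profiles_def mixed_strategies_def)+
  moreover have "(\<Sum>a\<in>UNIV. fst ?z $ a) = 1" "(\<Sum>b\<in>UNIV. snd ?z $ b) = 1"
    by (rule one[OF lins(1)] one[OF lins(2)]; auto simp: mixed_profiles_def mixed_strategies_def)+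
  ultimately show ?thesis by (simp add: mixed_profiles_def mixed_strategies_def mem_Times_iff)
qed

text \<open>Lipschitz coefficients are bounded on the compact set of profiles, and finiteness of the
  index type yields a common bound: the \<open>c\<close> of the second-moment estimates.\<close>

lemma lipschitz_family_bounded:
  fixes \<sigma> :: "'i::finite \<Rightarrow> 'e::metric_space \<Rightarrow> real"
  assumes K: "compact K" and "\<forall>i. \<exists>L. L-lipschitz_on K (\<sigma> i)"
  obtains c where "\<And>i z. z \<in> K \<Longrightarrow> \<bar>\<sigma> i z\<bar> \<le> c"
proof -
  have "\<exists>c. \<forall>z\<in>K. \<bar>\<sigma> i z\<bar> \<le> c" for i
  proof -
    have "continuous_on K (\<sigma> i)" using assms(2) lipschitz_on_continuous_on by blast
    from compact_imp_bounded[OF compact_continuous_image[OF this K]] show ?thesis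
      by (auto simp: bounded_iff)
  qed
  then obtain c where c: "\<And>i z. z \<in> K \<Longrightarrow> \<bar>\<sigma> i z\<bar> \<le> c i" by metis
  have "\<bar>\<sigma> i z\<bar> \<le> (\<Sum>i\<in>UNIV. \<bar>c i\<bar>)" if "z \<in> K" for i z
    using c[OF that, of i] member_le_sum[of i UNIV "\<lambda>i. \<bar>c i\<bar>"] by force
  then show ?thesis by (rule that)
qed

theorem proposition6p2:
  fixes u1 u2 :: "'a::finite \<Rightarrow> 'b::finite \<Rightarrow> real"
    and M :: "'w measure"
    and F :: "real \<Rightarrow> 'w measure"
    and W :: "'a + 'b \<Rightarrow> real \<Rightarrow> 'w \<Rightarrow> real"
    and \<sigma> :: "'a + 'b \<Rightarrow> (real ^ 'a) \<times> (real ^ 'b) \<Rightarrow> real"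
    and h1 :: "real ^ 'a \<Rightarrow> real" and h2 :: "real ^ 'b \<Rightarrow> real"
    and \<eta>1 \<eta>2 :: "real \<Rightarrow> real"
    and Y1 :: "real \<Rightarrow> 'w \<Rightarrow> real ^ 'a" and Y2 :: "real \<Rightarrow> 'w \<Rightarrow> real ^ 'b"
    and X :: "real \<Rightarrow> 'w \<Rightarrow> (real ^ 'a) \<times> (real ^ 'b)"
  assumes "zero_sum u1 u2"
    and "nash_equilibria u1 u2 \<inter> rel_interior mixed_profiles \<noteq> {}"
    and "prob_space M" and "filtration_on M F" and "independent_wiener M F W"
    and "\<forall>i. \<exists>L. L-lipschitz_on mixed_profiles (\<sigma> i)"
    and "penalty_function h1" and "penalty_function h2"
    and "learning_parameter \<eta>1" and "learning_parameter \<eta>2"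
    and "SRL M F W u1 u2 \<sigma> h1 h2 \<eta>1 \<eta>2 Y1 Y2 X"
  shows "AE \<omega> in M.
           ((\<lambda>t. infdist (time_average X t \<omega>) (nash_equilibria u1 u2)) \<longlongrightarrow> 0) at_top"
proof -
  interpret prob_space M by fact
  note zs = assms(1) and srl = assms(11)[unfolded SRL_def]
  have Xeq: "X t \<omega> = (choice_map h1 (\<eta>1 t *\<^sub>R Y1 t \<omega>), choice_map h2 (\<eta>2 t *\<^sub>R Y2 t \<omega>))"
    if "0 \<le> t" "\<omega> \<in> space M" for t \<omega>
    using srl that by blast
  have Xm: "X t \<omega> \<in> mixed_profiles" if "0 \<le> t" "\<omega> \<in> space M" for t \<omega>
    unfolding Xeq[OF that] mixed_profiles_def
    by (intro SigmaI choice_map_mixed assms(7,8))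
  have Xc: "AE \<omega> in M. continuous_on {0..} (\<lambda>t. X t \<omega>)"
  proof -
    have "AE \<omega> in M. \<forall>a. continuous_on {0..} (\<lambda>t. Y1 t \<omega> $ a)"
      "AE \<omega> in M. \<forall>b. continuous_on {0..} (\<lambda>t. Y2 t \<omega> $ b)"
      using srl by (subst AE_all_countable; simp add: ito_process_def continuous_paths_def)+
    then show ?thesis using AE_space
    proof eventually_elim
      case (elim \<omega>)
      have "continuous_on {0..} (\<lambda>t. (choice_map h1 (\<eta>1 t *\<^sub>R Y1 t \<omega>), choice_map h2 (\<eta>2 t *\<^sub>R Y2 t \<omega>)))"
        using elim(1,2)
        by (intro continuous_on_Pair
            choice_path_continuous[OF assms(7) learning_parameter_continuous[OF assms(9)]]
            choice_path_continuous[OF assms(8) learning_parameter_continuous[OF assms(10)]]) auto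
      then show ?case by (rule continuous_on_eq) (simp add: Xeq elim)
    qed
  qed
  obtain c where c: "\<And>i z. z \<in> mixed_profiles \<Longrightarrow> \<bar>\<sigma> i z\<bar> \<le> c"
    using lipschitz_family_bounded[OF compact_mixed_profiles assms(6)] by blast
  have wiener: "standard_wiener M F (W i)" for i
    using assms(5) by (simp add: independent_wiener_def)
  have vc: "continuous_on {0..} (\<lambda>t. payoff_vector1 u1 (X t \<omega>))"
    "continuous_on {0..} (\<lambda>t. payoff_vector2 u2 (X t \<omega>))"
    if "continuous_on {0..} (\<lambda>t. X t \<omega>)" for \<omega>
  proof -
    have "continuous_on {0..} (\<lambda>t. \<chi> a. payoff_vector1 u1 (X t \<omega>) $ a)"
      "continuous_on {0..} (\<lambda>t. \<chi> b. payoff_vector2 u2 (X t \<omega>) $ b)"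
      by (intro continuous_on_vec_lambda bounded_linear.continuous_on[OF bounded_linear_payoff_vector(1)]
          bounded_linear.continuous_on[OF bounded_linear_payoff_vector(2)] that)+
    then show "continuous_on {0..} (\<lambda>t. payoff_vector1 u1 (X t \<omega>))"
      "continuous_on {0..} (\<lambda>t. payoff_vector2 u2 (X t \<omega>))" by simp_all
  qed
  \<comment> \<open>The opponent's play is absorbed into the drift, so each learner is treated
    separately.\<close>
  interpret p1: perturbed_learner M F "\<lambda>a. W (Inl a)" "\<lambda>t \<omega>. payoff_vector1 u1 (X t \<omega>)"
      "\<lambda>a t \<omega>. \<sigma> (Inl a) (X t \<omega>)" Y1 h1 \<eta>1 "\<lambda>t \<omega>. fst (X t \<omega>)" c "\<Sum>a\<in>UNIV. \<Sum>b\<in>UNIV. \<bar>u1 a b\<bar>"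
  proof unfold_locales
    show "AE \<omega> in M. continuous_on {0..} (\<lambda>t. payoff_vector1 u1 (X t \<omega>))"
      using Xc by eventually_elim (rule vc)
    show "ito_process M F (W (Inl a)) (\<lambda>t \<omega>. payoff_vector1 u1 (X t \<omega>) $ a)
        (\<lambda>t \<omega>. \<sigma> (Inl a) (X t \<omega>)) (\<lambda>t \<omega>. Y1 t \<omega> $ a)" for a
      using srl by blast
    show "\<bar>\<sigma> (Inl a) (X t \<omega>)\<bar> \<le> c" if "0 \<le> t" "\<omega> \<in> space M" for a t \<omega>
      by (rule c[OF Xm[OF that]])
    show "\<bar>payoff_vector1 u1 (X t \<omega>) $ a\<bar> \<le> (\<Sum>a\<in>UNIV. \<Sum>b\<in>UNIV. \<bar>u1 a b\<bar>)"
      if "0 \<le> t" "\<omega> \<in> space M" for a t \<omega>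
      by (rule payoff_vector_bound[OF Xm[OF that]])
  qed (simp_all add: assms wiener Xeq)
  interpret p2: perturbed_learner M F "\<lambda>b. W (Inr b)" "\<lambda>t \<omega>. payoff_vector2 u2 (X t \<omega>)"
      "\<lambda>b t \<omega>. \<sigma> (Inr b) (X t \<omega>)" Y2 h2 \<eta>2 "\<lambda>t \<omega>. snd (X t \<omega>)" c "\<Sum>a\<in>UNIV. \<Sum>b\<in>UNIV. \<bar>u2 a b\<bar>"
  proof unfold_locales
    show "AE \<omega> in M. continuous_on {0..} (\<lambda>t. payoff_vector2 u2 (X t \<omega>))"
      using Xc by eventually_elim (rule vc)
    show "ito_process M F (W (Inr b)) (\<lambda>t \<omega>. payoff_vector2 u2 (X t \<omega>) $ b)
        (\<lambda>t \<omega>. \<sigma> (Inr b) (X t \<omega>)) (\<lambda>t \<omega>. Y2 t \<omega> $ b)" for b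
      using srl by blast
    show "\<bar>\<sigma> (Inr b) (X t \<omega>)\<bar> \<le> c" if "0 \<le> t" "\<omega> \<in> space M" for b t \<omega>
      by (rule c[OF Xm[OF that]])
    show "\<bar>payoff_vector2 u2 (X t \<omega>) $ b\<bar> \<le> (\<Sum>a\<in>UNIV. \<Sum>b\<in>UNIV. \<bar>u2 a b\<bar>)"
      if "0 \<le> t" "\<omega> \<in> space M" for b t \<omega>
      by (rule payoff_vector_bound[OF Xm[OF that]])
  qed (simp_all add: assms wiener Xeq)
  \<comment> \<open>One gap for each pair of pure deviations: a finite family of functions, each
    linear in the profile.\<close>
  define \<phi> where "\<phi> i z = payoff_vector1 u1 z $ fst i + payoff_vector2 u2 z $ snd i" for i :: "'a \<times> 'b" and z
  have \<phi>: "bounded_linear (\<phi> i)" for i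
    unfolding \<phi>_def by (intro bounded_linear_add bounded_linear_payoff_vector)
  from p1.no_regret p2.no_regret Xc AE_space show ?thesis
  proof eventually_elim
    case (elim \<omega>)
    note xc = elim(3) and \<omega> = elim(4)
    have Xi: "(\<lambda>s. X s \<omega>) integrable_on {0..t}" for t
      by (intro integrable_continuous_real continuous_on_subset[OF xc]) auto
    show ?case
    proof (rule infdist_tendsto_0_from_gaps[OF compact_mixed_profiles, where \<phi>=\<phi>])
      show "\<forall>\<^sub>F t in at_top. time_average X t \<omega> \<in> mixed_profiles"
        using eventually_gt_at_top[of 0]
        by eventually_elim (rule time_average_mixed[where X=X and \<omega>=\<omega>, OF Xm[OF _ \<omega>] Xi])
      show "continuous_on mixed_profiles (\<phi> i)" for i
        by (rule linear_continuous_on[OF \<phi>])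
      show "nash_equilibria u1 u2 \<noteq> {}" using assms(2) by blast
      show "z \<in> nash_equilibria u1 u2" if "z \<in> mixed_profiles" "\<And>i. \<phi> i z \<le> 0" for z
        using that(2)[of "(_, _)"] by (intro nash_equilibriumI_gap[OF zs that(1)]) (simp add: \<phi>_def)
      fix i :: "'a \<times> 'b" and e :: real assume e: "0 < e"
      then have "0 < e / 2" by simp
      with elim(1,2) have
        "\<forall>\<^sub>F t in at_top. integral {0..t} (\<lambda>r. payoff_vector1 u1 (X r \<omega>) $ fst i - payoff_vector1 u1 (X r \<omega>) \<bullet> fst (X r \<omega>)) \<le> e / 2 * t"
        "\<forall>\<^sub>F t in at_top. integral {0..t} (\<lambda>r. payoff_vector2 u2 (X r \<omega>) $ snd i - payoff_vector2 u2 (X r \<omega>) \<bullet> snd (X r \<omega>)) \<le> e / 2 * t"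
        by blast+
      then show "\<forall>\<^sub>F t in at_top. \<phi> i (time_average X t \<omega>) \<le> e"
        using eventually_gt_at_top[of 0]
      proof eventually_elim
        case (elim t)
        let ?f = "\<lambda>r. payoff_vector1 u1 (X r \<omega>) $ fst i - payoff_vector1 u1 (X r \<omega>) \<bullet> fst (X r \<omega>)"
        let ?g = "\<lambda>r. payoff_vector2 u2 (X r \<omega>) $ snd i - payoff_vector2 u2 (X r \<omega>) \<bullet> snd (X r \<omega>)"
        have "?f integrable_on {0..t}" "?g integrable_on {0..t}"
          by (intro integrable_continuous_real continuous_on_subset[of "{0..}" _ "{0..t}"] continuous_intros vc xc; simp)+
        then have "integral {0..t} ?f + integral {0..t} ?g = integral {0..t} (\<lambda>r. ?f r + ?g r)"
          by (rule Henstock_Kurzweil_Integration.integral_add[symmetric])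
        \<comment> \<open>The realised payoffs of the two players cancel because the game is
          zero-sum; what remains is linear in the play.\<close>
        also have "(\<lambda>r. ?f r + ?g r) = (\<lambda>r. \<phi> i (X r \<omega>))"
          by (simp add: fun_eq_iff payoff_vector_inner \<phi>_def mixed_payoff_zero_sum[OF zs])
        finally have "integral {0..t} (\<lambda>r. \<phi> i (X r \<omega>)) \<le> e * t" using elim by (simp add: field_simps)
        then show ?case
          unfolding bounded_linear_time_average[where X=X and \<omega>=\<omega>, OF \<phi> Xi] using elim(3) by (simp add: divide_le_eq)
      qed
    qed
  qed
qed

end
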